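(* The only minimal admissible $SU_{1,n}$-manifold of the class II is the manifold $M=SU_{1,n}/U_{n-1}$ with the reductive decomposition $$\mathfrak{su}_{1,n}=(\mathfrak{su}_{n-1}+\mathbb Rz)+(\mathbb Rz'+\mathfrak n'+\mathbb Cv+\mathfrak p'),$$ where $\mathfrak h=\mathfrak{su}_{n-1}+\mathbb Rz$ and the central element $z\in\mathfrak h$ acts (via $j(z)$) as $0$ on $\mathfrak{su}_{n-1}$, $\mathbb Rz$, $\mathbb R z'$ and $\mathbb Cv$, and as multiplication by $-\frac{n+1}{n-1}i$ on $\mathfrak n'$ and on $\mathfrak p'$.
   Context: $V=\mathbb C^{1,n}$ is the pseudo-Hermitian space of complex signature $(1,n)$ with orthonormal basis $e_0,e_1,\dots,e_n$, $\langle e_0,e_0\rangle=-1$, $\langle e_1,e_1\rangle=1$, and orthogonal decomposition $V=\mathbb Ce_0+\mathbb Ce_1+W$, $W\simeq\mathbb C^{n-1}$. Let $K=U_n$ with symmetric decomposition $\mathfrak{su}_{1,n}=\mathfrak u_n+\mathfrak p$, where $\mathfrak u_n=\{\mathrm{diag}(-\mathrm{tr}A,A)\}$, $A$ skew-Hermitian $n\times n$, and $\mathfrak p=\left\{\begin{pmatrix} 0 & X^* \\ X & 0 \end{pmatrix}: X\in\mathbb C^n\right\}$, $X^*=\bar X^t$, identified with $\mathbb C^n$. In these terms, $v\in\mathfrak p$ corresponds to $X=(1,0,\dots,0)^t$; $\mathbb Cv$ corresponds to $X=(c,0,\dots,0)^t$, $c\in\mathbb C$; $\mathfrak p'\simeq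 W$ corresponds to $X=(0,w)^t$, $w\in W=\mathbb C^{n-1}$. Further $\mathfrak{su}_{n-1}=\mathfrak{su}(W)$ acts trivially on $e_0,e_1$; $z=i\,\mathrm{diag}(1,1,-\frac{2}{n-1}\mathrm{Id}_W)$; $z'=i\,\mathrm{diag}(1,-1,0_{n-1})$; and $\mathfrak n'\simeq W$ is the subspace of $\mathfrak u_n$ consisting of the elements whose $A$-component, in the decomposition $\mathbb Ce_1+W$, is $\begin{pmatrix} 0 & -w^* \\ w & 0 \end{pmatrix}$, $w\in W$. The subgroup $H=K_v\simeq U_{n-1}$ is the connected stabilizer of $v$ in $K$, with Lie algebra $\mathfrak h=\mathfrak{su}_{n-1}+\mathbb Rz$; $j$ denotes the isotropy representation. Lie groups and stability subgroups are connected. A homogeneous manifold $G/H$ with compact connected $H$ is admissible if it admits a $G$-invariant Lorentzian metric; it is minimal admissible if there is no connected compact subgroup $\tilde H$ containing $H$ properly with $G/\tilde H$ admissible. For $H\subset K$, an admissible manifold $G/H$ belongs to the class II if the space $\mathfrak p^H$ of $\mathrm{Ad}_H$-invariant vectors in $\mathfrak p$ is non-zero.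
   Formalization: H is the connected stabilizer K_v; read as a group isomorphism, K_v ≃ U_{n-1} fails in general (for n=3, K_v is U_1×SU_2), so it is replaced by a surjective homomorphism K_v → U(W) with finite kernel that is an isomorphism of Lie algebras. *)

theory Defs
  imports "HOL-Analysis.Analysis"
begin

(* The coordinates of C^{1,n} are indexed by 'n option: None is e_0 and Some ranges over the
   n-element index type 'n of C e_1 + W.  Where e_1 has to be singled out, 'n is 'w option: then
   Some None is e_1, the Some (Some i) are the basis of W, dim W = CARD('w) = n - 1 >= 1, and
   n = CARD('w option) >= 2. *)

type_synonym 'n mat1 = "complex^('n option)^('n option)"
type_synonym 'w mat2 = "complex^('w option option)^('w option option)"

definition vcons :: "complex \<Rightarrow> complex^'n \<Rightarrow> complex^('n option)"
  where "vcons c w = (\<chi> i. case i of None \<Rightarrow> c | Some j \<Rightarrow> w $ j)"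

(* (a, b^t; c, A) *)
definition block_mat ::
    "complex \<Rightarrow> complex^'n \<Rightarrow> complex^'n \<Rightarrow> complex^'n^'n \<Rightarrow> complex^('n option)^('n option)"
  where "block_mat a b c A =
    (\<chi> i j. case i of
        None \<Rightarrow> (case j of None \<Rightarrow> a | Some j' \<Rightarrow> b $ j')
      | Some i' \<Rightarrow> (case j of None \<Rightarrow> c $ i' | Some j' \<Rightarrow> A $ i' $ j'))"

definition vcnj :: "complex^'n \<Rightarrow> complex^'n"
  where "vcnj x = (\<chi> i. cnj (x $ i))"

definition cadj :: "complex^'n^'n \<Rightarrow> complex^'n^'n"
  where "cadj A = (\<chi> i j. cnj (A $ j $ i))"

definition bracket :: "complex^'n^'n \<Rightarrow> complex^'n^'n \<Rightarrow> complex^'n^'n"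
  where "bracket X Y = X ** Y - Y ** X"

definition conj_by :: "complex^'n^'n \<Rightarrow> complex^'n^'n \<Rightarrow> complex^'n^'n"
  where "conj_by g X = g ** X ** matrix_inv g"

definition unitary_group :: "(complex^'n^'n) set"
  where "unitary_group = {A. cadj A ** A = mat 1}"

definition skew_hermitian :: "(complex^'n^'n) set"
  where "skew_hermitian = {A. cadj A = - A}"

definition form_J :: "'n::finite mat1"
  where "form_J = block_mat (-1) 0 0 (mat 1)"

definition SU1n :: "'n::finite mat1 set"
  where "SU1n = {g. cadj g ** form_J ** g = form_J \<and> det g = 1}"

definition su1n :: "'n::finite mat1 set"
  where "su1n = {X. cadj X ** form_J + form_J ** X = 0 \<and> trace X = 0}"

definition K_group :: "'n::finite mat1 set"
  where "K_group = {block_mat (inverse (det A)) 0 0 A | A. A \<in> unitary_group}"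

definition p_mat :: "complex^'n \<Rightarrow> 'n::finite mat1"
  where "p_mat X = block_mat 0 (vcnj X) X 0"

definition p_space :: "'n::finite mat1 set"
  where "p_space = range p_mat"

definition cc_subgroup :: "'n::finite mat1 set \<Rightarrow> bool"
  where "cc_subgroup H \<longleftrightarrow> H \<subseteq> SU1n \<and> mat 1 \<in> H \<and> (\<forall>g\<in>H. \<forall>h\<in>H. g ** h \<in> H) \<and>
    (\<forall>h\<in>H. matrix_inv h \<in> H) \<and> compact H \<and> connected H"

(* Tangent space at the identity; only used for compact (hence closed) subgroups. *)
definition lie_algebra :: "(complex^'n^'n) set \<Rightarrow> (complex^'n^'n) set"
  where "lie_algebra H = {X. \<exists>\<gamma>. (\<forall>t::real. \<gamma> t \<in> H) \<and> \<gamma> 0 = mat 1 \<and>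
    (\<gamma> has_vector_derivative X) (at 0)}"

(* T_g G, and the subspace T_g (gH) of vectors vertical for the projection G -> G/H. *)
definition tangent_G :: "'n::finite mat1 \<Rightarrow> 'n mat1 set"
  where "tangent_G g = (\<lambda>X. g ** X) ` su1n"

definition vertical :: "'n::finite mat1 set \<Rightarrow> 'n mat1 \<Rightarrow> 'n mat1 set"
  where "vertical H g = (\<lambda>X. g ** X) ` lie_algebra H"

definition symmetric_bilinear_on ::
    "'v::real_vector set \<Rightarrow> ('v \<Rightarrow> 'v \<Rightarrow> real) \<Rightarrow> bool"
  where "symmetric_bilinear_on S B \<longleftrightarrow>
    (\<forall>x\<in>S. \<forall>y\<in>S. B x y = B y x) \<and>
    (\<forall>x\<in>S. \<forall>y\<in>S. \<forall>z\<in>S. B (x + y) z = B x z + B y z) \<and>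
    (\<forall>c. \<forall>x\<in>S. \<forall>y\<in>S. B (c *\<^sub>R x) y = c * B x y)"

(* B is a symmetric bilinear form on S that induces on S/N a (well-defined, nondegenerate) form of
   signature (-,+,...,+): the images of e0 and of the elements of E are an orthonormal basis of
   S/N. *)
definition lorentzian_mod ::
    "'v::real_vector set \<Rightarrow> 'v set \<Rightarrow> ('v \<Rightarrow> 'v \<Rightarrow> real) \<Rightarrow> bool"
  where "lorentzian_mod S N B \<longleftrightarrow>
    symmetric_bilinear_on S B \<and> N \<subseteq> S \<and> (\<forall>x\<in>N. \<forall>y\<in>S. B x y = 0) \<and>
    (\<exists>e0 E. e0 \<in> S \<and> E \<subseteq> S \<and> finite E \<and>
       B e0 e0 = - 1 \<and> (\<forall>e\<in>E. B e0 e = 0) \<and>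
       (\<forall>e\<in>E. \<forall>f\<in>E. B e f = (if e = f then 1 else 0)) \<and>
       S = {x + y | x y. x \<in> span (insert e0 E) \<and> y \<in> N})"

(* A G-invariant Lorentzian metric on G/H, given by its pullback q along the projection G -> G/H,
   where T_{gH}(G/H) = T_g G / T_g(gH): q_g induces a Lorentzian form on this quotient; it does not
   depend on the representative g of gH, since the differential of the projection takes the same
   value on X at g and on X h at gh; and it is invariant under left translations by G.  No
   smoothness condition is needed: by left invariance the coefficients q_g(gX, gY) of q in a
   left-invariant frame are constant. *)
definition invariant_lorentz_metric ::
    "'n::finite mat1 set \<Rightarrow> ('n mat1 \<Rightarrow> 'n mat1 \<Rightarrow> 'n mat1 \<Rightarrow> real) \<Rightarrow> bool"
  where "invariant_lorentz_metric H q \<longleftrightarrow>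
    (\<forall>g\<in>SU1n. lorentzian_mod (tangent_G g) (vertical H g) (q g)) \<and>
    (\<forall>g\<in>SU1n. \<forall>h\<in>H. \<forall>X\<in>tangent_G g. \<forall>Y\<in>tangent_G g.
       q (g ** h) (X ** h) (Y ** h) = q g X Y) \<and>
    (\<forall>a\<in>SU1n. \<forall>g\<in>SU1n. \<forall>X\<in>tangent_G g. \<forall>Y\<in>tangent_G g.
       q (a ** g) (a ** X) (a ** Y) = q g X Y)"

definition admissible :: "'n::finite mat1 set \<Rightarrow> bool"
  where "admissible H \<longleftrightarrow> cc_subgroup H \<and> (\<exists>q. invariant_lorentz_metric H q)"

definition minimal_admissible :: "'n::finite mat1 set \<Rightarrow> bool"
  where "minimal_admissible H \<longleftrightarrow>
    admissible H \<and> \<not> (\<exists>H'. cc_subgroup H' \<and> H \<subset> H' \<and> admissible H')"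

definition class_II :: "'n::finite mat1 set \<Rightarrow> bool"
  where "class_II H \<longleftrightarrow> admissible H \<and> H \<subseteq> K_group \<and>
    (\<exists>X\<in>p_space. X \<noteq> 0 \<and> (\<forall>h\<in>H. conj_by h X = X))"

definition v_elt :: "'w::finite mat2"
  where "v_elt = p_mat (vcons 1 0)"

definition K_v :: "'w::finite mat2 set"
  where "K_v = connected_component_set {k \<in> K_group. conj_by k v_elt = v_elt} (mat 1)"

definition su_W :: "'w::finite mat2 set"
  where "su_W = {block_mat 0 0 0 (block_mat 0 0 0 B) | B. B \<in> skew_hermitian \<and> trace B = 0}"

definition z_elt :: "'w::finite mat2"
  where "z_elt = block_mat \<i> 0 0 (block_mat \<i> 0 0 (mat (- (2 / of_nat CARD('w)) * \<i>)))"

definition z'_elt :: "'w::finite mat2"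
  where "z'_elt = block_mat \<i> 0 0 (block_mat (- \<i>) 0 0 0)"

definition n'_mat :: "complex^'w \<Rightarrow> 'w::finite mat2"
  where "n'_mat w = block_mat 0 0 0 (block_mat 0 (- vcnj w) w 0)"

definition Cv_mat :: "complex \<Rightarrow> 'w::finite mat2"
  where "Cv_mat c = p_mat (vcons c 0)"

definition p'_mat :: "complex^'w \<Rightarrow> 'w::finite mat2"
  where "p'_mat w = p_mat (vcons 0 w)"

definition real_line :: "'v::real_vector \<Rightarrow> 'v set"
  where "real_line x = range (\<lambda>t. t *\<^sub>R x)"

definition W_block :: "'w::finite mat2 \<Rightarrow> complex^'w^'w"
  where "W_block g = (\<chi> i j. g $ Some (Some i) $ Some (Some j))"

definition sum_spaces :: "'v::real_vector set list \<Rightarrow> 'v set"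
  where "sum_spaces Us = sum_list ` listset Us"

definition direct_sum_of :: "'v::real_vector set \<Rightarrow> 'v set list \<Rightarrow> bool"
  where "direct_sum_of S Us \<longleftrightarrow>
    (\<forall>U\<in>set Us. subspace U) \<and> S = sum_spaces Us \<and> inj_on sum_list (listset Us)"

(* The subspaces h and m of the reductive decomposition. *)
definition h_space :: "'w::finite mat2 set"
  where "h_space = sum_spaces [su_W, real_line z_elt]"

definition m_space :: "'w::finite mat2 set"
  where "m_space = sum_spaces [real_line z'_elt, range n'_mat, range Cv_mat, range p'_mat]"

(* The relation in which "H is U_{n-1}": the groups K_v and U_{n-1} = U(W) are in general not
   isomorphic; rather, g = diag(a, a, B) |-> B is a homomorphism of K_v onto U(W)
   with finite kernel, inducing an isomorphism of h with the Lie algebra of U(W). *)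
definition W_block_covering :: "'w::finite mat2 set \<Rightarrow> bool"
  where "W_block_covering H \<longleftrightarrow>
    (\<forall>g\<in>H. \<forall>h\<in>H. W_block (g ** h) = W_block g ** W_block h) \<and>
    W_block ` H = unitary_group \<and> finite {g \<in> H. W_block g = mat 1} \<and>
    bij_betw W_block (lie_algebra H) skew_hermitian \<and>
    (\<forall>X\<in>lie_algebra H. \<forall>Y\<in>lie_algebra H.
       W_block (bracket X Y) = bracket (W_block X) (W_block Y))"

end

theory Submission
  imports Defs
begin

text \<open>
  Write \<open>U\<close> for the plane of \<open>e\<^sub>0\<close> and \<open>e\<^sub>1\<close>. The stabilizer of \<open>v\<close> in \<open>K\<close> consists of the matrices that are a
  scalar \<open>a\<close> on \<open>U\<close> and a unitary \<open>B\<close> on \<open>W\<close>, with \<open>a\<^sup>2 det B = 1\<close> (\<open>v_stabilizer_eq\<close>). This double covering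
  of \<open>U(W)\<close> is connected (\<open>connected_v_stabilizer\<close>), so it is \<open>K\<^sub>v\<close>, and its Lie algebra is computed with the
  Cayley transform (\<open>lie_algebra_K_v\<close>). A metric on \<open>G/H\<close> is the same as an \<open>Ad\<^sub>H\<close>-invariant form on
  the Lie algebra \<open>g\<close> of \<open>G\<close> with radical the Lie algebra of \<open>H\<close> that is Lorentzian
  on the quotient (\<open>admissible_iff\<close>); on the complement of \<open>h\<close>, which
  contains the fixed vectors \<open>z'\<close> and \<open>v\<close>, an obvious form shows that \<open>K\<^sub>v\<close> is admissible.

  Uniqueness up to conjugation: a group of class II fixes a vector of \<open>p\<close>, and \<open>K\<close> is transitive on the
  spheres of \<open>p\<close>, so the group lies in a conjugate of \<open>K\<^sub>v\<close>, which is admissible; minimality gives equality.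

  Minimality of \<open>K\<^sub>v\<close> is the main point. Let \<open>H\<close> be an admissible compact connected overgroup, with Lie algebra
  \<open>L\<close> and invariant form \<open>b\<close>. Overgroups need not lie in \<open>K\<close>. The element of \<open>K\<^sub>v\<close> that acts as \<open>\<i>\<close> on
  \<open>n' + p'\<close> and trivially on \<open>h + \<real> z' + \<complex> v\<close> makes these two spaces orthogonal for \<open>b\<close>, splits \<open>L\<close>, and makes the
  negative index of \<open>b\<close> on \<open>n' + p'\<close> even, hence zero; so there is a timelike \<open>a\<close> in \<open>\<real> z' + \<complex> v\<close>, a copy of
  \<open>su(1,1)\<close>. An element \<open>y\<close> of \<open>L\<close> in this \<open>su(1,1)\<close> vanishes: if it is hyperbolic or parabolic because \<open>H\<close>
  preserves a norm (\<open>su11_compact_elliptic\<close>), and if it is elliptic because then \<open>[y, a]\<close> would be a second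
  timelike vector orthogonal to \<open>a\<close> (\<open>lie_algebra_su11_trivial\<close>). An element \<open>\<xi>\<close> of \<open>L\<close> in \<open>n' + p'\<close> vanishes because the
  component of \<open>[\<xi>, \<i> \<xi>]\<close> in \<open>su(1,1)\<close> does. Hence \<open>L = h\<close> (\<open>lie_algebra_eq_h_space\<close>).

  So \<open>H\<close> normalizes \<open>h\<close>, therefore commutes with \<open>z\<close> (\<open>normalizer_centralizes_z\<close>) and preserves \<open>U\<close> and \<open>W\<close>.
  If \<open>H\<close> were larger than \<open>K\<^sub>v\<close>, connectedness would give elements of \<open>H\<close> outside \<open>K\<^sub>v\<close> arbitrarily close to the
  identity, which can be corrected by \<open>K\<^sub>v\<close> to act trivially on \<open>W\<close>; a limit of their directions is a tangent vector
  of \<open>H\<close> (\<open>tangent_direction_in_lie_algebra\<close>) outside \<open>h\<close>, a contradiction (\<open>overgroup_eq_K_v\<close>).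
\<close>

section \<open>Complex matrices\<close>

lemma matrix_add_rdistrib': "(A + B) ** C = A ** C + B ** (C::complex^'n^'m)"
  by (simp add: vec_eq_iff matrix_matrix_mult_def sum.distrib algebra_simps)

lemma matrix_diff_ldistrib: "A ** (B - C) = A ** B - A ** (C::complex^'n^'m)"
  by (simp add: vec_eq_iff matrix_matrix_mult_def sum_subtractf algebra_simps)

lemma matrix_diff_rdistrib: "(A - B) ** C = A ** C - B ** (C::complex^'n^'m)"
  by (simp add: vec_eq_iff matrix_matrix_mult_def sum_subtractf algebra_simps)

lemma matrix_scaleR_left: "(r *\<^sub>R A) ** C = r *\<^sub>R (A ** (C::complex^'n^'m))"
  by (simp add: vec_eq_iff matrix_matrix_mult_def scaleR_sum_right)

lemma matrix_scaleR_right: "A ** (r *\<^sub>R C) = r *\<^sub>R (A ** (C::complex^'n^'m))"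
  by (simp add: vec_eq_iff matrix_matrix_mult_def scaleR_sum_right)

lemma matrix_minus_left: "(- A) ** C = - (A ** (C::complex^'n^'m))"
  by (simp add: vec_eq_iff matrix_matrix_mult_def sum_negf)

lemma matrix_minus_right: "A ** (- C) = - (A ** (C::complex^'n^'m))"
  by (simp add: vec_eq_iff matrix_matrix_mult_def sum_negf)

lemma matrix_zero_left [simp]: "0 ** A = (0::complex^'n^'m)"
  by (simp add: vec_eq_iff matrix_matrix_mult_def)

lemma matrix_zero_right [simp]: "A ** 0 = (0::complex^'n^'m)"
  by (simp add: vec_eq_iff matrix_matrix_mult_def)

lemmas matrix_ring_simps = matrix_add_ldistrib matrix_add_rdistrib' matrix_diff_ldistrib
  matrix_diff_rdistrib matrix_scaleR_left matrix_scaleR_right matrix_minus_left matrix_minus_right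

lemma bounded_bilinear_matrix_mult:
  "bounded_bilinear ((**) :: complex^'n^'m \<Rightarrow> complex^'p^'n \<Rightarrow> complex^'p^'m)"
  unfolding bilinear_conv_bounded_bilinear [symmetric] bilinear_def
  by (auto intro!: linearI simp: matrix_ring_simps)

lemma bounded_bilinear_matrix_vector:
  "bounded_bilinear ((*v) :: complex^'n^'m \<Rightarrow> complex^'n \<Rightarrow> complex^'m)"
  unfolding bilinear_conv_bounded_bilinear [symmetric] bilinear_def
  by (auto intro!: linearI
      simp: vec_eq_iff matrix_vector_mult_def sum.distrib scaleR_sum_right algebra_simps)

lemmas tendsto_matrix_mult [tendsto_intros] =
  bounded_bilinear.tendsto [OF bounded_bilinear_matrix_mult]

lemmas continuous_on_matrix_mult [continuous_intros] =
  bounded_bilinear.continuous_on [OF bounded_bilinear_matrix_mult]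

lemma matrix_inv_unique:
  fixes A :: "complex^'n^'n"
  assumes "A ** B = mat 1"
  shows "matrix_inv A = B"
proof -
  have BA: "B ** A = mat 1"
    using assms matrix_left_right_inverse by blast
  have "A ** matrix_inv A = mat 1 \<and> matrix_inv A ** A = mat 1"
    unfolding matrix_inv_def by (rule someI_ex) (use assms BA in blast)
  then have "B ** (A ** matrix_inv A) = B"
    by simp
  then show ?thesis
    by (simp add: matrix_mul_assoc BA)
qed

lemma matrix_inv_left_right:
  fixes A :: "complex^'n^'n"
  assumes "invertible A"
  shows "A ** matrix_inv A = mat 1" "matrix_inv A ** A = mat 1"
  using assms matrix_inv_unique matrix_left_right_inverse unfolding invertible_def by metis+

lemma matrix_inv_mat_1 [simp]: "matrix_inv (mat 1) = (mat 1 :: complex^'n^'n)"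
  by (rule matrix_inv_unique) simp

lemma matrix_inv_inv:
  fixes A :: "complex^'n^'n"
  assumes "invertible A"
  shows "matrix_inv (matrix_inv A) = A"
  by (rule matrix_inv_unique) (rule matrix_inv_left_right [OF assms])

lemma matrix_inv_mult:
  fixes A B :: "complex^'n^'n"
  assumes "invertible A" "invertible B"
  shows "matrix_inv (A ** B) = matrix_inv B ** matrix_inv A"
proof (rule matrix_inv_unique)
  have "A ** B ** (matrix_inv B ** matrix_inv A) = A ** (B ** matrix_inv B) ** matrix_inv A"
    by (simp only: matrix_mul_assoc)
  then show "A ** B ** (matrix_inv B ** matrix_inv A) = mat 1"
    using assms by (simp add: matrix_inv_left_right)
qed

lemma invertible_matrix_inv:
  fixes A :: "complex^'n^'n"
  assumes "invertible A"
  shows "invertible (matrix_inv A)"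
  using matrix_inv_left_right [OF assms] unfolding invertible_def by blast

lemma cadj_nth [simp]: "cadj A $ i $ j = cnj (A $ j $ i)"
  by (simp add: cadj_def)

lemma cadj_mult: "cadj (A ** B) = cadj B ** cadj A"
  by (simp add: vec_eq_iff matrix_matrix_mult_def mult.commute)

lemma cadj_cadj [simp]: "cadj (cadj A) = A"
  by (simp add: vec_eq_iff)

lemma cadj_mat_1 [simp]: "cadj (mat 1) = mat 1"
  by (simp add: vec_eq_iff mat_def)

lemma cadj_add: "cadj (A + B) = cadj A + cadj B"
  by (simp add: vec_eq_iff)

lemma cadj_diff: "cadj (A - B) = cadj A - cadj B"
  by (simp add: vec_eq_iff)

lemma cadj_scaleR: "cadj (r *\<^sub>R A) = r *\<^sub>R cadj A"
  by (simp add: vec_eq_iff)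

lemma bounded_linear_cadj: "bounded_linear (cadj :: complex^'n^'n \<Rightarrow> _)"
  by (auto intro!: linearI simp: linear_conv_bounded_linear [symmetric] cadj_add cadj_scaleR)

lemmas tendsto_cadj [tendsto_intros] = bounded_linear.tendsto [OF bounded_linear_cadj]

lemmas continuous_on_cadj [continuous_intros] = bounded_linear.continuous_on [OF bounded_linear_cadj]

lemma det_cadj: "det (cadj A) = cnj (det A)"
proof -
  have "det (cadj A) = det (transpose (cadj A))"
    by simp
  also have "\<dots> = cnj (det A)"
    unfolding det_def by (simp add: transpose_def)
  finally show ?thesis .
qed

lemma continuous_on_det [continuous_intros]:
  fixes f :: "'a::topological_space \<Rightarrow> complex^'n^'n"
  assumes "continuous_on S f"
  shows "continuous_on S (\<lambda>x. det (f x))"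
  unfolding det_def by (intro continuous_intros assms)

lemma tendsto_det [tendsto_intros]:
  fixes f :: "'a \<Rightarrow> complex^'n^'n"
  assumes "(f \<longlongrightarrow> A) F"
  shows "((\<lambda>x. det (f x)) \<longlongrightarrow> det A) F"
  unfolding det_def by (intro tendsto_intros assms)

lemma has_vector_derivative_nth:
  "(f has_vector_derivative X) F \<Longrightarrow> ((\<lambda>t. f t $ i) has_vector_derivative X $ i) F"
  by (rule bounded_linear.has_vector_derivative [OF bounded_linear_vec_nth])

text \<open>Near the identity a product over a non-trivial permutation has at least two factors that
  vanish at the identity, so only the product of the diagonal entries contributes to first
  order.\<close>

lemma has_vector_derivative_det_at_1:
  fixes \<gamma> :: "real \<Rightarrow> complex^'n^'n"
  assumes d: "(\<gamma> has_vector_derivative X) (at t)" and \<gamma>: "\<gamma> t = mat 1"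
  shows "((\<lambda>t. det (\<gamma> t)) has_vector_derivative trace X) (at t)"
proof -
  let ?P = "{p. p permutes (UNIV::'n set)}"
  define D where "D p h = (\<Sum>i\<in>UNIV. (h *\<^sub>R X $ i $ p i) * (\<Prod>j\<in>UNIV - {i}. \<gamma> t $ j $ p j))"
    for p :: "'n \<Rightarrow> 'n" and h :: real
  have e: "((\<lambda>t. \<gamma> t $ i $ j) has_derivative (\<lambda>h. h *\<^sub>R X $ i $ j)) (at t)" for i j
    using has_vector_derivative_nth [OF has_vector_derivative_nth [OF d]]
    unfolding has_vector_derivative_def .
  have "((\<lambda>t. of_int (sign p) * (\<Prod>i\<in>UNIV. \<gamma> t $ i $ p i)) has_derivative
      (\<lambda>h. of_int (sign p) * D p h)) (at t)" for p
    unfolding D_def by (intro has_derivative_mult_right has_derivative_prod e)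
  then have main: "((\<lambda>t. det (\<gamma> t)) has_derivative (\<lambda>h. \<Sum>p\<in>?P. of_int (sign p) * D p h)) (at t)"
    unfolding det_def by (intro has_derivative_sum) auto
  have D0: "D p h = 0" if p: "p \<in> ?P" "p \<noteq> id" for p h
  proof -
    have "(\<Prod>j\<in>UNIV - {i}. \<gamma> t $ j $ p j) = 0" for i
    proof -
      obtain k where k: "p k \<noteq> k"
        using p(2) by (auto simp: fun_eq_iff)
      then have "p (p k) \<noteq> p k"
        using p(1) by (auto dest!: permutes_inj simp: inj_eq)
      with k obtain j where "j \<noteq> i" "p j \<noteq> j"
        by (cases "k = i") auto
      then have "\<exists>j\<in>UNIV - {i}. \<gamma> t $ j $ p j = 0"
        by (intro bexI [of _ j]) (auto simp: \<gamma> mat_def)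
      then show ?thesis
        by (intro prod_zero) auto
    qed
    then show ?thesis
      unfolding D_def by (intro sum.neutral) simp
  qed
  have "D id h = h *\<^sub>R trace X" for h
    by (simp add: D_def \<gamma> mat_def trace_def scaleR_sum_right)
  moreover have "(\<Sum>p\<in>?P. of_int (sign p) * D p h) = of_int (sign (id::'n\<Rightarrow>'n)) * D id h" for h
    using D0 by (subst sum.mono_neutral_right [of ?P "{id}"]) (auto simp: permutes_id)
  ultimately show ?thesis
    using main by (simp add: has_vector_derivative_def)
qed

section \<open>Block matrices over an index type with a distinguished element\<close>

lemma sum_option:
  "(\<Sum>i\<in>UNIV. f i) = f None + (\<Sum>i\<in>UNIV. f (Some i))" for f :: "'n::finite option \<Rightarrow> 'a::comm_monoid_add"
  unfolding UNIV_option_conv by (subst sum.insert) (auto simp: sum.reindex)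

lemma prod_option:
  "(\<Prod>i\<in>UNIV. f i) = f None * (\<Prod>i\<in>UNIV. f (Some i))" for f :: "'n::finite option \<Rightarrow> 'a::comm_monoid_mult"
  unfolding UNIV_option_conv by (subst prod.insert) (auto simp: prod.reindex)

lemma all_option: "(\<forall>i. P i) \<longleftrightarrow> P None \<and> (\<forall>i. P (Some i))"
  by (metis option.exhaust)

lemma block_mat_nth [simp]:
  "block_mat a b c A $ None $ None = a"
  "block_mat a b c A $ None $ Some j = b $ j"
  "block_mat a b c A $ Some i $ None = c $ i"
  "block_mat a b c A $ Some i $ Some j = A $ i $ j"
  by (simp_all add: block_mat_def)

lemma vcons_nth [simp]: "vcons c w $ None = c" "vcons c w $ Some i = w $ i"
  by (simp_all add: vcons_def)

lemma vcnj_nth [simp]: "vcnj x $ i = cnj (x $ i)"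
  by (simp add: vcnj_def)

lemma mat_nth: "mat c $ i $ j = (if i = j then c else 0)"
  by (simp add: mat_def)

lemma form_J_nth [simp]:
  "form_J $ None $ None = -1" "form_J $ None $ Some j = 0"
  "form_J $ Some i $ None = 0" "form_J $ Some i $ Some j = (if i = j then 1 else 0)"
  by (simp_all add: form_J_def mat_nth)

lemma block_diag_mult:
  fixes A A' :: "complex^'n::finite^'n"
  shows "block_mat a 0 0 A ** block_mat a' 0 0 A' = block_mat (a * a') 0 0 (A ** A')"
  by (simp add: vec_eq_iff all_option matrix_matrix_mult_def sum_option)

lemma block_diag_1: "block_mat 1 0 0 (mat 1) = mat 1"
  by (simp add: vec_eq_iff all_option mat_nth)

lemma cadj_block_diag: "cadj (block_mat a 0 0 A) = block_mat (cnj a) 0 0 (cadj A)"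
  by (simp add: vec_eq_iff all_option)

lemma trace_option: "trace X = X $ None $ None + (\<Sum>i\<in>UNIV. X $ Some i $ Some i)"
  for X :: "complex^('n::finite option)^('n option)"
  by (simp add: trace_def sum_option)

lemma trace_block_diag: "trace (block_mat a b c A) = a + trace (A :: complex^'n::finite^'n)"
  by (simp add: trace_option) (simp add: trace_def)

text \<open>Only the permutations that fix the distinguished index contribute; they are the extensions of
  the permutations of the remaining indices, and an extension has the same sign.\<close>

lemma det_block_diag: "det (block_mat a 0 0 A) = a * det (A :: complex^'n::finite^'n)"
proof -
  let ?X = "block_mat a 0 0 A" and ?R = "range (Some :: 'n \<Rightarrow> 'n option)"
  let ?F = "\<lambda>p. of_int (sign p) * (\<Prod>i\<in>UNIV. ?X $ i $ p i)"
  have "det ?X = sum ?F {p. p permutes (insert None ?R)}"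
    by (simp add: det_def UNIV_option_conv [symmetric])
  also have "\<dots> = (\<Sum>b\<in>insert None ?R. \<Sum>q | q permutes ?R. ?F (Transposition.transpose None b \<circ> q))"
    by (rule sum_over_permutations_insert) auto
  also have "\<dots> = (\<Sum>q | q permutes ?R. ?F q) +
      (\<Sum>b\<in>?R. \<Sum>q | q permutes ?R. ?F (Transposition.transpose None b \<circ> q))"
    by (subst sum.insert) auto
  also have "(\<Sum>b\<in>?R. \<Sum>q | q permutes ?R. ?F (Transposition.transpose None b \<circ> q)) = 0"
  proof (intro sum.neutral ballI)
    fix b q assume b: "b \<in> ?R" and q: "q \<in> {q. q permutes ?R}"
    have "q None = None"
      using q by (auto intro: permutes_not_in)
    then have "?X $ None $ (Transposition.transpose None b \<circ> q) None = 0"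
      using b by auto
    then have "(\<Prod>i\<in>UNIV. ?X $ i $ (Transposition.transpose None b \<circ> q) i) = 0"
      by (intro prod_zero) auto
    then show "?F (Transposition.transpose None b \<circ> q) = 0"
      by simp
  qed
  also have "(\<Sum>q | q permutes ?R. ?F q) =
      (\<Sum>p | p permutes (UNIV::'n set). a * (of_int (sign p) * (\<Prod>i\<in>UNIV. A $ i $ p i)))"
  proof (rule sum.reindex_bij_witness
      [where i = "map_permutation UNIV Some" and j = "map_permutation ?R the"])
    fix q assume "q \<in> {q. q permutes ?R}"
    then have q: "q permutes ?R" by simp
    show inv: "map_permutation UNIV Some (map_permutation ?R the q) = q"
      by (rule map_permutation_compose_inv) (use q in \<open>auto simp: bij_betw_def inj_on_def image_image\<close>)
    show p: "map_permutation ?R the q \<in> {p. p permutes UNIV}"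
      using map_permutation_permutes [OF _ q, of the UNIV]
      by (auto simp: bij_betw_def inj_on_def image_image)
    have s: "sign (map_permutation ?R the q) = sign q"
      by (rule sign_map_permutation) (use q in \<open>auto simp: inj_on_def\<close>)
    have "q None = None"
      using q by (auto intro: permutes_not_in)
    moreover have "q (Some i) = Some (map_permutation ?R the q i)" for i
      using map_permutation_apply [of Some UNIV i "map_permutation ?R the q"] inv by simp
    ultimately show "a * (of_int (sign (map_permutation ?R the q)) *
        (\<Prod>i\<in>UNIV. A $ i $ map_permutation ?R the q i)) = ?F q"
      by (simp add: s prod_option)
  next
    fix p assume "p \<in> {p. p permutes (UNIV::'n set)}"
    then have p: "p permutes (UNIV::'n set)" by simp
    show "map_permutation ?R the (map_permutation UNIV Some p) = p"
      by (rule map_permutation_compose_inv) (use p in \<open>auto simp: bij_betw_def\<close>)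
    show "map_permutation UNIV Some p \<in> {q. q permutes ?R}"
      using map_permutation_permutes [OF _ p, of Some ?R] by (auto simp: bij_betw_def)
  qed
  also have "\<dots> = a * det A"
    by (simp add: det_def sum_distrib_left)
  finally show ?thesis
    by simp
qed

section \<open>The group and its Lie algebra\<close>

lemma form_J_square: "form_J ** form_J = mat 1"
  by (simp add: vec_eq_iff all_option matrix_matrix_mult_def sum_option mat_nth if_distrib
      cong: if_cong)

lemma SU1n_inverse_left:
  assumes "g \<in> SU1n"
  shows "form_J ** cadj g ** form_J ** g = mat 1"
proof -
  have "form_J ** (cadj g ** form_J ** g) = mat 1"
    using assms by (simp add: SU1n_def form_J_square)
  then show ?thesis
    by (simp only: matrix_mul_assoc)
qed

lemma SU1n_inverse_right:
  assumes "g \<in> SU1n"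
  shows "g ** (form_J ** cadj g ** form_J) = mat 1"
  using SU1n_inverse_left [OF assms] matrix_left_right_inverse by blast

lemma SU1n_matrix_inv: "g \<in> SU1n \<Longrightarrow> matrix_inv g = form_J ** cadj g ** form_J"
  by (rule matrix_inv_unique) (rule SU1n_inverse_right)

lemma SU1n_invertible: "g \<in> SU1n \<Longrightarrow> invertible g"
  using SU1n_inverse_left SU1n_inverse_right unfolding invertible_def by blast

lemma SU1n_1: "mat 1 \<in> SU1n"
  by (simp add: SU1n_def)

lemma SU1n_mult:
  assumes "g \<in> SU1n" "h \<in> SU1n"
  shows "g ** h \<in> SU1n"
proof -
  have "cadj (g ** h) ** form_J ** (g ** h) = cadj h ** (cadj g ** form_J ** g) ** h"
    by (simp add: cadj_mult matrix_mul_assoc)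
  then show ?thesis
    using assms by (simp add: SU1n_def det_mul)
qed

lemma SU1n_inv:
  assumes g: "g \<in> SU1n"
  shows "matrix_inv g \<in> SU1n"
proof -
  let ?h = "matrix_inv g"
  have i: "g ** ?h = mat 1"
    using SU1n_invertible [OF g] by (rule matrix_inv_left_right)
  then have "cadj ?h ** cadj g = mat 1"
    by (metis cadj_mult cadj_mat_1)
  then have "cadj ?h ** (cadj g ** form_J ** g) ** ?h = form_J"
    using i by (metis matrix_mul_assoc matrix_mul_lid matrix_mul_rid)
  moreover have "det ?h = 1"
    using arg_cong [OF i, of det] g by (simp add: det_mul SU1n_def)
  ultimately show ?thesis
    using g by (simp add: SU1n_def)
qed

lemma conj_by_1 [simp]: "conj_by (mat 1) X = X"
  by (simp add: conj_by_def)

lemma conj_by_mult: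
  assumes "invertible g" "invertible h"
  shows "conj_by (g ** h) X = conj_by g (conj_by h X)"
  using assms by (simp add: conj_by_def matrix_inv_mult matrix_mul_assoc)

lemma conj_by_inv_cancel:
  assumes "invertible g"
  shows "conj_by g (conj_by (matrix_inv g) X) = X" "conj_by (matrix_inv g) (conj_by g X) = X"
  using assms matrix_inv_left_right [OF assms]
  by (simp_all add: conj_by_mult [symmetric] invertible_matrix_inv)

lemma conj_by_matrix_mult:
  assumes "invertible g"
  shows "conj_by g (X ** Y) = conj_by g X ** conj_by g Y"
proof -
  have "conj_by g X ** conj_by g Y = g ** X ** (matrix_inv g ** g) ** Y ** matrix_inv g"
    unfolding conj_by_def by (simp only: matrix_mul_assoc)
  then show ?thesis
    by (simp add: conj_by_def matrix_inv_left_right [OF assms] matrix_mul_assoc)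
qed

lemma linear_conj_by: "linear (conj_by g)"
  by (rule linearI) (simp_all add: conj_by_def matrix_ring_simps)

lemmas conj_by_add = linear_add [OF linear_conj_by]
  and conj_by_diff = linear_diff [OF linear_conj_by]
  and conj_by_scaleR = linear_scale [OF linear_conj_by]
  and conj_by_0 = linear_0 [OF linear_conj_by]

lemma trace_conj_by:
  assumes "invertible g"
  shows "trace (conj_by g X) = trace X"
  unfolding conj_by_def
  by (subst trace_mul_sym) (simp add: matrix_mul_assoc matrix_inv_left_right [OF assms])

text \<open>The condition says that \<open>X\<close> is skew for the adjoint \<open>X \<mapsto> J X\<^sup>* J\<close> of the indefinite form; this
  anti-involution turns the stability of \<open>su(1,n)\<close> under conjugation into a formal computation.\<close>

lemma su1n_iff: "X \<in> su1n \<longleftrightarrow> form_J ** cadj X ** form_J = - X \<and> trace X = 0"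
proof -
  have "cadj X ** form_J + form_J ** X = 0 \<longleftrightarrow> form_J ** (cadj X ** form_J + form_J ** X) = 0"
    by (metis form_J_square matrix_mul_assoc matrix_mul_lid matrix_zero_right)
  also have "\<dots> \<longleftrightarrow> form_J ** cadj X ** form_J + X = 0"
    by (simp add: matrix_ring_simps matrix_mul_assoc form_J_square)
  also have "\<dots> \<longleftrightarrow> form_J ** cadj X ** form_J = - X"
    by (rule eq_neg_iff_add_eq_0 [symmetric])
  finally show ?thesis
    by (simp add: su1n_def)
qed

lemma trace_scaleR: "trace (r *\<^sub>R X) = r *\<^sub>R trace (X :: complex^'n^'n)"
  by (simp add: trace_def scaleR_sum_right)

lemma trace_zero: "trace 0 = (0 :: complex)"
  by (simp add: trace_def)

lemma cadj_0: "cadj 0 = 0"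
  by (simp add: vec_eq_iff)

lemma subspace_su1n: "subspace su1n"
  by (rule subspaceI)
     (auto simp: su1n_iff cadj_0 trace_zero cadj_add cadj_scaleR matrix_ring_simps
       trace_add trace_scaleR)

lemma conj_by_su1n:
  assumes g: "g \<in> SU1n" and X: "X \<in> su1n"
  shows "conj_by g X \<in> su1n"
proof -
  note i = SU1n_invertible [OF g]
  have ig: "form_J ** cadj (matrix_inv g) ** form_J = g"
    using SU1n_matrix_inv [OF SU1n_inv [OF g]] matrix_inv_inv [OF i] by simp
  have "form_J ** cadj (conj_by g X) ** form_J =
      (form_J ** cadj (matrix_inv g) ** form_J) ** (form_J ** cadj X ** form_J) **
      (form_J ** cadj g ** form_J)"
  proof -
    have "(form_J ** cadj (matrix_inv g) ** form_J) ** (form_J ** cadj X ** form_J) **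
        (form_J ** cadj g ** form_J) =
        form_J ** cadj (matrix_inv g) ** (form_J ** form_J) ** cadj X ** (form_J ** form_J) **
        cadj g ** form_J"
      by (simp only: matrix_mul_assoc)
    then show ?thesis
      by (simp add: form_J_square conj_by_def cadj_mult matrix_mul_assoc)
  qed
  also have "\<dots> = - conj_by g X"
    using X by (simp add: su1n_iff ig SU1n_matrix_inv [OF g, symmetric] conj_by_def matrix_ring_simps)
  finally show ?thesis
    using X trace_conj_by [OF i] by (simp add: su1n_iff)
qed

lemma su1n_nth:
  assumes "X \<in> su1n"
  shows "X $ None $ Some i = cnj (X $ Some i $ None)"
    "X $ Some i $ Some j = - cnj (X $ Some j $ Some i)"
    "X $ None $ None = - cnj (X $ None $ None)"
proof -
  have *: "(cadj X ** form_J + form_J ** X) $ i $ j = 0" for i j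
    using assms by (simp add: su1n_def)
  show "X $ None $ Some i = cnj (X $ Some i $ None)"
    using * [of None "Some i"]
    by (simp add: matrix_matrix_mult_def sum_option if_distrib if_distribR cong: if_cong)
  show "X $ Some i $ Some j = - cnj (X $ Some j $ Some i)"
    using * [of "Some i" "Some j"]
    by (simp add: matrix_matrix_mult_def sum_option if_distrib if_distribR eq_neg_iff_add_eq_0
        add.commute cong: if_cong)
  have "- (X $ None $ None + cnj (X $ None $ None)) = 0"
    using * [of None None] by (simp add: matrix_matrix_mult_def sum_option)
  then show "X $ None $ None = - cnj (X $ None $ None)"
    by (simp only: neg_equal_0_iff_equal eq_neg_iff_add_eq_0)
qed

lemma su1nI:
  assumes "X $ None $ None = - cnj (X $ None $ None)"
    "\<And>i. X $ None $ Some i = cnj (X $ Some i $ None)"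
    "\<And>i j. X $ Some i $ Some j = - cnj (X $ Some j $ Some i)" "trace X = 0"
  shows "X \<in> su1n"
proof -
  have "cnj (X $ None $ None) = - X $ None $ None" "\<And>i. cnj (X $ None $ Some i) = X $ Some i $ None"
    "\<And>i j. cnj (X $ Some j $ Some i) = - X $ Some i $ Some j"
    using assms by (metis complex_cnj_cnj minus_minus)+
  then show ?thesis
    using assms(2,4) unfolding su1n_def
    by (auto simp: vec_eq_iff all_option matrix_matrix_mult_def sum_option if_distrib if_distribR
      cong: if_cong)
qed

section \<open>Lie algebras of compact groups of matrices\<close>

lemma has_vector_derivative_at_0_iff:
  fixes \<gamma> :: "real \<Rightarrow> 'a::real_normed_vector"
  shows "(\<gamma> has_vector_derivative X) (at 0) \<longleftrightarrow>
    (\<forall>e>0. \<exists>d>0. \<forall>t. \<bar>t\<bar> < d \<longrightarrow> norm (\<gamma> t - \<gamma> 0 - t *\<^sub>R X) \<le> e * \<bar>t\<bar>)"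
  by (simp add: has_vector_derivative_def has_derivative_at_alt bounded_linear_scaleR_left)

lemma cc_subgroupD:
  assumes "cc_subgroup H"
  shows "h \<in> H \<Longrightarrow> h \<in> SU1n" "mat 1 \<in> H" "g \<in> H \<Longrightarrow> h \<in> H \<Longrightarrow> g ** h \<in> H"
    "h \<in> H \<Longrightarrow> matrix_inv h \<in> H" "h \<in> H \<Longrightarrow> invertible h"
  using assms SU1n_invertible unfolding cc_subgroup_def by auto

text \<open>Difference quotients stay in the subspace, which is closed.\<close>

lemma derivative_in_subspace:
  fixes \<delta> :: "real \<Rightarrow> 'a::euclidean_space"
  assumes d: "(\<delta> has_vector_derivative D) (at 0)" and S: "subspace S" and \<delta>: "\<And>t. \<delta> t \<in> S"
  shows "D \<in> S"
proof -
  have "\<exists>y\<in>S. dist y D \<le> e" if e: "e > 0" for e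
  proof -
    obtain d where d: "d > 0"
      "\<And>t. \<bar>t\<bar> < d \<Longrightarrow> norm (\<delta> t - \<delta> 0 - t *\<^sub>R D) \<le> e * \<bar>t\<bar>"
      using d e unfolding has_vector_derivative_at_0_iff by blast
    define t where "t = d / 2"
    have t: "t > 0" "\<bar>t\<bar> < d"
      using d(1) by (auto simp: t_def)
    have "(1 / t) *\<^sub>R (\<delta> t - \<delta> 0) - D = (1 / t) *\<^sub>R (\<delta> t - \<delta> 0 - t *\<^sub>R D)"
      using t(1) by (simp add: algebra_simps)
    then have "dist ((1 / t) *\<^sub>R (\<delta> t - \<delta> 0)) D = norm (\<delta> t - \<delta> 0 - t *\<^sub>R D) / t"
      using t(1) by (simp only: dist_norm norm_scaleR) simp
    then have "dist ((1 / t) *\<^sub>R (\<delta> t - \<delta> 0)) D \<le> e"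
      using d(2) [OF t(2)] t(1) by (simp only: divide_le_eq) simp
    moreover have "(1 / t) *\<^sub>R (\<delta> t - \<delta> 0) \<in> S"
      using S \<delta> by (intro subspace_scale subspace_diff) auto
    ultimately show ?thesis
      by blast
  qed
  then have "D \<in> closure S"
    by (meson closure_approachable_le)
  then show ?thesis
    using closed_subspace [OF S] by (simp add: closure_closed)
qed

lemma lie_algebraE:
  assumes "X \<in> lie_algebra H"
  obtains \<gamma> :: "real \<Rightarrow> complex^'n^'n" where "\<And>t. \<gamma> t \<in> H" "\<gamma> 0 = mat 1" "(\<gamma> has_vector_derivative X) (at 0)"
  using assms unfolding lie_algebra_def by blast

lemma lie_algebraI:
  assumes "\<And>t::real. \<gamma> t \<in> H" "\<gamma> 0 = mat 1" "(\<gamma> has_vector_derivative X) (at 0)"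
  shows "X \<in> lie_algebra H"
  using assms unfolding lie_algebra_def by blast

lemmas has_vector_derivative_matrix_mult =
  bounded_bilinear.has_vector_derivative [OF bounded_bilinear_matrix_mult]

text \<open>Products of curves give sums of velocities, and reparametrized curves give multiples.\<close>

lemma subspace_lie_algebra:
  assumes H: "cc_subgroup H"
  shows "subspace (lie_algebra H)"
proof (rule subspaceI)
  show "0 \<in> lie_algebra H"
    by (rule lie_algebraI [where \<gamma> = "\<lambda>_. mat 1"]) (simp_all add: cc_subgroupD [OF H])
next
  fix X Y assume X: "X \<in> lie_algebra H" and Y: "Y \<in> lie_algebra H"
  obtain \<gamma> where \<gamma>: "\<And>t. \<gamma> t \<in> H" "\<gamma> 0 = mat 1" "(\<gamma> has_vector_derivative X) (at 0)"
    using X by (rule lie_algebraE) blast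
  obtain \<delta> where \<delta>: "\<And>t. \<delta> t \<in> H" "\<delta> 0 = mat 1" "(\<delta> has_vector_derivative Y) (at 0)"
    using Y by (rule lie_algebraE) blast
  have "((\<lambda>t. \<gamma> t ** \<delta> t) has_vector_derivative \<gamma> 0 ** Y + X ** \<delta> 0) (at 0)"
    by (rule has_vector_derivative_matrix_mult [OF \<gamma>(3) \<delta>(3)])
  then show "X + Y \<in> lie_algebra H"
    by (intro lie_algebraI [where \<gamma> = "\<lambda>t. \<gamma> t ** \<delta> t"])
       (simp_all add: cc_subgroupD [OF H] \<gamma> \<delta> add.commute)
next
  fix c :: real and X assume X: "X \<in> lie_algebra H"
  obtain \<gamma> where \<gamma>: "\<And>t. \<gamma> t \<in> H" "\<gamma> 0 = mat 1" "(\<gamma> has_vector_derivative X) (at 0)"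
    using X by (rule lie_algebraE) blast
  have "((\<lambda>t. c * t) has_vector_derivative c) (at 0)"
    by (auto intro!: derivative_eq_intros)
  then have "(\<gamma> \<circ> (\<lambda>t. c * t) has_vector_derivative c *\<^sub>R X) (at 0)"
    by (rule vector_diff_chain_at) (simp add: \<gamma>)
  then show "c *\<^sub>R X \<in> lie_algebra H"
    by (intro lie_algebraI [where \<gamma> = "\<gamma> \<circ> (\<lambda>t. c * t)"]) (simp_all add: \<gamma>)
qed

lemma lie_algebra_conj_by:
  assumes g: "invertible g"
  shows "lie_algebra (conj_by g ` H) = conj_by g ` lie_algebra H"
proof -
  have le: "conj_by g ` lie_algebra H \<subseteq> lie_algebra (conj_by g ` H)"
    if g: "invertible g" for g :: "complex^'n^'n" and H
  proof (rule image_subsetI)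
    fix X assume "X \<in> lie_algebra H"
    then obtain \<gamma> where \<gamma>: "\<And>t. \<gamma> t \<in> H" "\<gamma> 0 = mat 1" "(\<gamma> has_vector_derivative X) (at 0)"
      by (rule lie_algebraE) blast
    have "((\<lambda>t. conj_by g (\<gamma> t)) has_vector_derivative conj_by g X) (at 0)"
      using linear_conj_by \<gamma>(3) unfolding linear_conv_bounded_linear
      by (rule bounded_linear.has_vector_derivative)
    then show "conj_by g X \<in> lie_algebra (conj_by g ` H)"
      using \<gamma> matrix_inv_left_right [OF g]
      by (intro lie_algebraI [where \<gamma> = "\<lambda>t. conj_by g (\<gamma> t)"]) (auto simp: conj_by_def)
  qed
  have "lie_algebra (conj_by g ` H) = conj_by g ` conj_by (matrix_inv g) ` lie_algebra (conj_by g ` H)"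
    using conj_by_inv_cancel [OF g] by (simp add: image_image)
  also have "\<dots> \<subseteq> conj_by g ` lie_algebra (conj_by (matrix_inv g) ` conj_by g ` H)"
    by (intro image_mono le invertible_matrix_inv g)
  also have "conj_by (matrix_inv g) ` conj_by g ` H = H"
    using conj_by_inv_cancel [OF g] by (simp add: image_image)
  finally show ?thesis
    using le [OF g] by blast
qed

lemma lie_algebra_Ad:
  assumes H: "cc_subgroup H" and h: "h \<in> H" and X: "X \<in> lie_algebra H"
  shows "conj_by h X \<in> lie_algebra H"
proof -
  have "conj_by h ` H \<subseteq> H"
    using h by (auto simp: conj_by_def cc_subgroupD [OF H])
  moreover have "conj_by h X \<in> lie_algebra (conj_by h ` H)"
    using X by (simp add: lie_algebra_conj_by cc_subgroupD [OF H] h)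
  ultimately show ?thesis
    unfolding lie_algebra_def by blast
qed

lemma lie_algebra_su1n:
  assumes H: "H \<subseteq> SU1n"
  shows "lie_algebra H \<subseteq> su1n"
proof
  fix X assume "X \<in> lie_algebra H"
  then obtain \<gamma> where \<gamma>: "\<And>t. \<gamma> t \<in> H" "\<gamma> 0 = mat 1" "(\<gamma> has_vector_derivative X) (at 0)"
    by (rule lie_algebraE) blast
  have SU: "\<gamma> t \<in> SU1n" for t
    using \<gamma>(1) H by blast
  have "((\<lambda>t. det (\<gamma> t)) has_vector_derivative trace X) (at 0)"
    using \<gamma> by (intro has_vector_derivative_det_at_1)
  moreover have "(\<lambda>t. det (\<gamma> t)) = (\<lambda>t. 1)"
    using SU by (auto simp: SU1n_def)
  ultimately have tr: "trace X = 0"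
    by (metis has_vector_derivative_const vector_derivative_at)
  have "((\<lambda>t. cadj (\<gamma> t) ** form_J) has_vector_derivative cadj (\<gamma> 0) ** 0 + cadj X ** form_J) (at 0)"
    by (intro has_vector_derivative_matrix_mult has_vector_derivative_const
        bounded_linear.has_vector_derivative [OF bounded_linear_cadj] \<gamma>)
  from has_vector_derivative_matrix_mult [OF this \<gamma>(3)]
  have "((\<lambda>t. cadj (\<gamma> t) ** form_J ** \<gamma> t) has_vector_derivative
      form_J ** X + cadj X ** form_J) (at 0)"
    by (simp add: \<gamma>)
  moreover have "(\<lambda>t. cadj (\<gamma> t) ** form_J ** \<gamma> t) = (\<lambda>t. form_J)"
    using SU by (auto simp: SU1n_def)
  ultimately have "form_J ** X + cadj X ** form_J = 0"
    by (metis has_vector_derivative_const vector_derivative_at)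
  with tr show "X \<in> su1n"
    by (simp add: su1n_def add.commute)
qed

text \<open>The inverse of \<open>g\<close> in the group is the real-linear expression \<open>J g\<^sup>* J\<close>, so conjugation along a
  curve can be differentiated by the product rule alone.\<close>

lemma has_vector_derivative_conj_by:
  assumes "\<And>t. \<gamma> t \<in> SU1n" "\<gamma> 0 = mat 1" "(\<gamma> has_vector_derivative X) (at 0)"
  shows "((\<lambda>t. conj_by (\<gamma> t) Y) has_vector_derivative bracket X Y) (at 0)"
proof -
  have "X \<in> lie_algebra (SU1n :: 'a mat1 set)"
    using assms by (intro lie_algebraI)
  then have X: "X \<in> su1n"
    using lie_algebra_su1n by blast
  have inv: "((\<lambda>t. form_J ** cadj (\<gamma> t) ** form_J) has_vector_derivative
      form_J ** cadj X ** form_J) (at 0)"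
    using has_vector_derivative_matrix_mult [OF has_vector_derivative_matrix_mult
        [OF has_vector_derivative_const bounded_linear.has_vector_derivative [OF bounded_linear_cadj assms(3)]]
        has_vector_derivative_const, of form_J form_J] by simp
  have "((\<lambda>t. \<gamma> t ** Y) has_vector_derivative X ** Y) (at 0)"
    using has_vector_derivative_matrix_mult [OF assms(3) has_vector_derivative_const, of Y]
    by simp
  from has_vector_derivative_matrix_mult [OF this inv]
  show ?thesis
    using X by (simp add: conj_by_def SU1n_matrix_inv [OF assms(1)] assms(2) bracket_def su1n_iff
        form_J_square matrix_ring_simps)
qed

text \<open>The curve \<open>Ad (\<gamma> t) Y\<close> stays in the Lie algebra and has velocity \<open>[X, Y]\<close>.\<close>

lemma lie_algebra_bracket:
  assumes H: "cc_subgroup H" and X: "X \<in> lie_algebra H" and Y: "Y \<in> lie_algebra H"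
  shows "bracket X Y \<in> lie_algebra H"
proof -
  obtain \<gamma> where \<gamma>: "\<And>t. \<gamma> t \<in> H" "\<gamma> 0 = mat 1" "(\<gamma> has_vector_derivative X) (at 0)"
    using X by (rule lie_algebraE) blast
  show ?thesis
  proof (rule derivative_in_subspace)
    show "((\<lambda>t. conj_by (\<gamma> t) Y) has_vector_derivative bracket X Y) (at 0)"
      using \<gamma> by (intro has_vector_derivative_conj_by) (auto intro: cc_subgroupD(1) [OF H])
  qed (auto intro: lie_algebra_Ad H Y subspace_lie_algebra \<gamma>)
qed

section \<open>Tangent directions of compact groups\<close>

lemma cc_subgroup_bounded:
  assumes "cc_subgroup H"
  obtains M where "M > 0" "\<And>h. h \<in> H \<Longrightarrow> norm h \<le> M"
proof -
  have "bounded H"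
    using assms by (auto simp: cc_subgroup_def compact_imp_bounded)
  then show thesis
    using that unfolding bounded_pos by auto
qed

lemma matrix_mult_norm_bound:
  obtains C where "C > 0"
    "\<And>(X :: complex^'n^'n) (Y :: complex^'n^'n). norm (X ** Y) \<le> norm X * norm Y * C"
proof -
  have "bounded_bilinear ((**) :: complex^'n^'n \<Rightarrow> complex^'n^'n \<Rightarrow> complex^'n^'n)"
    by (rule bounded_bilinear_matrix_mult)
  from bounded_bilinear.pos_bounded [OF this] that show thesis
    by blast
qed

lemma matrix_vector_norm_bound:
  obtains C where "C > 0"
    "\<And>(X :: complex^'n^'n) (f :: complex^'n). norm (X *v f) \<le> norm X * norm f * C"
proof -
  have "bounded_bilinear ((*v) :: complex^'n^'n \<Rightarrow> complex^'n \<Rightarrow> complex^'n)"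
    by (rule bounded_bilinear_matrix_vector)
  from bounded_bilinear.pos_bounded [OF this] that show thesis
    by blast
qed

primrec matrix_power :: "complex^'n^'n \<Rightarrow> nat \<Rightarrow> complex^'n^'n" where
  "matrix_power A 0 = mat 1"
| "matrix_power A (Suc k) = A ** matrix_power A k"

lemma matrix_power_in: "cc_subgroup H \<Longrightarrow> A \<in> H \<Longrightarrow> matrix_power A k \<in> H"
  by (induction k) (simp_all add: cc_subgroupD(2,3))

text \<open>Powers of an element \<open>1 + E\<close> of a bounded group agree with \<open>1 + k E\<close> up to an error that is
  quadratic in \<open>k E\<close>; boundedness of the group replaces the estimate of the binomial tail.\<close>

lemma power_expansion:
  fixes H :: "'n::finite mat1 set"
  assumes H: "cc_subgroup H"
  obtains K where "K > 0" "\<And>A k. A \<in> H \<Longrightarrow>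
    norm (matrix_power A k - mat 1 - real k *\<^sub>R (A - mat 1)) \<le> K * (real k * norm (A - mat 1))\<^sup>2"
proof -
  obtain M where M: "M > 0" "\<And>h. h \<in> H \<Longrightarrow> norm h \<le> M"
    by (rule cc_subgroup_bounded [OF H]) blast
  obtain C where C: "C > 0" "\<And>(X :: 'n mat1) (Y :: 'n mat1). norm (X ** Y) \<le> norm X * norm Y * C"
    by (rule matrix_mult_norm_bound) blast
  have "norm (matrix_power A k - mat 1 - real k *\<^sub>R (A - mat 1)) \<le>
      C\<^sup>2 * M * (real k * norm (A - mat 1))\<^sup>2" if A: "A \<in> H" for A :: "'n mat1" and k
  proof -
    define E where "E = A - mat 1"
    have step: "matrix_power A (Suc k) = matrix_power A k + E ** matrix_power A k" for k
      by (simp add: E_def matrix_ring_simps)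
    have one: "norm (matrix_power A k - mat 1) \<le> real k * (norm E * M * C)" for k
    proof (induction k)
      case (Suc k)
      have "norm (E ** matrix_power A k) \<le> norm E * norm (matrix_power A k) * C"
        by (rule C)
      also have "\<dots> \<le> norm E * M * C"
        using C(1) M(2) [OF matrix_power_in [OF H A]] by (intro mult_right_mono mult_left_mono) auto
      finally have 1: "norm (E ** matrix_power A k) \<le> norm E * M * C" .
      have "norm (matrix_power A (Suc k) - mat 1) \<le>
          norm (matrix_power A k - mat 1) + norm (E ** matrix_power A k)"
        using norm_triangle_ineq [of "matrix_power A k - mat 1" "E ** matrix_power A k"]
        by (simp add: step add_diff_eq diff_add_eq del: matrix_power.simps)
      then show ?case
        using Suc 1 by (simp add: algebra_simps)
    qed simp
    have "norm (matrix_power A k - mat 1 - real k *\<^sub>R E) \<le> C\<^sup>2 * M * (real k * norm E)\<^sup>2"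
    proof (induction k)
      case (Suc k)
      have eq: "matrix_power A (Suc k) - mat 1 - real (Suc k) *\<^sub>R E =
          (matrix_power A k - mat 1 - real k *\<^sub>R E) + E ** (matrix_power A k - mat 1)"
        unfolding step by (simp add: matrix_ring_simps algebra_simps)
      have "norm (E ** (matrix_power A k - mat 1)) \<le> norm E * norm (matrix_power A k - mat 1) * C"
        by (rule C)
      also have "\<dots> \<le> norm E * (real k * (norm E * M * C)) * C"
        using C(1) one by (intro mult_right_mono mult_left_mono) auto
      also have "\<dots> = C\<^sup>2 * M * (norm E)\<^sup>2 * real k"
        by (simp add: power2_eq_square)
      finally have 1: "norm (E ** (matrix_power A k - mat 1)) \<le> C\<^sup>2 * M * (norm E)\<^sup>2 * real k" .
      have "norm (matrix_power A (Suc k) - mat 1 - real (Suc k) *\<^sub>R E) \<le>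
          C\<^sup>2 * M * (norm E)\<^sup>2 * (real k)\<^sup>2 + C\<^sup>2 * M * (norm E)\<^sup>2 * real k"
        unfolding eq using Suc 1
        by (intro order_trans [OF norm_triangle_ineq] add_mono)
           (simp_all add: power_mult_distrib mult_ac)
      also have "\<dots> = C\<^sup>2 * M * (norm E)\<^sup>2 * ((real k)\<^sup>2 + real k)"
        by (simp add: algebra_simps)
      also have "\<dots> \<le> C\<^sup>2 * M * (norm E)\<^sup>2 * (real (Suc k))\<^sup>2"
      proof (rule mult_left_mono)
        show "(real k)\<^sup>2 + real k \<le> (real (Suc k))\<^sup>2"
          by (simp add: power2_eq_square algebra_simps)
        show "0 \<le> C\<^sup>2 * M * (norm E)\<^sup>2"
          using M(1) by simp
      qed
      finally show ?case
        by (simp add: power_mult_distrib mult_ac)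
    qed simp
    then show ?thesis
      by (simp add: E_def)
  qed
  moreover have "C\<^sup>2 * M > 0"
    using M(1) C(1) by simp
  ultimately show thesis
    by (rule that [rotated])
qed

text \<open>With \<open>A n \<approx> 1 + e n y\<close>, the power of exponent \<open>\<lfloor>t / e n\<rfloor>\<close> is close to \<open>1 + t y\<close>. The index \<open>n\<close> is
  chosen after \<open>t\<close>, so that every error is of order \<open>t\<^sup>2\<close>.\<close>

lemma tangent_direction_one_sided:
  assumes H: "cc_subgroup H" and A: "\<And>n. A n \<in> H" and e: "\<And>n. e n > 0" "e \<longlonglongrightarrow> 0"
    and y: "(\<lambda>n. (1 / e n) *\<^sub>R (A n - mat 1)) \<longlonglongrightarrow> y"
  obtains K where "\<And>t. 0 < t \<Longrightarrow> t \<le> 1 \<Longrightarrow> \<exists>g\<in>H. norm (g - mat 1 - t *\<^sub>R y) \<le> K * t\<^sup>2"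
proof -
  obtain C where C: "C > 0" "\<And>A k. A \<in> H \<Longrightarrow>
      norm (matrix_power A k - mat 1 - real k *\<^sub>R (A - mat 1)) \<le> C * (real k * norm (A - mat 1))\<^sup>2"
    by (rule power_expansion [OF H]) blast
  have "\<exists>g\<in>H. norm (g - mat 1 - t *\<^sub>R y) \<le> (C * (norm y + 1)\<^sup>2 + 1 + norm y) * t\<^sup>2"
    if t: "0 < t" "t \<le> 1" for t
  proof -
    have "\<forall>\<^sub>F n in sequentially. dist ((1 / e n) *\<^sub>R (A n - mat 1)) y < t"
      using y t(1) by (rule tendstoD)
    moreover have "\<forall>\<^sub>F n in sequentially. dist (e n) 0 < t\<^sup>2"
      using e(2) by (rule tendstoD) (use t in simp)
    ultimately have "\<forall>\<^sub>F n in sequentially. dist ((1 / e n) *\<^sub>R (A n - mat 1)) y < t \<and> e n < t\<^sup>2"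
      by eventually_elim (use e(1) in \<open>auto simp: dist_norm\<close>)
    then obtain n where n: "dist ((1 / e n) *\<^sub>R (A n - mat 1)) y < t" "e n < t\<^sup>2"
      using eventually_happens' trivial_limit_sequentially by blast
    define d E where "d = e n" and "E = A n - mat 1"
    define k where "k = nat \<lfloor>t / d\<rfloor>"
    have d: "d > 0" "d < t\<^sup>2"
      using e(1) n(2) by (auto simp: d_def)
    have "real k \<le> t / d" "t / d < real k + 1"
      using t d by (auto simp: k_def)
    then have k: "real k * d \<le> t" "t - real k * d < d"
      using d by (auto simp: field_simps)
    have "E - d *\<^sub>R y = d *\<^sub>R ((1 / d) *\<^sub>R E - y)"
      using d by (simp add: algebra_simps)
    then have Ey: "norm (E - d *\<^sub>R y) \<le> d * t"
      using n(1) d unfolding d_def [symmetric] E_def [symmetric] dist_norm by simp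
    have "norm E \<le> norm (E - d *\<^sub>R y) + norm (d *\<^sub>R y)"
      by (metis diff_add_cancel norm_triangle_ineq)
    also have "\<dots> \<le> d * (norm y + 1)"
      using order_trans [OF Ey mult_left_mono [of t 1 d]] d t by (simp add: algebra_simps)
    finally have nE: "norm E \<le> d * (norm y + 1)" .
    have kE: "real k * norm E \<le> t * (norm y + 1)"
    proof -
      have "real k * norm E \<le> real k * (d * (norm y + 1))"
        using nE by (intro mult_left_mono) auto
      also have "\<dots> = (real k * d) * (norm y + 1)"
        by simp
      also have "\<dots> \<le> t * (norm y + 1)"
        using k by (intro mult_right_mono) auto
      finally show ?thesis .
    qed
    define g where "g = matrix_power (A n) k"
    have 1: "norm (g - mat 1 - real k *\<^sub>R E) \<le> C * (t * (norm y + 1))\<^sup>2"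
    proof -
      have "norm (g - mat 1 - real k *\<^sub>R E) \<le> C * (real k * norm E)\<^sup>2"
        unfolding g_def E_def by (rule C(2) [OF A])
      also have "\<dots> \<le> C * (t * (norm y + 1))\<^sup>2"
        using C(1) kE by (intro mult_left_mono power_mono) auto
      finally show ?thesis .
    qed
    have 2: "norm (real k *\<^sub>R (E - d *\<^sub>R y)) \<le> t\<^sup>2"
    proof -
      have "norm (real k *\<^sub>R (E - d *\<^sub>R y)) \<le> real k * (d * t)"
        using Ey by (auto intro: mult_left_mono)
      also have "\<dots> = (real k * d) * t"
        by simp
      also have "\<dots> \<le> t * t"
        using k t by (intro mult_right_mono) auto
      finally show ?thesis
        by (simp add: power2_eq_square)
    qed
    have 3: "norm ((real k * d - t) *\<^sub>R y) \<le> t\<^sup>2 * norm y"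
      using k d by (auto intro: mult_right_mono)
    have "g - mat 1 - t *\<^sub>R y = (g - mat 1 - real k *\<^sub>R E) + real k *\<^sub>R (E - d *\<^sub>R y) +
        (real k * d - t) *\<^sub>R y"
      by (simp add: algebra_simps)
    then have "norm (g - mat 1 - t *\<^sub>R y) \<le> C * (t * (norm y + 1))\<^sup>2 + t\<^sup>2 + t\<^sup>2 * norm y"
      using 1 2 3 by (simp only:) (intro norm_triangle_mono)
    also have "\<dots> = (C * (norm y + 1)\<^sup>2 + 1 + norm y) * t\<^sup>2"
      by (simp only: power_mult_distrib) (simp add: algebra_simps)
    finally show ?thesis
      using matrix_power_in [OF H A] unfolding g_def by blast
  qed
  then show thesis
    using that by blast
qed

text \<open>The heart of the theorem that closed subgroups are Lie groups: if elements of the group approach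
  the identity from the direction \<open>y\<close>, then their powers approximate every point of the line through
  \<open>y\<close>, so \<open>y\<close> is tangent to the group.\<close>

lemma tangent_direction_in_lie_algebra:
  assumes H: "cc_subgroup H" and A: "\<And>n. A n \<in> H" and e: "\<And>n. e n > 0" "e \<longlonglongrightarrow> 0"
    and y: "(\<lambda>n. (1 / e n) *\<^sub>R (A n - mat 1)) \<longlonglongrightarrow> y"
  shows "y \<in> lie_algebra H"
proof -
  have A1: "A \<longlonglongrightarrow> mat 1"
  proof -
    have "(\<lambda>n. e n *\<^sub>R ((1 / e n) *\<^sub>R (A n - mat 1)) + mat 1) \<longlonglongrightarrow> 0 *\<^sub>R y + mat 1"
      by (intro tendsto_intros e y)
    moreover have "e n *\<^sub>R ((1 / e n) *\<^sub>R (A n - mat 1)) + mat 1 = A n" for n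
      using e(1) [of n] by simp
    ultimately show ?thesis
      by simp
  qed
  note SU = cc_subgroupD(1) [OF H A]
  have inv: "(\<lambda>n. matrix_inv (A n)) \<longlonglongrightarrow> mat 1"
  proof -
    have "(\<lambda>n. form_J ** cadj (A n) ** form_J) \<longlonglongrightarrow> form_J ** cadj (mat 1) ** form_J"
      by (intro tendsto_intros A1)
    then show ?thesis
      by (simp add: SU1n_matrix_inv [OF SU] form_J_square)
  qed
  have y': "(\<lambda>n. (1 / e n) *\<^sub>R (matrix_inv (A n) - mat 1)) \<longlonglongrightarrow> - y"
  proof -
    have "(\<lambda>n. - (matrix_inv (A n) ** ((1 / e n) *\<^sub>R (A n - mat 1)))) \<longlonglongrightarrow> - (mat 1 ** y)"
      by (intro tendsto_intros inv y)
    moreover have "- (matrix_inv (A n) ** ((1 / e n) *\<^sub>R (A n - mat 1))) =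
        (1 / e n) *\<^sub>R (matrix_inv (A n) - mat 1)" for n
      by (simp add: matrix_ring_simps matrix_inv_left_right [OF SU1n_invertible [OF SU]]
          algebra_simps)
    ultimately show ?thesis
      by simp
  qed
  obtain K1 where K1: "\<And>t. 0 < t \<Longrightarrow> t \<le> 1 \<Longrightarrow> \<exists>g\<in>H. norm (g - mat 1 - t *\<^sub>R y) \<le> K1 * t\<^sup>2"
    using tangent_direction_one_sided [OF H A e y] by blast
  obtain K2 where K2: "\<And>t. 0 < t \<Longrightarrow> t \<le> 1 \<Longrightarrow> \<exists>g\<in>H. norm (g - mat 1 - t *\<^sub>R (- y)) \<le> K2 * t\<^sup>2"
    using tangent_direction_one_sided [OF H cc_subgroupD(4) [OF H A] e y'] by blast
  define K where "K = max (max K1 K2) 1"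
  have ex: "\<exists>g\<in>H. (t = 0 \<longrightarrow> g = mat 1) \<and> (\<bar>t\<bar> \<le> 1 \<longrightarrow> norm (g - mat 1 - t *\<^sub>R y) \<le> K * t\<^sup>2)" for t :: real
  proof -
    consider "t = 0" | "0 < t" "t \<le> 1" | "t < 0" "- t \<le> 1" | "\<bar>t\<bar> > 1"
      by linarith
    then show ?thesis
    proof cases
      case 1
      then show ?thesis
        using cc_subgroupD(2) [OF H] by (intro bexI [of _ "mat 1"]) auto
    next
      case 2
      then obtain g where g: "g \<in> H" "norm (g - mat 1 - t *\<^sub>R y) \<le> K1 * t\<^sup>2"
        using K1 by blast
      have "K1 * t\<^sup>2 \<le> K * t\<^sup>2"
        by (intro mult_right_mono) (auto simp: K_def)
      with g(2) have "norm (g - mat 1 - t *\<^sub>R y) \<le> K * t\<^sup>2"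
        by (simp only: power2_minus scaleR_minus_left scaleR_minus_right minus_minus)
      then show ?thesis
        using g(1) 2 by (intro bexI [of _ g]) auto
    next
      case 3
      then obtain g where g: "g \<in> H" "norm (g - mat 1 - (- t) *\<^sub>R (- y)) \<le> K2 * (- t)\<^sup>2"
        using K2 [of "- t"] by auto
      have "K2 * t\<^sup>2 \<le> K * t\<^sup>2"
        by (intro mult_right_mono) (auto simp: K_def)
      with g(2) have "norm (g - mat 1 - t *\<^sub>R y) \<le> K * t\<^sup>2"
        by (simp only: power2_minus scaleR_minus_left scaleR_minus_right minus_minus)
      then show ?thesis
        using g(1) 3 by (intro bexI [of _ g]) auto
    next
      case 4
      then show ?thesis
        using cc_subgroupD(2) [OF H] by (intro bexI [of _ "mat 1"]) auto
    qed
  qed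
  have "\<forall>t. \<exists>g. g \<in> H \<and> (t = 0 \<longrightarrow> g = mat 1) \<and>
      (\<bar>t\<bar> \<le> 1 \<longrightarrow> norm (g - mat 1 - t *\<^sub>R y) \<le> K * t\<^sup>2)"
    using ex by blast
  from choice [OF this] obtain \<gamma> where \<gamma>: "\<And>t. \<gamma> t \<in> H" "\<And>t. t = 0 \<longrightarrow> \<gamma> t = mat 1"
    "\<And>t. \<bar>t\<bar> \<le> 1 \<longrightarrow> norm (\<gamma> t - mat 1 - t *\<^sub>R y) \<le> K * t\<^sup>2"
    by blast
  have K: "K > 0"
    by (auto simp: K_def)
  have "(\<gamma> has_vector_derivative y) (at 0)"
    unfolding has_vector_derivative_at_0_iff
  proof (intro allI impI)
    fix r :: real assume r: "r > 0"
    have "norm (\<gamma> t - \<gamma> 0 - t *\<^sub>R y) \<le> r * \<bar>t\<bar>" if t: "\<bar>t\<bar> < min 1 (r / K)" for t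
    proof -
      have "norm (\<gamma> t - \<gamma> 0 - t *\<^sub>R y) \<le> (K * \<bar>t\<bar>) * \<bar>t\<bar>"
        using \<gamma>(2) [of 0] \<gamma>(3) [of t] t by (simp add: power2_eq_square mult.assoc)
      also have "\<dots> \<le> r * \<bar>t\<bar>"
        using t K by (intro mult_right_mono) (auto simp: field_simps)
      finally show ?thesis .
    qed
    then show "\<exists>d>0. \<forall>t. \<bar>t\<bar> < d \<longrightarrow> norm (\<gamma> t - \<gamma> 0 - t *\<^sub>R y) \<le> r * \<bar>t\<bar>"
      using r K by (intro exI [of _ "min 1 (r / K)"]) auto
  qed
  with \<gamma>(1) \<gamma>(2) [of 0] show ?thesis
    by (intro lie_algebraI) auto
qed

section \<open>Invariant norms\<close>

text \<open>The supremum of the Euclidean norm over an orbit: a norm that is invariant under the group, finite for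
  bounded groups.\<close>

definition orbit_norm :: "'n::finite mat1 set \<Rightarrow> complex^('n option) \<Rightarrow> real"
  where "orbit_norm H f = (SUP h\<in>H. norm (h *v f))"

context
  fixes H :: "'n::finite mat1 set"
  assumes H: "cc_subgroup H"
begin

lemma orbit_norm_bound:
  obtains C where "C > 0" "\<And>h f. h \<in> H \<Longrightarrow> norm (h *v f) \<le> C * norm f"
proof -
  obtain M where M: "M > 0" "\<And>h. h \<in> H \<Longrightarrow> norm h \<le> M"
    by (rule cc_subgroup_bounded [OF H]) blast
  obtain C where C: "C > 0" "\<And>(X :: 'n mat1) f. norm (X *v f) \<le> norm X * norm f * C"
    by (rule matrix_vector_norm_bound) blast
  have "norm (h *v f) \<le> (M * C) * norm f" if "h \<in> H" for h f
  proof -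
    have "norm (h *v f) \<le> norm h * norm f * C"
      by (rule C)
    also have "\<dots> \<le> M * norm f * C"
      using M(2) [OF that] C(1) by (intro mult_right_mono) auto
    finally show ?thesis
      by (simp add: mult_ac)
  qed
  with mult_pos_pos [OF M(1) C(1)] show thesis
    by (rule that)
qed

lemma norm_le_orbit_norm: "h \<in> H \<Longrightarrow> norm (h *v f) \<le> orbit_norm H f"
proof -
  obtain C where "\<And>h. h \<in> H \<Longrightarrow> norm (h *v f) \<le> C * norm f"
    by (rule orbit_norm_bound) blast
  then have "bdd_above ((\<lambda>h. norm (h *v f)) ` H)"
    by (intro bdd_aboveI2)
  then show "h \<in> H \<Longrightarrow> norm (h *v f) \<le> orbit_norm H f"
    unfolding orbit_norm_def by (intro cSUP_upper)
qed

lemma orbit_norm_le: "(\<And>h. h \<in> H \<Longrightarrow> norm (h *v f) \<le> c) \<Longrightarrow> orbit_norm H f \<le> c"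
  unfolding orbit_norm_def by (rule cSUP_least) (use cc_subgroupD(2) [OF H] in blast)+

lemma orbit_norm_pos:
  assumes "f \<noteq> 0"
  shows "orbit_norm H f > 0"
proof -
  have "0 < norm f"
    using assms by simp
  also have "norm f \<le> orbit_norm H f"
    using norm_le_orbit_norm [OF cc_subgroupD(2) [OF H], of f]
    by (simp only: matrix_vector_mul_lid)
  finally show ?thesis .
qed

lemma orbit_norm_invariant:
  assumes h: "h \<in> H"
  shows "orbit_norm H (h *v f) = orbit_norm H f"
proof -
  have le: "orbit_norm H (h *v f) \<le> orbit_norm H f" if "h \<in> H" for h f
  proof (rule orbit_norm_le)
    fix k assume "k \<in> H"
    then show "norm (k *v (h *v f)) \<le> orbit_norm H f"
      using norm_le_orbit_norm [OF cc_subgroupD(3) [OF H _ that], of k f]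
      by (simp add: matrix_vector_mul_assoc)
  qed
  have "orbit_norm H f = orbit_norm H (matrix_inv h *v (h *v f))"
    by (simp add: matrix_vector_mul_assoc matrix_inv_left_right cc_subgroupD(5) [OF H h])
  also have "\<dots> \<le> orbit_norm H (h *v f)"
    using h by (intro le cc_subgroupD(4) [OF H])
  finally show ?thesis
    by (intro antisym le h)
qed

lemma orbit_norm_triangle: "orbit_norm H (f + g) \<le> orbit_norm H f + orbit_norm H g"
proof (rule orbit_norm_le)
  fix h assume h: "h \<in> H"
  have "norm (h *v (f + g)) \<le> norm (h *v f) + norm (h *v g)"
    by (simp add: matrix_vector_right_distrib norm_triangle_ineq)
  then show "norm (h *v (f + g)) \<le> orbit_norm H f + orbit_norm H g"
    using norm_le_orbit_norm [OF h, of f] norm_le_orbit_norm [OF h, of g] by linarith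
qed

lemma orbit_norm_scaleR: "orbit_norm H (r *\<^sub>R f) \<le> \<bar>r\<bar> * orbit_norm H f"
proof (rule orbit_norm_le)
  fix h assume h: "h \<in> H"
  have "h *v (r *\<^sub>R f) = r *\<^sub>R (h *v f)"
    by (simp add: vec_eq_iff matrix_vector_mult_def scaleR_sum_right)
  then show "norm (h *v (r *\<^sub>R f)) \<le> \<bar>r\<bar> * orbit_norm H f"
    using norm_le_orbit_norm [OF h, of f] by (simp add: mult_left_mono)
qed

text \<open>A tangent vector \<open>X\<close> generates isometries of the invariant norm \<open>N\<close>, so to first order
  \<open>N (f + t X f)\<close> equals \<open>N f\<close>; as a function of \<open>t\<close> it is convex, hence minimal at \<open>t = 0\<close>.\<close>

lemma orbit_norm_expanding:
  assumes X: "X \<in> lie_algebra H"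
  shows "orbit_norm H f \<le> orbit_norm H (f + s *\<^sub>R (X *v f))"
proof (rule ccontr)
  let ?N = "orbit_norm H"
  assume neg: "\<not> ?thesis"
  define \<eta> where "\<eta> = ?N f - ?N (f + s *\<^sub>R (X *v f))"
  have \<eta>: "\<eta> > 0"
    using neg by (simp add: \<eta>_def)
  obtain \<gamma> where \<gamma>: "\<And>t. \<gamma> t \<in> H" "\<gamma> 0 = mat 1" "(\<gamma> has_vector_derivative X) (at 0)"
    using X by (rule lie_algebraE) blast
  obtain C where C: "C > 0" "\<And>h f. h \<in> H \<Longrightarrow> norm (h *v f) \<le> C * norm f"
    using orbit_norm_bound by blast
  obtain B where B: "B > 0" "\<And>(X :: 'n mat1) f. norm (X *v f) \<le> norm X * norm f * B"
    by (rule matrix_vector_norm_bound) blast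
  define c where "c = C * norm f * B * \<bar>s\<bar> + 1"
  have c: "c > 0"
    using C B by (auto simp: c_def intro!: add_nonneg_pos)
  obtain d where d: "d > 0"
    "\<And>t. \<bar>t\<bar> < d \<Longrightarrow> norm (\<gamma> t - \<gamma> 0 - t *\<^sub>R X) \<le> \<eta> / (2 * c) * \<bar>t\<bar>"
  proof -
    have "\<eta> / (2 * c) > 0"
      using \<eta> c by simp
    with \<gamma>(3) that show thesis
      unfolding has_vector_derivative_at_0_iff by blast
  qed
  define \<tau> where "\<tau> = min 1 (d / (2 * (\<bar>s\<bar> + 1)))"
  have \<tau>: "0 < \<tau>" "\<tau> \<le> 1"
    using d by (auto simp: \<tau>_def)
  have "\<tau> \<le> d / (2 * (\<bar>s\<bar> + 1))"
    by (simp add: \<tau>_def)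
  then have "\<bar>\<tau> * s\<bar> \<le> d / (2 * (\<bar>s\<bar> + 1)) * \<bar>s\<bar>"
    unfolding abs_mult using \<tau>(1) by (intro mult_right_mono) simp_all
  also have "\<dots> < d"
    using d(1) by (simp add: field_simps add_nonneg_pos)
  finally have ts: "\<bar>\<tau> * s\<bar> < d" .
  define R where "R = \<gamma> (\<tau> * s) - mat 1 - (\<tau> * s) *\<^sub>R X"
  have R: "norm R \<le> \<eta> / (2 * c) * (\<tau> * \<bar>s\<bar>)"
    using d(2) [OF ts] \<tau> by (simp add: R_def \<gamma>(2) abs_mult)
  have "?N (R *v f) \<le> C * norm (R *v f)"
    using C(2) by (rule orbit_norm_le)
  also have "\<dots> \<le> C * (norm R * norm f * B)"
    using C(1) B(2) by (intro mult_left_mono) auto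
  also have "\<dots> \<le> C * (\<eta> / (2 * c) * (\<tau> * \<bar>s\<bar>) * norm f * B)"
    using R C(1) B(1) by (intro mult_left_mono mult_right_mono) auto
  also have "\<dots> = \<tau> * \<eta> / 2 * ((C * norm f * B * \<bar>s\<bar>) / c)"
    by simp
  also have "\<dots> \<le> \<tau> * \<eta> / 2 * 1"
    using \<tau> \<eta> c by (intro mult_left_mono) (auto simp: c_def)
  finally have NR: "?N (R *v f) \<le> \<tau> * \<eta> / 2"
    by simp
  have split: "\<gamma> (\<tau> * s) *v f = ((1 - \<tau>) *\<^sub>R f + \<tau> *\<^sub>R (f + s *\<^sub>R (X *v f))) + R *v f"
  proof -
    have "\<gamma> (\<tau> * s) = mat 1 + (\<tau> * s) *\<^sub>R X + R"
      by (simp add: R_def)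
    then have "\<gamma> (\<tau> * s) *v f = f + ((\<tau> * s) *\<^sub>R X) *v f + R *v f"
      by (simp add: matrix_vector_mult_add_rdistrib)
    moreover have "((\<tau> * s) *\<^sub>R X) *v f = (\<tau> * s) *\<^sub>R (X *v f)"
      by (simp add: vec_eq_iff matrix_vector_mult_def scaleR_sum_right)
    ultimately show ?thesis
      by (simp add: algebra_simps)
  qed
  have "?N f = ?N (\<gamma> (\<tau> * s) *v f)"
    using \<gamma>(1) by (simp add: orbit_norm_invariant)
  also have "\<dots> \<le> (?N ((1 - \<tau>) *\<^sub>R f) + ?N (\<tau> *\<^sub>R (f + s *\<^sub>R (X *v f)))) + ?N (R *v f)"
    unfolding split
    by (intro order_trans [OF orbit_norm_triangle] add_right_mono orbit_norm_triangle)
  also have "\<dots> \<le> ((1 - \<tau>) * ?N f + \<tau> * ?N (f + s *\<^sub>R (X *v f))) + \<tau> * \<eta> / 2"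
    using orbit_norm_scaleR [of "1 - \<tau>" f] orbit_norm_scaleR [of \<tau> "f + s *\<^sub>R (X *v f)"] NR \<tau>
    by (intro add_mono) auto
  also have "\<dots> = ?N f - \<tau> * \<eta> / 2"
    by (simp add: \<eta>_def field_simps)
  finally show False
    using mult_pos_pos [OF \<tau>(1) \<eta>] by simp
qed

end

section \<open>Unitary matrices\<close>

definition hprod :: "complex^'n \<Rightarrow> complex^'n \<Rightarrow> complex"
  where "hprod x y = (\<Sum>i\<in>UNIV. cnj (x $ i) * y $ i)"

lemma hprod_adjoint: "hprod x (A *v y) = hprod (cadj A *v x) y"
proof -
  have "hprod x (A *v y) = (\<Sum>i\<in>UNIV. \<Sum>j\<in>UNIV. cnj (x $ i) * A $ i $ j * y $ j)"
    by (simp add: hprod_def matrix_vector_mult_def sum_distrib_left mult.assoc)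
  also have "\<dots> = (\<Sum>j\<in>UNIV. \<Sum>i\<in>UNIV. cnj (x $ i) * A $ i $ j * y $ j)"
    by (rule sum.swap)
  also have "\<dots> = hprod (cadj A *v x) y"
    by (simp add: hprod_def matrix_vector_mult_def sum_distrib_left sum_distrib_right mult_ac)
  finally show ?thesis .
qed

lemma hprod_scale: "hprod (a *s x) (b *s y) = cnj a * b * hprod x y"
  by (simp add: hprod_def sum_distrib_left mult_ac)

lemma hprod_self: "hprod x x = of_real ((norm x)\<^sup>2)"
  unfolding norm_vec_def L2_set_def hprod_def
  by (simp add: sum_nonneg complex_norm_square mult.commute del: of_real_power)

lemma inner_eq_hprod: "inner x y = Re (hprod x y)"
  by (simp add: hprod_def inner_vec_def inner_complex_def)

lemma norm_matrix_square: "of_real ((norm A)\<^sup>2) = trace (cadj A ** A)" for A :: "complex^'n^'n"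
proof -
  have "of_real ((norm A)\<^sup>2) = (\<Sum>i\<in>UNIV. of_real ((norm (A $ i))\<^sup>2) :: complex)"
    unfolding norm_vec_def [of A] L2_set_def by (simp add: sum_nonneg)
  also have "\<dots> = (\<Sum>i\<in>UNIV. \<Sum>j\<in>UNIV. cnj (A $ i $ j) * A $ i $ j)"
    by (simp only: hprod_self [symmetric] hprod_def)
  also have "\<dots> = trace (cadj A ** A)"
    by (subst sum.swap) (simp add: trace_def matrix_matrix_mult_def)
  finally show ?thesis .
qed

lemma unitary_left: "B \<in> unitary_group \<Longrightarrow> cadj B ** B = mat 1"
  by (simp add: unitary_group_def)

lemma unitary_right: "B \<in> unitary_group \<Longrightarrow> B ** cadj B = mat 1"
  using matrix_left_right_inverse unitary_left by blast

lemma unitary_1: "mat 1 \<in> unitary_group"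
  by (simp add: unitary_group_def)

lemma unitary_mult: "A \<in> unitary_group \<Longrightarrow> B \<in> unitary_group \<Longrightarrow> A ** B \<in> unitary_group"
  unfolding unitary_group_def
  by (simp add: cadj_mult) (metis matrix_mul_assoc matrix_mul_rid)

lemma unitary_cadj: "B \<in> unitary_group \<Longrightarrow> cadj B \<in> unitary_group"
  using unitary_right by (simp add: unitary_group_def)

lemma unitary_det: "B \<in> unitary_group \<Longrightarrow> cnj (det B) * det B = 1"
  using arg_cong [OF unitary_left, of B det] by (simp add: det_mul det_cadj)

lemma cnj_mult_self_1: "cnj c * c = 1 \<longleftrightarrow> norm c = 1"
proof -
  have "cnj c * c = of_real ((norm c)\<^sup>2)"
    by (simp only: complex_norm_square mult.commute)
  then have "cnj c * c = 1 \<longleftrightarrow> (norm c)\<^sup>2 = 1"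
    by (simp only: of_real_eq_1_iff)
  also have "\<dots> \<longleftrightarrow> norm c = 1"
    using norm_ge_zero [of c] by (simp only: power2_eq_1_iff) linarith
  finally show ?thesis .
qed

lemma unitary_norm_det: "B \<in> unitary_group \<Longrightarrow> norm (det B) = 1"
  using unitary_det cnj_mult_self_1 by blast

lemma unitary_norm:
  assumes "B \<in> unitary_group"
  shows "norm (B *v x) = norm x"
proof -
  have "hprod (B *v x) (B *v x) = hprod x x"
    using unitary_left [OF assms] by (simp add: hprod_adjoint matrix_vector_mul_assoc)
  then have "(norm (B *v x))\<^sup>2 = (norm x)\<^sup>2"
    unfolding hprod_self by (simp only: of_real_eq_iff)
  then show ?thesis
    by (simp add: power2_eq_iff_nonneg)
qed

lemma unitary_matrix_norm:
  assumes "B \<in> unitary_group"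
  shows "norm (B :: complex^'n^'n) = sqrt CARD('n)"
proof -
  have "complex_of_real ((norm B)\<^sup>2) = of_real (real CARD('n))"
    unfolding norm_matrix_square using unitary_left [OF assms] by (simp add: trace_I)
  then have "(norm B)\<^sup>2 = CARD('n)"
    by (simp only: of_real_eq_iff)
  then show ?thesis
    by (metis norm_ge_zero real_sqrt_unique)
qed

lemma mat_mult_nth: "(mat c ** A) $ i $ j = c * A $ i $ j" "(A ** mat c) $ i $ j = c * A $ i $ j"
  for c :: complex
  by (simp_all add: matrix_matrix_mult_def mat_nth if_distrib if_distribR mult.commute cong: if_cong)

lemma det_mat: "det (mat c :: complex^'n^'n) = c ^ CARD('n)"
  by (subst det_diagonal) (simp_all add: mat_nth)

lemma cadj_mat: "cadj (mat c) = mat (cnj c)"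
  by (simp add: vec_eq_iff mat_nth)

lemma mat_mult_mat: "mat c ** mat d = (mat (c * d) :: complex^'n^'n)"
  by (simp add: vec_eq_iff mat_mult_nth mat_nth)

lemma unitary_mat: "norm c = 1 \<Longrightarrow> mat c \<in> unitary_group"
  using cnj_mult_self_1 [of c] by (simp add: unitary_group_def cadj_mat mat_mult_mat)

lemma invertible_iff_kernel: "invertible A \<longleftrightarrow> (\<forall>x. A *v x = 0 \<longrightarrow> x = 0)" for A :: "complex^'n^'n"
  by (simp add: invertible_left_inverse matrix_left_invertible_ker)

text \<open>Cramer's rule; it makes the inverse a continuous function of the matrix.\<close>

lemma matrix_inv_cramer:
  fixes A :: "complex^'n^'n"
  assumes "invertible A"
  shows "matrix_inv A =
    (\<chi> k j. det (\<chi> i l. if l = k then mat 1 $ i $ j else A $ i $ l) / det A)"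
proof -
  have "det A \<noteq> 0"
    using assms invertible_det_nz by blast
  moreover have "det (\<chi> i l. if l = k then mat 1 $ i $ j else A $ i $ l) =
      matrix_inv A $ k $ j * det A" for k j
  proof -
    let ?x = "\<chi> k. matrix_inv A $ k $ j"
    have "(A *v ?x) $ i = (A ** matrix_inv A) $ i $ j" for i
      by (simp add: matrix_vector_mult_def matrix_matrix_mult_def)
    then have "(A *v ?x) $ i = mat 1 $ i $ j" for i
      by (simp only: matrix_inv_left_right [OF assms])
    then show ?thesis
      using cramer_lemma [of k A ?x] by (simp only: vec_lambda_beta)
  qed
  ultimately show ?thesis
    by (simp add: vec_eq_iff)
qed

lemma continuous_on_matrix_inv:
  fixes f :: "'a::topological_space \<Rightarrow> complex^'n^'n"
  assumes f: "continuous_on S f" and inv: "\<And>x. x \<in> S \<Longrightarrow> invertible (f x)"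
  shows "continuous_on S (\<lambda>x. matrix_inv (f x))"
proof -
  have e: "continuous_on S (\<lambda>x. f x $ i $ j)" for i j
    by (intro continuous_intros f)
  have d: "det (f x) \<noteq> 0" if "x \<in> S" for x
    using inv [OF that] invertible_det_nz by blast
  have i: "continuous_on S (\<lambda>x. if l = k then c else f x $ i $ l)" for i l k c
    using e by (cases "l = k") auto
  have "continuous_on S
      (\<lambda>x. \<chi> k j. det (\<chi> i l. if l = k then mat 1 $ i $ j else f x $ i $ l) / det (f x))"
    by (intro continuous_intros f i) (use d in auto)
  then show ?thesis
    by (rule continuous_on_eq) (simp add: matrix_inv_cramer inv)
qed

section \<open>The stabilizer of v\<close>

text \<open>The matrices that are scalar on the plane of \<open>e\<^sub>0\<close> and \<open>e\<^sub>1\<close> and preserve \<open>W\<close>.\<close>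

definition kmat :: "complex \<Rightarrow> complex^'w^'w \<Rightarrow> 'w::finite mat2"
  where "kmat a B = block_mat a 0 0 (block_mat a 0 0 B)"

lemma kmat_nth [simp]:
  "kmat a B $ None $ None = a" "kmat a B $ None $ Some j = 0" "kmat a B $ Some i $ None = 0"
  "kmat a B $ Some None $ Some None = a" "kmat a B $ Some None $ Some (Some k) = 0"
  "kmat a B $ Some (Some l) $ Some None = 0" "kmat a B $ Some (Some l) $ Some (Some k) = B $ l $ k"
  by (simp_all add: kmat_def)

lemma kmat_mult: "kmat a B ** kmat a' B' = kmat (a * a') (B ** B')"
  by (simp add: kmat_def block_diag_mult)

lemma kmat_1: "kmat 1 (mat 1) = mat 1"
  by (simp add: kmat_def block_diag_1)

lemma cadj_kmat: "cadj (kmat a B) = kmat (cnj a) (cadj B)"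
  by (simp add: kmat_def cadj_block_diag)

lemma det_kmat: "det (kmat a B) = a\<^sup>2 * det B"
  by (simp add: kmat_def det_block_diag power2_eq_square)

lemma trace_kmat: "trace (kmat a B) = 2 * a + trace B"
  by (simp add: kmat_def trace_block_diag)

lemma kmat_eq_iff: "kmat a B = kmat a' B' \<longleftrightarrow> a = a' \<and> B = B'"
  by (auto simp: vec_eq_iff all_option)

lemma W_block_kmat [simp]: "W_block (kmat a B) = B"
  by (simp add: W_block_def vec_eq_iff)

lemma bounded_linear_kmat: "bounded_linear (\<lambda>(a, B). kmat a B)"
  unfolding linear_conv_bounded_linear [symmetric]
  by (rule linearI) (auto simp: vec_eq_iff all_option)

lemma continuous_on_kmat [continuous_intros]:
  assumes "continuous_on S f" "continuous_on S g"
  shows "continuous_on S (\<lambda>x. kmat (f x) (g x))"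
  using bounded_linear.continuous_on [OF bounded_linear_kmat continuous_on_Pair [OF assms]] by simp

lemma has_vector_derivative_kmat:
  assumes "(f has_vector_derivative a) (at t)" "(g has_vector_derivative B) (at t)"
  shows "((\<lambda>x. kmat (f x) (g x)) has_vector_derivative kmat a B) (at t)"
  using bounded_linear.has_vector_derivative
    [OF bounded_linear_kmat has_vector_derivative_Pair [OF assms]] by simp

definition v_stabilizer :: "'w::finite mat2 set"
  where "v_stabilizer = {kmat a B | a B. B \<in> unitary_group \<and> a\<^sup>2 * det B = 1}"

lemma v_stabilizer_iff: "kmat a B \<in> v_stabilizer \<longleftrightarrow> B \<in> unitary_group \<and> a\<^sup>2 * det B = 1"
  by (auto simp: v_stabilizer_def kmat_eq_iff)

lemma v_stabilizerE:
  assumes "k \<in> v_stabilizer"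
  obtains a B where "k = kmat a B" "B \<in> unitary_group" "a\<^sup>2 * det B = 1" "norm a = 1"
proof -
  obtain a B where k: "k = kmat a B" "B \<in> unitary_group" "a\<^sup>2 * det B = 1"
    using assms unfolding v_stabilizer_def by blast
  have "norm (a\<^sup>2 * det B) = 1"
    unfolding k(3) by simp
  then have "(norm a)\<^sup>2 = 1"
    using unitary_norm_det [OF k(2)] by (simp add: norm_mult norm_power)
  then have "norm a = 1"
    using norm_ge_zero [of a] by (auto simp: power2_eq_1_iff)
  with k that show thesis
    by blast
qed

lemma block_diag_unitary_inv:
  assumes "A \<in> unitary_group" "cnj d * d = 1"
  shows "matrix_inv (block_mat d 0 0 A) = block_mat (cnj d) 0 0 (cadj A)"
  using assms by (intro matrix_inv_unique)
    (simp add: block_diag_mult unitary_right mult.commute block_diag_1)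

lemma det_unitary_inverse:
  assumes "A \<in> unitary_group"
  shows "inverse (det A) = cnj (det A)"
  using unitary_det [OF assms] by (metis inverse_unique mult.commute)

lemma K_group_subset_SU1n: "K_group \<subseteq> SU1n"
proof
  fix k :: "'a mat1" assume "k \<in> K_group"
  then obtain A where A: "A \<in> unitary_group" "k = block_mat (inverse (det A)) 0 0 A"
    unfolding K_group_def by blast
  show "k \<in> SU1n"
    using unitary_det [OF A(1)] unitary_left [OF A(1)]
    by (simp add: SU1n_def form_J_def A(2) cadj_block_diag block_diag_mult det_block_diag
        det_unitary_inverse [OF A(1)] mult.commute)
qed

lemma conj_by_block_diag:
  fixes A :: "complex^'n::finite^'n"
  assumes A: "A \<in> unitary_group" and d: "cnj d * d = 1"
  shows "conj_by (block_mat d 0 0 A) (p_mat x) = p_mat (cnj d *s (A *v x))"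
proof -
  have "conj_by (block_mat d 0 0 A) (p_mat x) =
      block_mat d 0 0 A ** block_mat 0 (vcnj x) x 0 ** block_mat (cnj d) 0 0 (cadj A)"
    by (simp add: conj_by_def p_mat_def block_diag_unitary_inv [OF A d])
  also have "block_mat d 0 0 A ** block_mat 0 (vcnj x) x 0 = block_mat 0 (d *s vcnj x) (A *v x) 0"
    by (simp add: vec_eq_iff all_option matrix_matrix_mult_def matrix_vector_mult_def sum_option)
  also have "\<dots> ** block_mat (cnj d) 0 0 (cadj A) = p_mat (cnj d *s (A *v x))"
    by (simp add: p_mat_def vec_eq_iff all_option matrix_matrix_mult_def matrix_vector_mult_def
        sum_option sum_distrib_left mult_ac)
  finally show ?thesis .
qed

lemma p_mat_eq_iff: "p_mat x = p_mat y \<longleftrightarrow> x = y"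
  by (auto simp: p_mat_def vec_eq_iff all_option)

text \<open>On \<open>p = \<complex>\<^sup>n\<close> the element of \<open>K\<close> given by \<open>A\<close> acts as \<open>det A \<cdot> A\<close>. So fixing \<open>v\<close> means that \<open>e\<^sub>1\<close> is an
  eigenvector of \<open>A\<close> for the eigenvalue \<open>a = 1 / det A\<close>, and by unitarity \<open>A\<close> preserves the orthogonal
  complement \<open>W\<close>.\<close>

lemma v_stabilizer_eq: "{k \<in> K_group. conj_by k v_elt = v_elt} = v_stabilizer"
proof (intro equalityI subsetI)
  fix k :: "'a mat2" assume "k \<in> {k \<in> K_group. conj_by k v_elt = v_elt}"
  then obtain A where A: "A \<in> unitary_group" and k: "k = block_mat (inverse (det A)) 0 0 A"
    and fix_v: "conj_by k v_elt = v_elt"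
    unfolding K_group_def by blast
  define c where "c = A $ None $ None"
  define B where "B = (\<chi> i j. A $ Some i $ Some j)"
  have dA: "cnj (cnj (det A)) * cnj (det A) = 1"
    using unitary_det [OF A] by (simp add: mult.commute)
  have "det A *s (A *v vcons 1 0) = vcons 1 0"
    using fix_v conj_by_block_diag [OF A dA, of "vcons 1 0"]
    by (simp add: k det_unitary_inverse [OF A] v_elt_def p_mat_eq_iff)
  then have col: "det A * (A *v vcons 1 0) $ i = vcons 1 0 $ i" for i
    by (simp add: vec_eq_iff)
  have dc: "det A * c = 1"
    using col [of None] by (simp add: matrix_vector_mult_def sum_option c_def)
  have nz: "det A \<noteq> 0"
    using dc by auto
  have lower: "A $ Some i $ None = 0" for i
    using col [of "Some i"] nz by (simp add: matrix_vector_mult_def sum_option)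
  have nc: "c * cnj c = 1"
    using arg_cong [OF dc, of norm] unitary_norm_det [OF A] cnj_mult_self_1 [of c]
    by (simp add: norm_mult mult.commute)
  have "(A ** cadj A) $ None $ None = 1"
    by (simp add: unitary_right [OF A] mat_nth)
  then have "(\<Sum>i\<in>UNIV. A $ None $ Some i * cnj (A $ None $ Some i)) = 0"
    using nc by (simp add: matrix_matrix_mult_def sum_option c_def)
  then have "complex_of_real (\<Sum>i\<in>UNIV. (norm (A $ None $ Some i))\<^sup>2) = 0"
    by (simp add: complex_norm_square del: of_real_power)
  then have "(\<Sum>i\<in>UNIV. (norm (A $ None $ Some i))\<^sup>2) = 0"
    by (simp only: of_real_eq_0_iff)
  then have upper: "A $ None $ Some i = 0" for i
    by (simp add: sum_nonneg_eq_0_iff)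
  have Ab: "A = block_mat c 0 0 B"
    by (simp add: vec_eq_iff all_option upper lower c_def B_def)
  have "cadj (block_mat c 0 0 B) ** block_mat c 0 0 B = mat 1"
    using unitary_left [OF A] Ab by simp
  then have "block_mat (cnj c * c) 0 0 (cadj B ** B) = block_mat 1 0 0 (mat 1)"
    by (simp add: cadj_block_diag block_diag_mult block_diag_1)
  then have B: "B \<in> unitary_group"
    by (simp add: unitary_group_def vec_eq_iff all_option)
  have "inverse (det A) = c"
    using dc by (metis inverse_unique)
  then have "k = kmat c B"
    unfolding k kmat_def using Ab by simp
  moreover have "c\<^sup>2 * det B = 1"
    using dc by (simp add: Ab det_block_diag power2_eq_square mult_ac)
  ultimately show "k \<in> v_stabilizer"
    using B by (simp add: v_stabilizer_iff)
next
  fix k :: "'a mat2" assume "k \<in> v_stabilizer"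
  then obtain a B where k: "k = kmat a B" "B \<in> unitary_group" "a\<^sup>2 * det B = 1" "norm a = 1"
    by (rule v_stabilizerE)
  have a: "cnj a * a = 1"
    using k(4) cnj_mult_self_1 by blast
  let ?A = "block_mat a 0 0 B"
  have A: "?A \<in> unitary_group"
    using a unitary_left [OF k(2)]
    by (simp add: unitary_group_def cadj_block_diag block_diag_mult block_diag_1)
  have "inverse (det ?A) = a"
    using k(3) by (intro inverse_unique) (simp add: det_block_diag power2_eq_square mult_ac)
  then have "k = block_mat (inverse (det ?A)) 0 0 ?A"
    by (simp only: k(1) kmat_def)
  then have "k \<in> K_group"
    unfolding K_group_def using A by blast
  moreover have "conj_by k v_elt = v_elt"
    unfolding k(1) kmat_def v_elt_def conj_by_block_diag [OF A a] p_mat_eq_iff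
    using a by (simp add: vec_eq_iff all_option matrix_vector_mult_def sum_option)
  ultimately show "k \<in> {k \<in> K_group. conj_by k v_elt = v_elt}"
    by blast
qed

lemma v_stabilizer_subset_SU1n: "v_stabilizer \<subseteq> SU1n"
  using v_stabilizer_eq K_group_subset_SU1n by blast

lemma v_stabilizer_mult:
  assumes "g \<in> v_stabilizer" "h \<in> v_stabilizer"
  shows "g ** h \<in> v_stabilizer"
proof -
  obtain a A where g: "g = kmat a A" "A \<in> unitary_group" "a\<^sup>2 * det A = 1" "norm a = 1"
    using assms(1) by (rule v_stabilizerE)
  obtain b B where h: "h = kmat b B" "B \<in> unitary_group" "b\<^sup>2 * det B = 1" "norm b = 1"
    using assms(2) by (rule v_stabilizerE)
  have "(a * b)\<^sup>2 * (det A * det B) = (a\<^sup>2 * det A) * (b\<^sup>2 * det B)"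
    by (simp add: power2_eq_square)
  then show ?thesis
    using g h by (simp add: kmat_mult v_stabilizer_iff unitary_mult det_mul)
qed

lemma matrix_inv_kmat:
  assumes "B \<in> unitary_group" "norm a = 1"
  shows "matrix_inv (kmat a B) = kmat (cnj a) (cadj B)"
proof (rule matrix_inv_unique)
  have "a * cnj a = 1"
    using assms(2) cnj_mult_self_1 [of a] by (simp add: mult.commute)
  then show "kmat a B ** kmat (cnj a) (cadj B) = mat 1"
    by (simp add: kmat_mult unitary_right assms(1) kmat_1)
qed

lemma v_stabilizer_inv:
  assumes "k \<in> v_stabilizer"
  shows "matrix_inv k \<in> v_stabilizer"
proof -
  obtain a B where k: "k = kmat a B" "B \<in> unitary_group" "a\<^sup>2 * det B = 1" "norm a = 1"
    using assms by (rule v_stabilizerE)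
  have "(cnj a)\<^sup>2 * cnj (det B) = 1"
    using arg_cong [OF k(3), of cnj] by simp
  then show ?thesis
    using k by (simp add: matrix_inv_kmat v_stabilizer_iff unitary_cadj det_cadj)
qed

lemma v_stabilizer_1: "mat 1 \<in> v_stabilizer"
  using v_stabilizer_iff [of 1 "mat 1"] by (simp add: kmat_1 unitary_1)

section \<open>Connectedness of the stabilizer\<close>

text \<open>A unitary matrix has finitely many eigenvalues because its eigenvectors for distinct eigenvalues
  are orthogonal; so some point of the unit circle is not an eigenvalue.\<close>

lemma unitary_non_eigenvalue:
  assumes B: "(B :: complex^'n^'n) \<in> unitary_group"
  obtains c where "norm c = 1" "invertible (mat c + B)"
proof (rule ccontr)
  assume "\<not> thesis"
  then have "\<forall>c. norm c = 1 \<longrightarrow> (\<exists>x. (mat c + B) *v x = 0 \<and> x \<noteq> 0)"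
    using that unfolding invertible_iff_kernel by blast
  then obtain x where x: "\<And>c. norm c = 1 \<Longrightarrow> (mat c + B) *v x c = 0" "\<And>c. norm c = 1 \<Longrightarrow> x c \<noteq> 0"
    by metis
  have mv: "mat c *v y = c *s y" for c and y :: "complex^'n"
    by (simp add: vec_eq_iff matrix_vector_mult_def mat_nth if_distrib if_distribR cong: if_cong)
  have ev: "B *v x c = (- c) *s x c" if "norm c = 1" for c
    using x(1) [OF that] by (simp add: matrix_vector_mult_add_rdistrib mv add_eq_0_iff vec_eq_iff)
  have orth: "hprod (x c) (x d) = 0" if c: "norm c = 1" and d: "norm d = 1" and ne: "c \<noteq> d" for c d
  proof -
    have "hprod (B *v x c) (B *v x d) = hprod (x c) (x d)"
      by (simp add: hprod_adjoint matrix_vector_mul_assoc unitary_left [OF B])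
    then have "cnj c * d * hprod (x c) (x d) = hprod (x c) (x d)"
      unfolding ev [OF c] ev [OF d] hprod_scale by simp
    then have "(cnj c * d - 1) * hprod (x c) (x d) = 0"
      by (simp add: algebra_simps)
    moreover have "cnj c * d \<noteq> 1"
    proof
      assume "cnj c * d = 1"
      moreover have "cnj c * c = 1"
        using c cnj_mult_self_1 by blast
      ultimately have "cnj c * d = cnj c * c"
        by simp
      moreover have "c \<noteq> 0"
        using c by auto
      ultimately show False
        using ne by simp
    qed
    ultimately show ?thesis
      by simp
  qed
  have inj: "inj_on x {c. norm c = 1}"
  proof (rule inj_onI)
    fix c d assume cd: "c \<in> {c. norm c = 1}" "d \<in> {c. norm c = 1}" "x c = x d"
    show "c = d"
    proof (rule ccontr)
      assume "c \<noteq> d"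
      then have "hprod (x c) (x c) = 0"
        using orth [of c d] cd by simp
      then show False
        using x(2) [of c] cd by (simp add: hprod_self)
    qed
  qed
  have "pairwise orthogonal (x ` {c. norm c = 1})"
  proof (clarsimp simp: pairwise_def orthogonal_def inner_eq_hprod)
    fix c d assume "cmod c = 1" "cmod d = 1" "x c \<noteq> x d"
    then have "hprod (x c) (x d) = 0"
      by (intro orth) auto
    then show "Re (hprod (x c) (x d)) = 0"
      by simp
  qed
  moreover have "0 \<notin> x ` {c. norm c = 1}"
    using x(2) by force
  ultimately have "independent (x ` {c. norm c = 1})"
    by (rule pairwise_orthogonal_independent)
  then have "finite (x ` {c. norm c = 1})"
    by (rule independent_imp_finite)
  then have "finite {c :: complex. norm c = 1}"
    using inj by (rule finite_imageD)
  moreover have "infinite {c :: complex. norm c = 1}"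
  proof -
    have "t \<in> Re ` {c. norm c = 1}" if "t \<in> {0..1}" for t
      by (rule image_eqI [of _ _ "Complex t (sqrt (1 - t\<^sup>2))"])
        (use that in \<open>auto simp: cmod_def power_le_one\<close>)
    then have "{0..1} \<subseteq> Re ` {c. norm c = 1}"
      by blast
    then show ?thesis
      using infinite_Icc [of 0 "1 :: real"] finite_imageI finite_subset by (metis zero_less_one)
  qed
  ultimately show False
    by blast
qed

lemma path_component_of_function:
  assumes "continuous_on {0..1::real} f" "\<And>t. t \<in> {0..1} \<Longrightarrow> f t \<in> S"
  shows "path_component S (f 0) (f 1)"
  unfolding path_component_def path_def
  by (rule exI [of _ f]) (use assms in \<open>auto simp: path_image_def pathstart_def pathfinish_def\<close>)

text \<open>For a normal matrix \<open>M\<close> the quotient of \<open>M\<close> by its adjoint is unitary. Its determinant is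
  \<open>d / cnj d\<close> with \<open>d = det M\<close>, which comes with the explicit square root \<open>d / norm d\<close>.\<close>

lemma unitary_of_normal:
  fixes M :: "complex^'n^'n"
  assumes normal: "M ** cadj M = cadj M ** M" and inv: "invertible M"
  defines "U \<equiv> M ** matrix_inv (cadj M)"
  shows "U \<in> unitary_group" "(cnj (det M) / of_real (norm (det M)))\<^sup>2 * det U = 1"
proof -
  let ?N = "cadj M"
  have d: "det M \<noteq> 0"
    using inv invertible_det_nz by blast
  then have inv': "invertible ?N"
    by (simp add: invertible_det_nz det_cadj)
  have "cadj (matrix_inv ?N) ** M = mat 1"
    using arg_cong [OF matrix_inv_left_right(1) [OF inv'], of cadj] by (simp add: cadj_mult)
  then have "matrix_inv M = cadj (matrix_inv ?N)"
    using matrix_left_right_inverse by (intro matrix_inv_unique) blast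
  then have "cadj U ** U = matrix_inv M ** (?N ** M) ** matrix_inv ?N"
    by (simp add: U_def cadj_mult matrix_mul_assoc)
  also have "\<dots> = (matrix_inv M ** M) ** (?N ** matrix_inv ?N)"
    unfolding normal [symmetric] by (simp only: matrix_mul_assoc)
  also have "\<dots> = mat 1"
    by (simp add: matrix_inv_left_right inv inv')
  finally show "U \<in> unitary_group"
    by (simp add: unitary_group_def)
  have "det ?N * det (matrix_inv ?N) = 1"
    using arg_cong [OF matrix_inv_left_right(1) [OF inv'], of det] by (simp add: det_mul)
  then have "cnj (det M) * det U = det M"
    by (simp add: U_def det_mul det_cadj mult_ac)
  moreover have "(of_real (norm (det M)))\<^sup>2 = cnj (det M) * det M"
    using complex_norm_square [of "det M"] by (simp add: mult.commute)
  ultimately show "(cnj (det M) / of_real (norm (det M)))\<^sup>2 * det U = 1"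
    using d by (simp add: power_divide power2_eq_square)
qed

lemma path_component_v_stabilizer_mult:
  assumes p: "path_component v_stabilizer (mat 1) p" and q: "path_component v_stabilizer (mat 1) q"
  shows "path_component v_stabilizer (mat 1) (p ** q)"
proof -
  have pS: "p \<in> v_stabilizer"
    using p path_component_mem by blast
  obtain g where g: "path g" "path_image g \<subseteq> v_stabilizer" "pathstart g = mat 1" "pathfinish g = q"
    using q unfolding path_component_def by blast
  have "path_component v_stabilizer (p ** g 0) (p ** g 1)"
  proof (rule path_component_of_function)
    show "continuous_on {0..1} (\<lambda>t. p ** g t)"
      using g(1) unfolding path_def by (intro continuous_intros)
    show "p ** g t \<in> v_stabilizer" if "t \<in> {0..1}" for t
      using g(2) that by (intro v_stabilizer_mult pS) (auto simp: path_image_def)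
  qed
  then have "path_component v_stabilizer p (p ** q)"
    using g(3,4) by (simp add: pathstart_def pathfinish_def)
  with p show ?thesis
    by (rule path_component_trans)
qed

text \<open>A unitary \<open>C\<close> is the quotient of \<open>1 + C\<close> by its adjoint. Replacing \<open>1 + C\<close> by \<open>1 + t C\<close> deforms it
  to the identity, and the deformation lifts to the stabilizer by the explicit square root.\<close>

lemma path_component_cayley:
  assumes C: "(C :: complex^'w::finite^'w) \<in> unitary_group" and inv: "invertible (mat 1 + C)"
  obtains a where "path_component v_stabilizer (mat 1) (kmat a C)"
proof -
  define M where "M t = mat 1 + t *\<^sub>R C" for t :: real
  have cM: "cadj (M t) = mat 1 + t *\<^sub>R cadj C" for t
    by (simp add: M_def cadj_add cadj_scaleR)
  have normal: "M t ** cadj (M t) = cadj (M t) ** M t" for t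
    unfolding cM unfolding M_def
    by (simp add: matrix_ring_simps unitary_left [OF C] unitary_right [OF C] scaleR_add_right)
  have inv: "invertible (M t)" if t: "t \<in> {0..1}" for t
  proof (cases "t = 1")
    case False
    have "x = 0" if "M t *v x = 0" for x
    proof -
      have sv: "(t *\<^sub>R C) *v x = t *\<^sub>R (C *v x)"
        by (simp add: vec_eq_iff matrix_vector_mult_def scaleR_sum_right)
      have "x + t *\<^sub>R (C *v x) = 0"
        using that unfolding M_def by (simp add: matrix_vector_mult_add_rdistrib sv)
      then have "norm x = norm (t *\<^sub>R (C *v x))"
        by (metis add_eq_0_iff norm_minus_cancel)
      then have "(1 - t) * norm x = 0"
        using t by (simp add: unitary_norm [OF C] algebra_simps)
      then show ?thesis
        using False by simp
    qed
    then show ?thesis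
      unfolding invertible_iff_kernel by blast
  qed (simp add: M_def inv)
  define a where "a t = cnj (det (M t)) / of_real (norm (det (M t)))" for t
  define U where "U t = M t ** matrix_inv (cadj (M t))" for t
  have M_cont: "continuous_on S M" for S
    unfolding M_def by (intro continuous_intros)
  have dM: "det (M t) \<noteq> 0" if "t \<in> {0..1}" for t
    using inv [OF that] invertible_det_nz by blast
  have inv': "invertible (cadj (M t))" if "t \<in> {0..1}" for t
    using dM [OF that] by (simp add: invertible_det_nz det_cadj)
  have "path_component v_stabilizer (kmat (a 0) (U 0)) (kmat (a 1) (U 1))"
  proof (rule path_component_of_function)
    show "continuous_on {0..1} (\<lambda>t. kmat (a t) (U t))"
      unfolding a_def U_def
      by (intro continuous_intros M_cont continuous_on_matrix_inv) (use dM inv' in auto)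
    show "kmat (a t) (U t) \<in> v_stabilizer" if "t \<in> {0..1}" for t
      using unitary_of_normal [OF normal inv [OF that]]
      by (simp add: v_stabilizer_iff a_def U_def)
  qed
  moreover have "kmat (a 0) (U 0) = mat 1"
    by (simp add: a_def U_def M_def kmat_1)
  moreover have "U 1 = C"
  proof -
    have "C ** cadj (M 1) = M 1"
      unfolding cM unfolding M_def by (simp add: matrix_ring_simps unitary_right [OF C] add.commute)
    then have "U 1 = C ** (cadj (M 1) ** matrix_inv (cadj (M 1)))"
      by (simp add: U_def matrix_mul_assoc)
    then show ?thesis
      by (simp add: matrix_inv_left_right inv')
  qed
  ultimately show thesis
    using that by simp
qed

text \<open>The double covering of the unitary group given by a square root of the determinant is connected:
  turning a single eigenvalue once around the circle exchanges the two square roots.\<close>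

lemma path_component_minus_1: "path_component v_stabilizer (mat 1) (kmat (- 1) (mat 1 :: complex^'w::finite^'w))"
proof -
  define e :: "complex \<Rightarrow> 'w \<Rightarrow> complex" where "e u i = (if i = (SOME i. True) then u else 1)" for u i
  define D where "D u = (\<chi> i j. if i = j then e u i else 0 :: complex^'w^'w)" for u
  have det: "det (D u) = u" for u
    by (subst det_diagonal) (simp_all add: D_def e_def)
  have D1: "D 1 = mat 1"
    by (simp add: D_def vec_eq_iff mat_nth e_def)
  have "path_component v_stabilizer (kmat (cis (- (pi * 0))) (D (cis (2 * pi * 0))))
      (kmat (cis (- (pi * 1))) (D (cis (2 * pi * 1))))"
  proof (rule path_component_of_function)
    have "continuous_on {0..1} (\<lambda>t::real. D (cis (2 * pi * t)))"
      unfolding D_def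
    proof (intro continuous_on_vec_lambda)
      show "continuous_on {0..1} (\<lambda>t::real.
          if i = j then e (cis (2 * pi * t)) i else 0)" for i j :: 'w
        unfolding e_def
        by (cases "i = j"; cases "i = (SOME i. True)") (auto intro!: continuous_intros)
    qed
    then show "continuous_on {0..1} (\<lambda>t::real. kmat (cis (- (pi * t))) (D (cis (2 * pi * t))))"
      by (intro continuous_intros)
    fix t :: real
    have "cadj (D (cis s)) ** D (cis s) = mat 1" for s
    proof -
      have e1: "cnj (e (cis s) i) * e (cis s) i = 1" for i
        by (simp add: e_def cis_cnj cis_mult)
      have "(cadj (D (cis s)) ** D (cis s)) $ i $ j =
          (\<Sum>k\<in>UNIV. if k = i then cnj (e (cis s) i) * (if i = j then e (cis s) i else 0) else 0)"
        for i j
      proof -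
        have "(cadj (D (cis s)) ** D (cis s)) $ i $ j =
            (\<Sum>k\<in>UNIV. cnj (D (cis s) $ k $ i) * D (cis s) $ k $ j)"
          by (simp add: matrix_matrix_mult_def)
        also have "\<dots> = (\<Sum>k\<in>UNIV.
            if k = i then cnj (e (cis s) i) * (if i = j then e (cis s) i else 0) else 0)"
          by (rule sum.cong) (auto simp: D_def)
        finally show ?thesis .
      qed
      then show ?thesis
        by (simp add: vec_eq_iff mat_nth e1)
    qed
    then show "kmat (cis (- (pi * t))) (D (cis (2 * pi * t))) \<in> v_stabilizer"
      unfolding v_stabilizer_iff unitary_group_def det power2_eq_square cis_mult by simp
  qed
  moreover have "cis (- pi) = - 1"
    by (simp add: complex_eq_iff)
  ultimately show ?thesis
    by (simp add: D1 kmat_1)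
qed

lemma path_component_scalar:
  assumes "norm (c :: complex) = 1"
  obtains w where "path_component v_stabilizer (mat 1) (kmat w (mat c :: complex^'w::finite^'w))"
proof -
  define m where "m = real CARD('w)"
  obtain \<theta> where \<theta>: "c = cis \<theta>"
  proof -
    have "c \<noteq> 0"
      using assms by auto
    then have "c = cis (Arg c)"
      using assms by (simp add: cis_Arg sgn_eq)
    then show thesis
      by (rule that)
  qed
  have "path_component v_stabilizer
      (kmat (cis (- (m * \<theta> * 0 / 2))) (mat (cis (\<theta> * 0)) :: complex^'w^'w))
      (kmat (cis (- (m * \<theta> * 1 / 2))) (mat (cis (\<theta> * 1))))"
  proof (rule path_component_of_function)
    have "continuous_on {0..1} (\<lambda>t::real. mat (cis (\<theta> * t)) :: complex^'w^'w)"
      unfolding mat_def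
    proof (intro continuous_on_vec_lambda)
      show "continuous_on {0..1} (\<lambda>t::real. if i = j then cis (\<theta> * t) else 0)" for i j :: 'w
        by (cases "i = j") (auto intro!: continuous_intros)
    qed
    then show "continuous_on {0..1}
        (\<lambda>t::real. kmat (cis (- (m * \<theta> * t / 2))) (mat (cis (\<theta> * t)) :: complex^'w^'w))"
      by (intro continuous_intros) auto
    fix t :: real
    have "(cis (- (m * \<theta> * t / 2)))\<^sup>2 * cis (\<theta> * t) ^ CARD('w) = 1"
    proof -
      have "- (m * \<theta> * t / 2) + - (m * \<theta> * t / 2) + m * (\<theta> * t) = 0"
        by simp
      moreover have "(cis x)\<^sup>2 * cis y ^ CARD('w) = cis (x + x + m * y)" for x y
      proof -
        have "cis y ^ CARD('w) = cis (m * y)"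
          unfolding m_def by (rule Complex.DeMoivre)
        then show ?thesis
          by (simp only: power2_eq_square cis_mult)
      qed
      ultimately show ?thesis
        by (simp only: cis_zero)
    qed
    then show "kmat (cis (- (m * \<theta> * t / 2))) (mat (cis (\<theta> * t)) :: complex^'w^'w) \<in> v_stabilizer"
      by (simp add: v_stabilizer_iff unitary_mat det_mat)
  qed
  then show thesis
    using that by (simp add: \<theta> kmat_1)
qed

text \<open>A scalar factor moves \<open>-1\<close> out of the spectrum, so that the Cayley path applies; the remaining
  ambiguity is the sign of the square root of the determinant.\<close>

lemma connected_v_stabilizer: "connected (v_stabilizer :: 'w::finite mat2 set)"
proof -
  have "path_component v_stabilizer (mat 1) k" if k: "k \<in> v_stabilizer" for k :: "'w mat2"
  proof -
    obtain a B where k: "k = kmat a B" "B \<in> unitary_group" "a\<^sup>2 * det B = 1"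
      using k by (rule v_stabilizerE) blast
    obtain c where c: "norm c = 1" "invertible (mat c + B)"
      using unitary_non_eigenvalue [OF k(2)] by blast
    have cc: "cnj c * c = 1" "norm (cnj c) = 1"
      using c(1) cnj_mult_self_1 by auto
    define C where "C = mat (cnj c) ** B"
    have C: "C \<in> unitary_group"
      unfolding C_def by (intro unitary_mult unitary_mat cc k)
    have "mat 1 + C = mat (cnj c) ** (mat c + B)"
      by (simp add: C_def matrix_ring_simps mat_mult_mat cc)
    moreover have "invertible (mat (cnj c) :: complex^'w^'w)"
      using cc by (auto simp: invertible_det_nz det_mat)
    ultimately have "invertible (mat 1 + C)"
      using c(2) by (simp add: invertible_mult)
    with C obtain a1 where 1: "path_component v_stabilizer (mat 1) (kmat a1 C)"
      by (rule path_component_cayley)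
    obtain w where 2: "path_component v_stabilizer (mat 1) (kmat w (mat c :: complex^'w^'w))"
      using path_component_scalar [OF c(1)] by blast
    have "mat c ** C = B"
      using cc by (simp add: C_def matrix_mul_assoc mat_mult_mat mult.commute)
    then have 3: "path_component v_stabilizer (mat 1) (kmat (w * a1) B)"
      using path_component_v_stabilizer_mult [OF 2 1] by (simp add: kmat_mult)
    then have "kmat (w * a1) B \<in> v_stabilizer"
      using path_component_mem by blast
    then have "(w * a1)\<^sup>2 * det B = a\<^sup>2 * det B"
      using k(3) by (simp add: v_stabilizer_iff)
    moreover have "det B \<noteq> 0"
      using unitary_norm_det [OF k(2)] by auto
    ultimately have "a = w * a1 \<or> a = - (w * a1)"
      by (metis mult_right_cancel power2_eq_iff)
    then show ?thesis
      using 3 path_component_v_stabilizer_mult [OF path_component_minus_1 3]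
      by (auto simp: k(1) kmat_mult)
  qed
  then have "path_connected (v_stabilizer :: 'w mat2 set)"
    unfolding path_connected_component using path_component_sym path_component_trans by blast
  then show ?thesis
    by (rule path_connected_imp_connected)
qed

lemma K_v_eq: "K_v = v_stabilizer"
  unfolding K_v_def v_stabilizer_eq
  by (rule connected_component_eq_self [OF connected_v_stabilizer v_stabilizer_1])

lemma compact_v_stabilizer: "compact (v_stabilizer :: 'w::finite mat2 set)"
proof -
  let ?S = "{X :: 'w mat2. X = kmat (X $ None $ None) (W_block X) \<and> cadj X ** X = mat 1 \<and> det X = 1}"
  have eq: "v_stabilizer = ?S"
  proof (intro equalityI subsetI)
    fix X :: "'w mat2" assume "X \<in> v_stabilizer"
    then obtain a B where X: "X = kmat a B" "B \<in> unitary_group" "a\<^sup>2 * det B = 1" "norm a = 1"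
      by (rule v_stabilizerE)
    then show "X \<in> ?S"
      using cnj_mult_self_1 [of a] unitary_left [OF X(2)]
      by (simp add: X(1) cadj_kmat kmat_mult kmat_1 det_kmat)
  next
    fix X :: "'w mat2" assume X: "X \<in> ?S"
    define a B where "a = X $ None $ None" and "B = W_block X"
    have X': "X = kmat a B" "cadj X ** X = mat 1" "det X = 1"
      using X by (auto simp: a_def B_def)
    then have "kmat (cnj a * a) (cadj B ** B) = kmat 1 (mat 1)"
      by (simp add: cadj_kmat kmat_mult kmat_1)
    then have "cadj B ** B = mat 1"
      by (simp add: kmat_eq_iff)
    then show "X \<in> v_stabilizer"
      using X'(1,3) by (simp add: v_stabilizer_iff unitary_group_def det_kmat)
  qed
  have W: "continuous_on UNIV (W_block :: 'w mat2 \<Rightarrow> _)"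
    unfolding W_block_def by (intro continuous_intros)
  have "closed ?S"
    by (intro closed_Collect_conj closed_Collect_eq continuous_intros W)
  moreover have "norm X \<le> sqrt CARD('w option option)" if "X \<in> ?S" for X :: "'w mat2"
    using that unitary_matrix_norm [of X] by (simp add: unitary_group_def)
  then have "bounded ?S"
    unfolding bounded_iff by blast
  ultimately show ?thesis
    unfolding eq compact_eq_bounded_closed by blast
qed

lemma cc_subgroup_K_v: "cc_subgroup K_v"
  unfolding cc_subgroup_def K_v_eq
  by (intro conjI ballI v_stabilizer_subset_SU1n v_stabilizer_1 v_stabilizer_mult v_stabilizer_inv
    compact_v_stabilizer connected_v_stabilizer)

section \<open>The reductive decomposition\<close>

lemma sum_spaces_Nil: "sum_spaces [] = {0}"
  by (simp add: sum_spaces_def)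

lemma sum_spaces_Cons: "sum_spaces (A # As) = {a + b | a b. a \<in> A \<and> b \<in> sum_spaces As}"
proof (intro equalityI subsetI)
  fix x assume "x \<in> {a + b | a b. a \<in> A \<and> b \<in> sum_spaces As}"
  then obtain a xs where a: "a \<in> A" "xs \<in> listset As" "x = sum_list (a # xs)"
    unfolding sum_spaces_def by auto
  then have "a # xs \<in> listset (A # As)"
    by (simp add: set_Cons_def)
  then show "x \<in> sum_spaces (A # As)"
    unfolding sum_spaces_def a(3) by (rule imageI)
qed (force simp: sum_spaces_def set_Cons_def)

lemma sum_spaces_2: "sum_spaces [A, B] = {a + b | a b. a \<in> A \<and> b \<in> B}"
  by (auto simp: sum_spaces_Cons sum_spaces_Nil)

lemma sum_spaces_4: "sum_spaces [A, B, C, D] =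
    {a + (b + (c + d)) | a b c d. a \<in> A \<and> b \<in> B \<and> c \<in> C \<and> d \<in> D}"
  unfolding sum_spaces_Cons [of A] sum_spaces_Cons [of B] sum_spaces_2 by blast

lemma scaleR_complex_mult: "r *\<^sub>R z = of_real r * z" for z :: complex
  by (rule scaleR_conv_of_real)

lemma trace_mat: "trace (mat c :: complex^'n^'n) = of_nat CARD('n) * c"
  by (simp add: trace_def mat_nth)

lemma skew_hermitian_nth:
  assumes "S \<in> skew_hermitian"
  shows "S $ i $ j = - cnj (S $ j $ i)"
proof -
  have "cadj S $ i $ j = (- S) $ i $ j"
    using assms by (simp only: skew_hermitian_def mem_Collect_eq)
  then show ?thesis
    by simp
qed

lemma skew_hermitianI:
  assumes "\<And>i j. S $ i $ j = - cnj (S $ j $ i)"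
  shows "S \<in> skew_hermitian"
proof -
  have "cnj (S $ j $ i) = - S $ i $ j" for i j
    using arg_cong [OF assms [of i j], of uminus] by simp
  then show ?thesis
    by (simp add: skew_hermitian_def vec_eq_iff)
qed

lemma subspace_skew_hermitian: "subspace skew_hermitian"
  unfolding skew_hermitian_def
  by (rule subspaceI) (simp_all add: cadj_0 cadj_add cadj_scaleR)

lemma skew_hermitian_trace:
  assumes "S \<in> skew_hermitian"
  shows "Re (trace S) = 0"
proof -
  have "Re (S $ i $ i) = 0" for i
    using arg_cong [OF skew_hermitian_nth [OF assms, of i i], of Re] by simp
  then show ?thesis
    by (simp add: trace_def)
qed

lemma kmat_su1n_iff:
  "kmat a S \<in> su1n \<longleftrightarrow> S \<in> skew_hermitian \<and> 2 * a + trace S = 0"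
proof (intro iffI conjI)
  assume *: "kmat a S \<in> su1n"
  show "2 * a + trace S = 0"
    using * by (simp add: su1n_def trace_kmat)
  show "S \<in> skew_hermitian"
  proof (rule skew_hermitianI)
    show "S $ i $ j = - cnj (S $ j $ i)" for i j
      using su1n_nth(2) [OF *, of "Some i" "Some j"] by (simp only: kmat_nth)
  qed
next
  assume *: "S \<in> skew_hermitian \<and> 2 * a + trace S = 0"
  then have S: "S \<in> skew_hermitian" and tr: "2 * a + trace S = 0"
    by auto
  have "Re (2 * a + trace S) = 0"
    using tr by simp
  then have "Re a = 0"
    using skew_hermitian_trace [OF S] by simp
  then have a: "cnj a = - a"
    by (simp add: complex_eq_iff)
  show "kmat a S \<in> su1n"
  proof (rule su1nI)
    fix i j :: "'a option"
    show "kmat a S $ Some i $ Some j = - cnj (kmat a S $ Some j $ Some i)"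
    proof (cases i; cases j)
      fix k l assume "i = Some k" "j = Some l"
      then show ?thesis
        using skew_hermitian_nth [OF S, of k l] by (simp only: kmat_nth)
    qed (simp_all add: a)
  qed (use a tr in \<open>simp_all add: trace_kmat\<close>)
qed

lemma su_W_eq: "su_W = {kmat 0 B | B. B \<in> skew_hermitian \<and> trace B = 0}"
  by (simp add: su_W_def kmat_def)

lemma z_elt_eq: "z_elt = (kmat \<i> (mat (- (2 / of_nat CARD('w)) * \<i>)) :: 'w::finite mat2)"
  by (simp add: z_elt_def kmat_def)

lemma skew_hermitian_mat: "mat (of_real t * \<i>) \<in> skew_hermitian"
  by (rule skew_hermitianI) (simp add: mat_nth)

lemma kmat_add: "kmat a S + kmat b T = kmat (a + b) (S + T)"
  by (auto simp: vec_eq_iff all_option)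

lemma kmat_diff: "kmat a S - kmat b T = kmat (a - b) (S - T)"
  by (auto simp: vec_eq_iff all_option)

lemma kmat_scaleR: "r *\<^sub>R kmat a S = kmat (r *\<^sub>R a) (r *\<^sub>R S)"
  by (auto simp: vec_eq_iff all_option)

text \<open>Subtracting a multiple of \<open>z\<close> makes the block on \<open>W\<close> traceless.\<close>

lemma h_space_eq:
  "h_space = {kmat a S | a S. S \<in> skew_hermitian \<and> 2 * a + trace S = 0}" (is "_ = ?H")
proof (intro equalityI subsetI)
  let ?\<mu> = "mat (of_real (- (2 / real CARD('a))) * \<i>) :: complex^'a^'a"
  have z: "z_elt = (kmat \<i> ?\<mu> :: 'a mat2)"
    by (simp add: z_elt_eq)
  have tr_mu: "trace ?\<mu> = - 2 * \<i>"
    by (simp add: trace_mat)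
  have mu: "?\<mu> \<in> skew_hermitian"
    by (rule skew_hermitian_mat)
  {
    fix X :: "'a mat2" assume "X \<in> h_space"
    then obtain B t where X: "X = kmat 0 B + t *\<^sub>R z_elt" "B \<in> skew_hermitian" "trace B = 0"
      unfolding h_space_def sum_spaces_2 su_W_eq real_line_def by blast
    then have "X = kmat (t *\<^sub>R \<i>) (B + t *\<^sub>R ?\<mu>)"
      by (simp add: z kmat_add kmat_scaleR)
    moreover have "B + t *\<^sub>R ?\<mu> \<in> skew_hermitian"
      by (intro subspace_add subspace_scale subspace_skew_hermitian mu X)
    moreover have "2 * (t *\<^sub>R \<i>) + trace (B + t *\<^sub>R ?\<mu>) = 0"
      unfolding trace_add trace_scaleR X tr_mu by (simp add: scaleR_complex_mult)
    ultimately show "X \<in> ?H"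
      by blast
  next
    fix X :: "'a mat2" assume "X \<in> ?H"
    then obtain a S where X: "X = kmat a S" "S \<in> skew_hermitian" "2 * a + trace S = 0"
      by blast
    define r where "r = Im a"
    have "Re (2 * a + trace S) = 0"
      using X(3) by simp
    then have a: "a = r *\<^sub>R \<i>"
      using skew_hermitian_trace [OF X(2)] by (simp add: complex_eq_iff r_def)
    let ?B = "S - r *\<^sub>R ?\<mu>"
    have "?B \<in> skew_hermitian"
      by (intro subspace_diff subspace_scale subspace_skew_hermitian mu X)
    moreover have "trace ?B = 2 * a + trace S"
      unfolding trace_sub trace_scaleR tr_mu a by (simp add: scaleR_complex_mult)
    then have "trace ?B = 0"
      using X(3) by simp
    ultimately have "kmat 0 ?B \<in> su_W"
      unfolding su_W_eq by blast
    moreover have "X = kmat 0 ?B + r *\<^sub>R z_elt"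
      by (simp add: z kmat_add kmat_scaleR X(1) a)
    ultimately show "X \<in> h_space"
      unfolding h_space_def sum_spaces_2 real_line_def by blast
  }
qed

lemma h_space_iff: "X \<in> h_space \<longleftrightarrow> X \<in> su1n \<and> X \<in> range (\<lambda>(a, B). kmat a B)"
  unfolding h_space_eq using kmat_su1n_iff by auto

lemma h_space_subset_su1n: "h_space \<subseteq> su1n"
  using h_space_iff by blast

lemma subspace_kmats: "subspace (range (\<lambda>(a, B). kmat a B))"
  by (rule linear_subspace_image) (simp_all add: bounded_linear_kmat bounded_linear.linear)

lemma subspace_h_space: "subspace h_space"
proof -
  have "h_space = su1n \<inter> range (\<lambda>(a, B). kmat a B :: 'a mat2)"
    using h_space_iff by blast
  then show ?thesis
    using subspace_inter [OF subspace_su1n subspace_kmats] by metis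
qed

text \<open>The Cayley transform \<open>U t = (1 + t S / 2) (1 - t S / 2)\<^sup>-\<^sup>1\<close>. It satisfies
  \<open>U t - 1 - t S = t (U t - 1) S / 2\<close>, so continuity at \<open>0\<close> already gives the derivative.\<close>

lemma cayley_curve:
  assumes S: "(S :: complex^'n^'n) \<in> skew_hermitian"
  obtains U :: "real \<Rightarrow> complex^'n^'n" where "\<And>t. U t \<in> unitary_group" "U 0 = mat 1"
    "(U has_vector_derivative S) (at 0)"
proof -
  define M where "M t = mat 1 + (t / 2) *\<^sub>R S" for t
  have "cadj S = - S"
    using S by (simp add: skew_hermitian_def)
  then have cM: "cadj (M t) = mat 1 - (t / 2) *\<^sub>R S" for t
    by (simp add: M_def cadj_add cadj_scaleR)
  have "(mat 1 + X) ** (mat 1 - X) = (mat 1 - X) ** (mat 1 + X)" for X :: "complex^'n^'n"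
    by (simp add: matrix_ring_simps)
  then have normal: "M t ** cadj (M t) = cadj (M t) ** M t" for t
    unfolding cM unfolding M_def .
  have inv: "invertible (M t)" for t
    unfolding invertible_iff_kernel
  proof (intro allI impI)
    fix x assume x: "M t *v x = 0"
    have "hprod x (S *v x) = - cnj (hprod x (S *v x))"
    proof -
      have "hprod x (S *v x) = hprod ((- S) *v x) x"
        by (simp add: hprod_adjoint \<open>cadj S = - S\<close>)
      also have "\<dots> = - cnj (hprod x (S *v x))"
        by (simp add: hprod_def matrix_vector_mult_def sum_negf mult.commute)
      finally show ?thesis .
    qed
    then have im: "Re (hprod x (S *v x)) = 0"
      by (simp add: complex_eq_iff)
    have "M t *v x = x + (t / 2) *\<^sub>R (S *v x)"
      unfolding M_def
      by (simp add: matrix_vector_mult_add_rdistrib) 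
         (simp add: vec_eq_iff matrix_vector_mult_def scaleR_sum_right)
    then have "hprod x (M t *v x) = hprod x x + of_real (t / 2) * hprod x (S *v x)"
      by (simp add: hprod_def sum.distrib sum_distrib_left scaleR_complex_mult algebra_simps)
    then have "Re (hprod x (M t *v x)) = (norm x)\<^sup>2"
      using im by (simp add: hprod_self)
    moreover have "hprod x (M t *v x) = 0"
      unfolding x by (simp add: hprod_def)
    ultimately show "x = 0"
      by simp
  qed
  have inv': "invertible (cadj (M t))" for t
    using inv [of t] by (simp add: invertible_det_nz det_cadj)
  define U where "U t = M t ** matrix_inv (cadj (M t))" for t
  have U0: "U 0 = mat 1"
    by (simp add: U_def M_def)
  have "continuous_on UNIV U"
    unfolding U_def by (intro continuous_intros continuous_on_matrix_inv inv')
      (auto simp: M_def intro!: continuous_intros)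
  then have U_lim: "(U \<longlongrightarrow> mat 1) (at 0)"
    using U0 by (metis UNIV_I continuous_on_def)
  have key: "U t - U 0 - t *\<^sub>R S = t *\<^sub>R ((1 / 2) *\<^sub>R ((U t - mat 1) ** S))" for t
  proof -
    have "U t ** cadj (M t) = M t"
      by (simp add: U_def matrix_mul_assoc [symmetric] matrix_inv_left_right inv')
    then have "U t - (t / 2) *\<^sub>R (U t ** S) = mat 1 + (t / 2) *\<^sub>R S"
      unfolding cM by (simp add: matrix_ring_simps M_def)
    moreover have "a - b = c + d" if "a - d = b + c" for a b c d :: "complex^'n^'n"
      using that by (simp add: algebra_simps)
    ultimately have "U t - mat 1 = (t / 2) *\<^sub>R S + (t / 2) *\<^sub>R (U t ** S)"
      by blast
    then have "U t - U 0 - t *\<^sub>R S = (t / 2) *\<^sub>R S + (t / 2) *\<^sub>R (U t ** S) - t *\<^sub>R S"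
      using U0 by simp
    also have "\<dots> = (t / 2) *\<^sub>R (U t ** S) - (t / 2) *\<^sub>R S"
    proof -
      have "t *\<^sub>R S = (t / 2) *\<^sub>R S + (t / 2) *\<^sub>R S"
        by (simp add: scaleR_add_left [symmetric])
      then show ?thesis
        by simp
    qed
    finally show ?thesis
      by (simp add: matrix_ring_simps scaleR_diff_right)
  qed
  have lim: "((\<lambda>t. (1 / 2) *\<^sub>R ((U t - mat 1) ** S)) \<longlongrightarrow> 0) (at 0)"
  proof -
    have "((\<lambda>t. (1 / 2) *\<^sub>R ((U t - mat 1) ** S)) \<longlongrightarrow> (1 / 2) *\<^sub>R ((mat 1 - mat 1) ** S)) (at 0)"
      by (intro tendsto_intros U_lim)
    then show ?thesis
      by simp
  qed
  have "(U has_vector_derivative S) (at 0)"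
    unfolding has_vector_derivative_at_0_iff
  proof (intro allI impI)
    fix e :: real assume e: "e > 0"
    obtain d where d: "d > 0"
      "\<And>t. t \<noteq> 0 \<Longrightarrow> \<bar>t\<bar> < d \<Longrightarrow> norm ((1 / 2) *\<^sub>R ((U t - mat 1) ** S)) < e"
      using lim e unfolding tendsto_iff eventually_at by (force simp: dist_norm)
    have "norm (U t - U 0 - t *\<^sub>R S) \<le> e * \<bar>t\<bar>" if "\<bar>t\<bar> < d" for t
    proof (cases "t = 0")
      case False
      then have "norm ((1 / 2) *\<^sub>R ((U t - mat 1) ** S)) \<le> e"
        using d(2) that by (intro less_imp_le)
      then have "\<bar>t\<bar> * norm ((1 / 2) *\<^sub>R ((U t - mat 1) ** S)) \<le> \<bar>t\<bar> * e"
        by (intro mult_left_mono) auto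
      then show ?thesis
        unfolding key norm_scaleR [of t] by (simp add: mult.commute)
    qed simp
    then show "\<exists>d>0. \<forall>t. \<bar>t\<bar> < d \<longrightarrow> norm (U t - U 0 - t *\<^sub>R S) \<le> e * \<bar>t\<bar>"
      using d(1) by blast
  qed
  moreover have "U t \<in> unitary_group" for t
    unfolding U_def by (rule unitary_of_normal [OF normal inv])
  ultimately show thesis
    using U0 that by blast
qed

text \<open>The principal square root of \<open>1 / det B\<close> lifts a unitary matrix to the stabilizer; near the
  identity the lift is continuous and differentiable.\<close>

definition lift :: "complex^'w^'w \<Rightarrow> 'w::finite mat2"
  where "lift B = kmat (csqrt (inverse (det B))) B"

lemma lift_in:
  assumes "B \<in> unitary_group"
  shows "lift B \<in> v_stabilizer"
proof -
  have "det B \<noteq> 0"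
    using unitary_norm_det [OF assms] by auto
  then show ?thesis
    using assms by (simp add: lift_def v_stabilizer_iff)
qed

text \<open>A curve in the stabilizer has velocity \<open>kmat a S\<close>, and membership in \<open>su(1,n)\<close> supplies skewness of
  \<open>S\<close> and the trace condition. Conversely the Cayley curve of \<open>S\<close> lifts, and the derivative of the
  determinant is the trace.\<close>

lemma lie_algebra_K_v: "lie_algebra K_v = (h_space :: 'w::finite mat2 set)"
proof (intro equalityI subsetI)
  fix X :: "'w mat2" assume X: "X \<in> lie_algebra K_v"
  then obtain \<gamma> where \<gamma>: "\<And>t. \<gamma> t \<in> K_v" "(\<gamma> has_vector_derivative X) (at 0)"
    by (rule lie_algebraE) blast
  have "\<gamma> t \<in> range (\<lambda>(a, B). kmat a B)" for t
    using \<gamma>(1) [of t] unfolding K_v_eq v_stabilizer_def by (auto simp: image_iff)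
  then have "X \<in> range (\<lambda>(a, B). kmat a B)"
    by (rule derivative_in_subspace [OF \<gamma>(2) subspace_kmats])
  moreover have "X \<in> su1n"
    using X lie_algebra_su1n v_stabilizer_subset_SU1n unfolding K_v_eq by blast
  ultimately show "X \<in> h_space"
    by (simp add: h_space_iff)
next
  fix X :: "'w mat2" assume "X \<in> h_space"
  then obtain a S where X: "X = kmat a S" and S: "S \<in> skew_hermitian" and tr: "2 * a + trace S = 0"
    unfolding h_space_eq by blast
  obtain U :: "real \<Rightarrow> complex^'w^'w" where U: "\<And>t. U t \<in> unitary_group" "U 0 = mat 1"
    "(U has_vector_derivative S) (at 0)"
    using cayley_curve [OF S] by blast
  have "((\<lambda>t. det (U t)) has_vector_derivative trace S) (at 0)"
    by (rule has_vector_derivative_det_at_1 [OF U(3,2)])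
  moreover have "((\<lambda>z. csqrt (inverse z)) has_field_derivative - 1 / 2) (at (det (U 0)))"
    by (rule derivative_eq_intros refl | simp add: U(2))+
  ultimately have "((\<lambda>z. csqrt (inverse z)) \<circ> (\<lambda>t. det (U t)) has_vector_derivative
      trace S * (- 1 / 2)) (at 0)"
    by (rule field_vector_diff_chain_at)
  moreover have "trace S * (- 1 / 2) = a"
    using tr by (simp add: add_eq_0_iff)
  ultimately have "((\<lambda>t. csqrt (inverse (det (U t)))) has_vector_derivative a) (at 0)"
    by (simp add: o_def)
  then have "((\<lambda>t. lift (U t)) has_vector_derivative X) (at 0)"
    unfolding lift_def X using U(3) by (rule has_vector_derivative_kmat)
  moreover have "lift (U 0) = mat 1"
    by (simp add: lift_def U(2) kmat_1)
  ultimately show "X \<in> lie_algebra K_v"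
    unfolding K_v_eq by (intro lie_algebraI [where \<gamma> = "\<lambda>t. lift (U t)"] lift_in U)
qed

lemma W_block_covering_K_v: "W_block_covering (K_v :: 'w::finite mat2 set)"
  unfolding W_block_covering_def
proof (intro conjI ballI)
  fix g h :: "'w mat2" assume "g \<in> K_v" "h \<in> K_v"
  then show "W_block (g ** h) = W_block g ** W_block h"
    unfolding K_v_eq v_stabilizer_def by (auto simp: kmat_mult)
next
  show "W_block ` K_v = (unitary_group :: (complex^'w^'w) set)"
  proof (intro equalityI subsetI)
    fix B :: "complex^'w^'w" assume "B \<in> unitary_group"
    then have "lift B \<in> K_v" "W_block (lift B) = B"
      by (simp_all add: K_v_eq lift_in) (simp add: lift_def)
    then show "B \<in> W_block ` K_v"
      by (metis imageI)
  qed (auto simp: K_v_eq v_stabilizer_def)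
next
  have "{g \<in> K_v. W_block g = (mat 1 :: complex^'w^'w)} \<subseteq> {kmat 1 (mat 1), kmat (- 1) (mat 1)}"
    by (auto simp: K_v_eq v_stabilizer_def power2_eq_1_iff kmat_eq_iff)
  then show "finite {g \<in> K_v. W_block g = (mat 1 :: complex^'w^'w)}"
    by (rule finite_subset) simp
next
  show "bij_betw W_block (lie_algebra K_v) (skew_hermitian :: (complex^'w^'w) set)"
    unfolding lie_algebra_K_v
  proof (rule bij_betwI')
    fix X Y :: "'w mat2" assume "X \<in> h_space" "Y \<in> h_space"
    then obtain a S b T where "X = kmat a S" "2 * a + trace S = 0"
        and "Y = kmat b T" "2 * b + trace T = 0"
      unfolding h_space_eq by blast
    moreover from this have "S = T \<Longrightarrow> 2 * a = 2 * b"
      by (metis add_right_cancel)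
    ultimately show "W_block X = W_block Y \<longleftrightarrow> X = Y"
      by (auto simp: kmat_eq_iff)
  next
    fix X :: "'w mat2" assume "X \<in> h_space"
    then show "W_block X \<in> skew_hermitian"
      unfolding h_space_eq by auto
  next
    fix S :: "complex^'w^'w" assume "S \<in> skew_hermitian"
    moreover have "2 * (- trace S / 2) + trace S = 0"
      by simp
    ultimately have "kmat (- trace S / 2) S \<in> h_space"
      unfolding h_space_eq by blast
    then show "\<exists>X\<in>h_space. S = W_block X"
      by (metis W_block_kmat)
  qed
next
  fix X Y :: "'w mat2" assume "X \<in> lie_algebra K_v" "Y \<in> lie_algebra K_v"
  then show "W_block (bracket X Y) = bracket (W_block X) (W_block Y)"
    unfolding lie_algebra_K_v h_space_eq bracket_def by (auto simp: kmat_mult kmat_diff)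
qed

text \<open>Coordinates on the complement: the real coefficient of \<open>z'\<close>, and the vectors that parametrize the
  three remaining summands.\<close>

definition m_elt :: "real \<Rightarrow> complex^'w \<Rightarrow> complex \<Rightarrow> complex^'w \<Rightarrow> 'w::finite mat2"
  where "m_elt x w c p = x *\<^sub>R z'_elt + (n'_mat w + (Cv_mat c + p'_mat p))"

lemmas m_defs = z'_elt_def n'_mat_def Cv_mat_def p'_mat_def p_mat_def

lemma m_elt_nth [simp]:
  "m_elt x w c p $ None $ None = of_real x * \<i>"
  "m_elt x w c p $ None $ Some None = cnj c"
  "m_elt x w c p $ None $ Some (Some i) = cnj (p $ i)"
  "m_elt x w c p $ Some None $ None = c"
  "m_elt x w c p $ Some None $ Some None = - (of_real x * \<i>)"
  "m_elt x w c p $ Some None $ Some (Some i) = - cnj (w $ i)"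
  "m_elt x w c p $ Some (Some i) $ None = p $ i"
  "m_elt x w c p $ Some (Some i) $ Some None = w $ i"
  "m_elt x w c p $ Some (Some i) $ Some (Some j) = 0"
  by (simp_all add: m_elt_def m_defs scaleR_complex_mult)

lemma m_elt_su1n: "m_elt x w c p \<in> su1n"
proof (rule su1nI)
  fix i j :: "'a option"
  show "m_elt x w c p $ None $ Some i = cnj (m_elt x w c p $ Some i $ None)"
    by (cases i) auto
  show "m_elt x w c p $ Some i $ Some j = - cnj (m_elt x w c p $ Some j $ Some i)"
    by (cases i; cases j) auto
qed (simp_all add: trace_option sum_option)

lemma m_space_eq: "m_space = {m_elt x w c p | x w c p. True}"
  unfolding m_space_def sum_spaces_4 m_elt_def real_line_def by blast

lemma m_space_iff:
  "X \<in> m_space \<longleftrightarrow> X \<in> su1n \<and> W_block X = 0 \<and> X $ None $ None + X $ Some None $ Some None = 0"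
proof
  assume "X \<in> m_space"
  then obtain x w c p where X: "X = m_elt x w c p"
    unfolding m_space_eq by blast
  have "W_block X = 0"
    by (simp add: X W_block_def vec_eq_iff)
  then show "X \<in> su1n \<and> W_block X = 0 \<and> X $ None $ None + X $ Some None $ Some None = 0"
    by (simp add: X m_elt_su1n)
next
  assume X: "X \<in> su1n \<and> W_block X = 0 \<and> X $ None $ None + X $ Some None $ Some None = 0"
  then have S: "X \<in> su1n" and W: "X $ Some (Some i) $ Some (Some j) = 0" for i j
    by (simp_all add: W_block_def vec_eq_iff)
  define x where "x = Im (X $ None $ None)"
  have "Re (X $ None $ None) = 0"
    using arg_cong [OF su1n_nth(3) [OF S], of Re] by simp
  then have im: "X $ None $ None = of_real x * \<i>"
    by (simp add: complex_eq_iff x_def)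
  have im': "X $ Some None $ Some None = - (of_real x * \<i>)"
    using X im by (simp add: eq_neg_iff_add_eq_0 add.commute)
  have "X = m_elt x (\<chi> i. X $ Some (Some i) $ Some None)
      (X $ Some None $ None) (\<chi> i. X $ Some (Some i) $ None)"
    by (simp add: vec_eq_iff all_option su1n_nth(1) [OF S] su1n_nth(2) [OF S, of None "Some i" for i] im im' W)
  then show "X \<in> m_space"
    unfolding m_space_eq by blast
qed

text \<open>The projection to \<open>h\<close> keeps the block on \<open>W\<close> and the mean of the first two diagonal entries.\<close>

lemma su1n_decomposition:
  assumes X: "X \<in> su1n"
  obtains h x w c p where "h \<in> h_space" "X = h + m_elt x w c p"
proof -
  define h where "h = kmat ((X $ None $ None + X $ Some None $ Some None) / 2) (W_block X)"
  have S: "W_block X \<in> skew_hermitian"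
  proof (rule skew_hermitianI)
    show "W_block X $ i $ j = - cnj (W_block X $ j $ i)" for i j
      using su1n_nth(2) [OF X, of "Some i" "Some j"] by (simp only: W_block_def vec_lambda_beta)
  qed
  have "trace X = X $ None $ None + (X $ Some None $ Some None + trace (W_block X))"
    by (simp add: trace_option sum_option W_block_def) (simp add: trace_def)
  moreover have "trace X = 0"
    using X by (simp add: su1n_def)
  moreover have "2 * ((b + c) / 2) + d = a" if "a = b + (c + d)" for a b c d :: complex
    using that by simp
  ultimately have "2 * ((X $ None $ None + X $ Some None $ Some None) / 2) + trace (W_block X) = 0"
    by metis
  then have h: "h \<in> h_space"
    using S unfolding h_space_eq h_def by blast
  moreover have "X - h \<in> m_space"
    unfolding m_space_iff
    using subspace_diff [OF subspace_su1n X] h h_space_subset_su1n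
    by (auto simp: h_def W_block_def vec_eq_iff field_simps)
  then obtain x w c p where "X - h = m_elt x w c p"
    unfolding m_space_eq by blast
  then have "X = h + m_elt x w c p"
    by (simp add: algebra_simps)
  ultimately show thesis
    by (rule that)
qed

lemma linear_n'_mat: "linear n'_mat"
  by (rule linearI) (auto simp: n'_mat_def vec_eq_iff all_option)

lemma linear_p'_mat: "linear p'_mat"
  by (rule linearI) (auto simp: p'_mat_def p_mat_def vec_eq_iff all_option)

lemma linear_Cv_mat: "linear Cv_mat"
  by (rule linearI) (auto simp: Cv_mat_def p_mat_def vec_eq_iff all_option)

lemma subspace_real_line: "subspace (real_line x)"
  unfolding real_line_def span_singleton [symmetric] by (rule subspace_span)

lemma subspace_su_W: "subspace su_W"
proof -
  have "linear (\<lambda>B. kmat 0 B :: 'a mat2)"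
    by (rule linearI) (auto simp: vec_eq_iff all_option)
  moreover have "subspace (skew_hermitian \<inter> {B :: complex^'a^'a. trace B = 0})"
    by (intro subspace_inter subspace_skew_hermitian subspaceI)
      (auto simp: trace_zero trace_add trace_scaleR)
  ultimately have "subspace ((\<lambda>B. kmat 0 B :: 'a mat2) ` (skew_hermitian \<inter> {B. trace B = 0}))"
    by (rule linear_subspace_image)
  moreover have "su_W = (\<lambda>B. kmat 0 B :: 'a mat2) ` (skew_hermitian \<inter> {B. trace B = 0})"
    unfolding su_W_eq by blast
  ultimately show ?thesis
    by simp
qed

lemma direct_sum_h_space: "direct_sum_of h_space [su_W :: 'w::finite mat2 set, real_line z_elt]"
  unfolding direct_sum_of_def
proof (intro conjI)
  show "\<forall>U\<in>set [su_W :: 'w mat2 set, real_line z_elt]. subspace U"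
    by (simp add: subspace_su_W subspace_real_line)
  show "h_space = sum_spaces [su_W :: 'w mat2 set, real_line z_elt]"
    by (rule h_space_def)
  show "inj_on sum_list (listset [su_W :: 'w mat2 set, real_line z_elt])"
  proof (rule inj_onI)
    fix Xs Ys :: "'w mat2 list"
    assume Xs: "Xs \<in> listset [su_W, real_line z_elt]" and Ys: "Ys \<in> listset [su_W, real_line z_elt]"
      and eq: "sum_list Xs = sum_list Ys"
    obtain B s where X: "Xs = [kmat 0 B, s *\<^sub>R z_elt]"
      using Xs by (auto simp: set_Cons_def su_W_eq real_line_def)
    obtain C t where Y: "Ys = [kmat 0 C, t *\<^sub>R z_elt]"
      using Ys by (auto simp: set_Cons_def su_W_eq real_line_def)
    have "(kmat 0 B + s *\<^sub>R z_elt) $ None $ None = (kmat 0 C + t *\<^sub>R z_elt) $ None $ None"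
      using eq by (simp add: X Y)
    then have "s = t"
      by (simp add: z_elt_def complex_eq_iff)
    then show "Xs = Ys"
      using eq by (simp add: X Y)
  qed
qed

lemma direct_sum_m_space: "direct_sum_of m_space
    [real_line (z'_elt :: 'w::finite mat2), range n'_mat, range Cv_mat, range p'_mat]"
  unfolding direct_sum_of_def
proof (intro conjI)
  let ?L = "[real_line (z'_elt :: 'w mat2), range n'_mat, range Cv_mat, range p'_mat]"
  show "\<forall>U\<in>set ?L. subspace U"
    using linear_subspace_image [OF linear_n'_mat subspace_UNIV]
      linear_subspace_image [OF linear_Cv_mat subspace_UNIV]
      linear_subspace_image [OF linear_p'_mat subspace_UNIV]
    by (simp add: subspace_real_line)
  show "m_space = sum_spaces ?L"
    by (rule m_space_def)
  show "inj_on sum_list (listset ?L)"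
  proof (rule inj_onI)
    fix Xs Ys :: "'w mat2 list"
    assume Xs: "Xs \<in> listset ?L" and Ys: "Ys \<in> listset ?L" and eq: "sum_list Xs = sum_list Ys"
    obtain x w c p where X: "Xs = [x *\<^sub>R z'_elt, n'_mat w, Cv_mat c, p'_mat p]"
      using Xs by (auto simp: set_Cons_def real_line_def)
    obtain y w' c' p' where Y: "Ys = [y *\<^sub>R z'_elt, n'_mat w', Cv_mat c', p'_mat p']"
      using Ys by (auto simp: set_Cons_def real_line_def)
    have "m_elt x w c p = m_elt y w' c' p'"
      using eq by (simp add: X Y m_elt_def)
    then have e: "m_elt x w c p $ i $ j = m_elt y w' c' p' $ i $ j" for i j
      by simp
    have "x = y" "c = c'" "w = w'" "p = p'"
      using e [of None None] e [of "Some None" None] e [of "Some (Some i)" "Some None" for i]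
        e [of "Some (Some i)" None for i]
      by (simp_all add: vec_eq_iff)
    then show "Xs = Ys"
      by (simp add: X Y)
  qed
qed

lemma h_space_m_space_trivial:
  assumes "X \<in> h_space" "X \<in> m_space"
  shows "X = 0"
proof -
  obtain a S where X: "X = kmat a S"
    using assms(1) unfolding h_space_eq by blast
  have "S = 0" "a + a = 0"
    using assms(2) unfolding m_space_iff X by auto
  then show ?thesis
    by (simp add: X vec_eq_iff all_option)
qed

lemma linear_m_elt: "linear (\<lambda>(x, w, c, p). m_elt x w c p)"
  by (rule linearI) (auto simp: vec_eq_iff all_option algebra_simps scaleR_complex_mult)

lemma subspace_m_space: "subspace m_space"
proof -
  have "m_space = range (\<lambda>(x, w, c, p). m_elt x w c p :: 'a mat2)"
    unfolding m_space_eq by (auto simp: image_iff) blast+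
  then show ?thesis
    using linear_subspace_image [OF linear_m_elt subspace_UNIV] by metis
qed

lemma direct_sum_su1n: "direct_sum_of su1n [h_space :: 'w::finite mat2 set, m_space]"
  unfolding direct_sum_of_def
proof (intro conjI)
  show "\<forall>U\<in>set [h_space :: 'w mat2 set, m_space]. subspace U"
    by (simp add: subspace_h_space subspace_m_space)
  show "su1n = sum_spaces [h_space :: 'w mat2 set, m_space]"
  proof (intro equalityI subsetI)
    fix X :: "'w mat2" assume "X \<in> su1n"
    then obtain h x w c p where "h \<in> h_space" "X = h + m_elt x w c p"
      by (rule su1n_decomposition)
    then show "X \<in> sum_spaces [h_space, m_space]"
      unfolding sum_spaces_2 m_space_eq by blast
  next
    fix X :: "'w mat2" assume "X \<in> sum_spaces [h_space, m_space]"
    then obtain h m where "h \<in> h_space" "m \<in> m_space" "X = h + m"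
      unfolding sum_spaces_2 by blast
    then show "X \<in> su1n"
      using subspace_add [OF subspace_su1n] h_space_subset_su1n m_space_iff by blast
  qed
  show "inj_on sum_list (listset [h_space :: 'w mat2 set, m_space])"
  proof (rule inj_onI)
    fix Xs Ys :: "'w mat2 list"
    assume Xs: "Xs \<in> listset [h_space, m_space]" and Ys: "Ys \<in> listset [h_space, m_space]"
      and eq: "sum_list Xs = sum_list Ys"
    obtain h m where X: "Xs = [h, m]" "h \<in> h_space" "m \<in> m_space"
      using Xs by (auto simp: set_Cons_def)
    obtain h' m' where Y: "Ys = [h', m']" "h' \<in> h_space" "m' \<in> m_space"
      using Ys by (auto simp: set_Cons_def)
    have d: "h - h' = m' - m"
      using eq by (simp add: X Y algebra_simps)
    have "h - h' \<in> h_space"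
      by (intro subspace_diff subspace_h_space X Y)
    moreover have "h - h' \<in> m_space"
      unfolding d by (intro subspace_diff subspace_m_space X Y)
    ultimately have "h - h' = 0"
      by (rule h_space_m_space_trivial)
    then show "Xs = Ys"
      using d by (simp add: X Y)
  qed
qed

section \<open>Invariant metrics as forms on the Lie algebra\<close>

lemma lorentzian_modE:
  assumes "lorentzian_mod S N b"
  obtains e E where "symmetric_bilinear_on S b" "N \<subseteq> S" "\<forall>x\<in>N. \<forall>y\<in>S. b x y = 0"
    "e \<in> S" "E \<subseteq> S" "finite E" "b e e = - 1" "\<forall>f\<in>E. b e f = 0"
    "\<forall>f\<in>E. \<forall>g\<in>E. b f g = (if f = g then 1 else 0)"
    "S = {x + y | x y. x \<in> span (insert e E) \<and> y \<in> N}"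
  using assms unfolding lorentzian_mod_def by (elim conjE exE) (rule that)

lemma lorentzian_mod_transport:
  assumes l: "lorentzian_mod S N b" and f: "linear f" and f': "linear f'" and inv: "\<And>x. f' (f x) = x"
  shows "lorentzian_mod (f ` S) (f ` N) (\<lambda>x y. b (f' x) (f' y))"
proof -
  obtain e E where s: "symmetric_bilinear_on S b" and N: "N \<subseteq> S" "\<forall>x\<in>N. \<forall>y\<in>S. b x y = 0"
    and e: "e \<in> S" "E \<subseteq> S" "finite E" "b e e = - 1" "\<forall>f\<in>E. b e f = 0"
      "\<forall>f\<in>E. \<forall>g\<in>E. b f g = (if f = g then 1 else 0)"
    and S: "S = {x + y | x y. x \<in> span (insert e E) \<and> y \<in> N}"
    using l by (rule lorentzian_modE)
  have inj: "f x = f y \<longleftrightarrow> x = y" for x y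
  proof
    assume "f x = f y"
    then have "f' (f x) = f' (f y)"
      by simp
    then show "x = y"
      by (simp only: inv)
  qed simp
  have add: "f' (x + y) = f' x + f' y" and scale: "f' (c *\<^sub>R x) = c *\<^sub>R f' x" for x y c
    using linear_add [OF f'] linear_scale [OF f'] by auto
  have "symmetric_bilinear_on (f ` S) (\<lambda>x y. b (f' x) (f' y))"
    using s unfolding symmetric_bilinear_on_def by (simp add: inv add scale)
  moreover have "f ` S = {x + y | x y. x \<in> span (insert (f e) (f ` E)) \<and> y \<in> f ` N}"
  proof -
    have "span (insert (f e) (f ` E)) = f ` span (insert e E)"
      using linear_span_image [OF f, of "insert e E"] by simp
    then have "{x + y | x y. x \<in> span (insert (f e) (f ` E)) \<and> y \<in> f ` N} =
        {f x + f y | x y. x \<in> span (insert e E) \<and> y \<in> N}"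
      by auto
    also have "\<dots> = f ` {x + y | x y. x \<in> span (insert e E) \<and> y \<in> N}"
      unfolding linear_add [OF f, symmetric] by blast
    finally show ?thesis
      using S by simp
  qed
  moreover have "f ` N \<subseteq> f ` S" "\<forall>x\<in>f ` N. \<forall>y\<in>f ` S. b (f' x) (f' y) = 0"
    using N by (auto simp: inv)
  moreover have "f e \<in> f ` S" "f ` E \<subseteq> f ` S" "finite (f ` E)"
    using e(1-3) by blast+
  moreover have "\<forall>x\<in>f ` E. b (f' (f e)) (f' x) = 0" "b (f' (f e)) (f' (f e)) = - 1"
    using e(4,5) by (simp_all add: inv)
  moreover have "\<forall>x\<in>f ` E. \<forall>y\<in>f ` E. b (f' x) (f' y) = (if x = y then 1 else 0)"
    using e(6) by (simp add: inv inj)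
  ultimately show ?thesis
    unfolding lorentzian_mod_def by (intro conjI exI [of _ "f e"] exI [of _ "f ` E"])
qed

definition invariant_lorentz_form :: "'n::finite mat1 set \<Rightarrow> ('n mat1 \<Rightarrow> 'n mat1 \<Rightarrow> real) \<Rightarrow> bool"
  where "invariant_lorentz_form H b \<longleftrightarrow> lorentzian_mod su1n (lie_algebra H) b \<and>
    (\<forall>h\<in>H. \<forall>X\<in>su1n. \<forall>Y\<in>su1n. b (conj_by h X) (conj_by h Y) = b X Y)"

lemma linear_matrix_mult_left: "linear (\<lambda>X. g ** X :: complex^'n^'n)"
  by (rule linearI) (simp_all add: matrix_ring_simps)

text \<open>An invariant metric is determined by its value at the base point, an arbitrary \<open>Ad\<^sub>H\<close>-invariant
  Lorentzian form on the quotient of the Lie algebra.\<close>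

lemma admissible_iff:
  fixes H :: "'n::finite mat1 set"
  shows "admissible H \<longleftrightarrow> cc_subgroup H \<and> (\<exists>b. invariant_lorentz_form H b)"
proof (intro iffI conjI)
  assume "admissible H"
  then show H: "cc_subgroup H"
    by (simp add: admissible_def)
  obtain q where q: "\<And>g. g \<in> SU1n \<Longrightarrow> lorentzian_mod (tangent_G g) (vertical H g) (q g)"
    and right: "\<And>g h X Y. g \<in> SU1n \<Longrightarrow> h \<in> H \<Longrightarrow> X \<in> tangent_G g \<Longrightarrow> Y \<in> tangent_G g \<Longrightarrow>
      q (g ** h) (X ** h) (Y ** h) = q g X Y"
    and left: "\<And>a g X Y. a \<in> SU1n \<Longrightarrow> g \<in> SU1n \<Longrightarrow> X \<in> tangent_G g \<Longrightarrow> Y \<in> tangent_G g \<Longrightarrow>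
      q (a ** g) (a ** X) (a ** Y) = q g X Y"
    using \<open>admissible H\<close> unfolding admissible_def invariant_lorentz_metric_def by blast
  have t1: "tangent_G (mat 1) = su1n" "vertical H (mat 1) = lie_algebra H"
    by (simp_all add: tangent_G_def vertical_def)
  have "q (mat 1) (conj_by h X) (conj_by h Y) = q (mat 1) X Y"
    if h: "h \<in> H" and X: "X \<in> su1n" and Y: "Y \<in> su1n" for h X Y
  proof -
    note hS = cc_subgroupD(1) [OF H h]
    have cX: "conj_by h X \<in> su1n" "conj_by h Y \<in> su1n"
      using conj_by_su1n [OF hS] X Y by blast+
    have ch: "conj_by h Z ** h = h ** Z" for Z :: "'n mat1"
      using matrix_inv_left_right(2) [OF SU1n_invertible [OF hS]]
      by (simp add: conj_by_def matrix_mul_assoc [symmetric])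
    have "q (mat 1) (conj_by h X) (conj_by h Y) = q (mat 1 ** h) (conj_by h X ** h) (conj_by h Y ** h)"
      using right [OF SU1n_1 h] cX by (simp add: t1)
    also have "\<dots> = q (h ** mat 1) (h ** X) (h ** Y)"
      by (simp add: ch)
    also have "\<dots> = q (mat 1) X Y"
      using left [OF hS SU1n_1] X Y by (simp add: t1)
    finally show ?thesis .
  qed
  then have "invariant_lorentz_form H (q (mat 1))"
    using q [OF SU1n_1] unfolding invariant_lorentz_form_def t1 by blast
  then show "\<exists>b. invariant_lorentz_form H b"
    by blast
next
  assume "cc_subgroup H \<and> (\<exists>b. invariant_lorentz_form H b)"
  then obtain b where H: "cc_subgroup H" and b: "lorentzian_mod su1n (lie_algebra H) b"
    and inv: "\<And>h X Y. h \<in> H \<Longrightarrow> X \<in> su1n \<Longrightarrow> Y \<in> su1n \<Longrightarrow> b (conj_by h X) (conj_by h Y) = b X Y"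
    unfolding invariant_lorentz_form_def by blast
  define q where "q g X Y = b (matrix_inv g ** X) (matrix_inv g ** Y)" for g X Y :: "'n mat1"
  have cancel: "matrix_inv g ** (g ** X) = X" if "g \<in> SU1n" for g X :: "'n mat1"
    using matrix_inv_left_right(2) [OF SU1n_invertible [OF that]] by (simp add: matrix_mul_assoc)
  have "invariant_lorentz_metric H q"
    unfolding invariant_lorentz_metric_def
  proof (intro conjI ballI)
    fix g :: "'n mat1" assume g: "g \<in> SU1n"
    show "lorentzian_mod (tangent_G g) (vertical H g) (q g)"
      unfolding tangent_G_def vertical_def q_def
      by (rule lorentzian_mod_transport [OF b linear_matrix_mult_left linear_matrix_mult_left])
        (rule cancel [OF g])
  next
    fix g h X Y :: "'n mat1" assume g: "g \<in> SU1n" and h: "h \<in> H" and XY: "X \<in> tangent_G g" "Y \<in> tangent_G g"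
    obtain X' Y' where X: "X = g ** X'" "X' \<in> su1n" and Y: "Y = g ** Y'" "Y' \<in> su1n"
      using XY unfolding tangent_G_def by blast
    note hS = cc_subgroupD(1) [OF H h]
    have "matrix_inv (g ** h) ** (g ** Z ** h) = conj_by (matrix_inv h) Z" for Z :: "'n mat1"
    proof -
      have "matrix_inv (g ** h) ** (g ** Z ** h) = matrix_inv h ** (matrix_inv g ** (g ** (Z ** h)))"
        by (simp add: matrix_inv_mult SU1n_invertible g hS matrix_mul_assoc)
      then have "matrix_inv (g ** h) ** (g ** Z ** h) = matrix_inv h ** (Z ** h)"
        unfolding cancel [OF g] .
      then show ?thesis
        by (simp add: conj_by_def matrix_inv_inv SU1n_invertible hS matrix_mul_assoc)
    qed
    then show "q (g ** h) (X ** h) (Y ** h) = q g X Y"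
      unfolding q_def X Y
      using inv [OF cc_subgroupD(4) [OF H h] X(2) Y(2)] by (simp add: cancel [OF g])
  next
    fix a g X Y :: "'n mat1" assume a: "a \<in> SU1n" and g: "g \<in> SU1n"
    have "matrix_inv (a ** g) ** (a ** Z) = matrix_inv g ** Z" for Z :: "'n mat1"
      using cancel [OF a]
      by (simp add: matrix_inv_mult SU1n_invertible a g matrix_mul_assoc [symmetric])
    then show "q (a ** g) (a ** X) (a ** Y) = q g X Y"
      by (simp add: q_def)
  qed
  with H show "admissible H"
    unfolding admissible_def by blast
qed

lemma cc_subgroup_conj_by:
  assumes H: "cc_subgroup H" and g: "g \<in> SU1n"
  shows "cc_subgroup (conj_by g ` H)"
  unfolding cc_subgroup_def
proof (intro conjI ballI subsetI)
  note gi = SU1n_invertible [OF g]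
  note d = cc_subgroupD [OF H]
  have inv: "matrix_inv (conj_by g h) = conj_by g (matrix_inv h)" if "h \<in> H" for h
  proof (rule matrix_inv_unique)
    have "conj_by g h ** conj_by g (matrix_inv h) = conj_by g (h ** matrix_inv h)"
      by (simp add: conj_by_matrix_mult [OF gi])
    also have "\<dots> = conj_by g (mat 1)"
      by (simp add: matrix_inv_left_right d(5) [OF that])
    also have "\<dots> = mat 1"
      by (simp add: conj_by_def matrix_inv_left_right [OF gi])
    finally show "conj_by g h ** conj_by g (matrix_inv h) = mat 1" .
  qed
  show "X \<in> SU1n" if X: "X \<in> conj_by g ` H" for X
    using that SU1n_mult [OF SU1n_mult [OF g d(1)] SU1n_inv [OF g]]
    unfolding conj_by_def by blast
  show "mat 1 \<in> conj_by g ` H"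
    by (rule image_eqI [OF _ d(2)]) (simp add: conj_by_def matrix_inv_left_right [OF gi])
  show "X ** Y \<in> conj_by g ` H" if XY: "X \<in> conj_by g ` H" "Y \<in> conj_by g ` H" for X Y
  proof -
    obtain h k where "X = conj_by g h" "h \<in> H" "Y = conj_by g k" "k \<in> H"
      using XY by blast
    then show ?thesis
      using d(3) [of h k] by (auto simp: conj_by_matrix_mult [OF gi, symmetric])
  qed
  show "matrix_inv X \<in> conj_by g ` H" if X: "X \<in> conj_by g ` H" for X
  proof -
    obtain h where "X = conj_by g h" "h \<in> H"
      using X by blast
    then show ?thesis
      using inv d(4) by auto
  qed
  have c: "continuous_on H (conj_by g)"
    unfolding conj_by_def by (intro continuous_intros)
  show "compact (conj_by g ` H)"
    using H c by (intro compact_continuous_image) (simp_all add: cc_subgroup_def)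
  show "connected (conj_by g ` H)"
    using H c by (intro connected_continuous_image) (simp_all add: cc_subgroup_def)
qed

lemma conj_by_image_su1n:
  fixes g :: "'n::finite mat1"
  assumes g: "g \<in> SU1n"
  shows "conj_by g ` su1n = su1n"
proof (intro equalityI subsetI)
  fix X :: "'n mat1" assume X: "X \<in> su1n"
  have "X = conj_by g (conj_by (matrix_inv g) X)"
    by (simp add: conj_by_inv_cancel(1) [OF SU1n_invertible [OF g]])
  then show "X \<in> conj_by g ` su1n"
    using conj_by_su1n [OF SU1n_inv [OF g] X] by blast
qed (use conj_by_su1n [OF g] in blast)

lemma admissible_conj_by:
  fixes H :: "'n::finite mat1 set"
  assumes H: "admissible H" and g: "g \<in> SU1n"
  shows "admissible (conj_by g ` H)"
proof -
  note gi = SU1n_invertible [OF g]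
  obtain b where cc: "cc_subgroup H" and b: "lorentzian_mod su1n (lie_algebra H) b"
    and inv: "\<And>h X Y. h \<in> H \<Longrightarrow> X \<in> su1n \<Longrightarrow> Y \<in> su1n \<Longrightarrow> b (conj_by h X) (conj_by h Y) = b X Y"
    using H unfolding admissible_iff invariant_lorentz_form_def by blast
  let ?f = "conj_by (matrix_inv g)"
  let ?b = "\<lambda>X Y :: 'n mat1. b (?f X) (?f Y)"
  have "lorentzian_mod (conj_by g ` su1n) (conj_by g ` lie_algebra H) ?b"
    by (rule lorentzian_mod_transport [OF b linear_conj_by linear_conj_by])
      (rule conj_by_inv_cancel(2) [OF gi])
  then have "lorentzian_mod su1n (lie_algebra (conj_by g ` H)) ?b"
    by (simp add: conj_by_image_su1n [OF g] lie_algebra_conj_by [OF gi])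
  moreover have "?b (conj_by k X) (conj_by k Y) = ?b X Y"
    if k: "k \<in> conj_by g ` H" and X: "X \<in> su1n" and Y: "Y \<in> su1n" for k X Y :: "'n mat1"
  proof -
    obtain h where h: "k = conj_by g h" "h \<in> H"
      using k by blast
    note hi = cc_subgroupD(5) [OF cc h(2)]
    have "?f (conj_by k Z) = conj_by h (?f Z)" for Z :: "'n mat1"
    proof -
      have "k = g ** (h ** matrix_inv g)"
        by (simp add: h(1) conj_by_def matrix_mul_assoc)
      then have "conj_by k Z = conj_by g (conj_by h (?f Z))"
        using gi hi by (simp add: conj_by_mult invertible_mult invertible_matrix_inv)
      then show ?thesis
        by (simp add: conj_by_inv_cancel(2) [OF gi])
    qed
    then show ?thesis
      using inv [OF h(2)] conj_by_su1n [OF SU1n_inv [OF g]] X Y by simp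
  qed
  ultimately have "invariant_lorentz_form (conj_by g ` H) ?b"
    unfolding invariant_lorentz_form_def by blast
  then show ?thesis
    unfolding admissible_iff using cc_subgroup_conj_by [OF cc g] by blast
qed

section \<open>The stabilizer is admissible\<close>

definition lower_column :: "'w option option \<Rightarrow> 'w::finite mat2 \<Rightarrow> complex^'w"
  where "lower_column j X = (\<chi> i. X $ Some (Some i) $ j)"

lemma conj_by_kmat_nth:
  assumes B: "B \<in> unitary_group" and a: "norm a = 1"
  shows "conj_by (kmat a B) X $ None $ None = X $ None $ None"
    "conj_by (kmat a B) X $ None $ Some None = X $ None $ Some None"
    "conj_by (kmat a B) X $ Some None $ None = X $ Some None $ None"
    "conj_by (kmat a B) X $ Some None $ Some None = X $ Some None $ Some None"
    "lower_column None (conj_by (kmat a B) X) = cnj a *s (B *v lower_column None X)"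
    "lower_column (Some None) (conj_by (kmat a B) X) = cnj a *s (B *v lower_column (Some None) X)"
    "W_block (conj_by (kmat a B) X) = B ** W_block X ** cadj B"
proof -
  have aa: "a * (cnj a * z) = z" for z
    using a cnj_mult_self_1 [of a] by (simp add: mult.assoc [symmetric] mult.commute)
  have "conj_by (kmat a B) X = kmat a B ** X ** kmat (cnj a) (cadj B)"
    by (simp add: conj_by_def matrix_inv_kmat [OF B a])
  then show "conj_by (kmat a B) X $ None $ None = X $ None $ None"
    "conj_by (kmat a B) X $ None $ Some None = X $ None $ Some None"
    "conj_by (kmat a B) X $ Some None $ None = X $ Some None $ None"
    "conj_by (kmat a B) X $ Some None $ Some None = X $ Some None $ Some None"
    "lower_column None (conj_by (kmat a B) X) = cnj a *s (B *v lower_column None X)"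
    "lower_column (Some None) (conj_by (kmat a B) X) = cnj a *s (B *v lower_column (Some None) X)"
    "W_block (conj_by (kmat a B) X) = B ** W_block X ** cadj B"
    using aa by (simp_all add: matrix_matrix_mult_def matrix_vector_mult_def sum_option W_block_def
        lower_column_def vec_eq_iff mult_ac)
qed

lemma m_space_invariant:
  assumes k: "k \<in> K_v" and X: "X \<in> m_space"
  shows "conj_by k X \<in> m_space"
proof -
  obtain a B where kk: "k = kmat a B" "B \<in> unitary_group" "norm a = 1"
    using k unfolding K_v_eq by (rule v_stabilizerE)
  have "k \<in> SU1n"
    using k v_stabilizer_subset_SU1n unfolding K_v_eq by blast
  then have "conj_by k X \<in> su1n"
    using X conj_by_su1n m_space_iff by blast
  then show ?thesis
    using X by (simp add: m_space_iff kk(1) conj_by_kmat_nth [OF kk(2,3)])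
qed

text \<open>A form of signature \<open>(-,+,...,+)\<close> on the complement of \<open>h\<close>: minus the square of the coefficient of \<open>z'\<close>,
  plus the norm squares of the components in \<open>\<complex> v\<close>, \<open>p'\<close> and \<open>n'\<close>.\<close>

definition v_form :: "'w::finite mat2 \<Rightarrow> 'w mat2 \<Rightarrow> real"
  where "v_form X Y = inner (X $ Some None $ None) (Y $ Some None $ None)
    + inner (lower_column None X) (lower_column None Y)
    + inner (lower_column (Some None) X) (lower_column (Some None) Y)
    - Im (X $ None $ None - X $ Some None $ Some None) / 2 * (Im (Y $ None $ None - Y $ Some None $ Some None) / 2)"

lemma lower_column_linear:
  "lower_column j (X + Y) = lower_column j X + lower_column j Y"
  "lower_column j (c *\<^sub>R X) = c *\<^sub>R lower_column j X"
  by (simp_all add: lower_column_def vec_eq_iff)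

lemma v_form_bilinear:
  "v_form X Y = v_form Y X" "v_form (X + Y) Z = v_form X Z + v_form Y Z"
  "v_form (c *\<^sub>R X) Z = c * v_form X Z"
  unfolding v_form_def lower_column_linear
  by (simp_all add: inner_commute inner_add_left algebra_simps add_divide_distrib diff_divide_distrib)

lemma lower_column_m_elt [simp]:
  "lower_column None (m_elt x w c p) = p" "lower_column (Some None) (m_elt x w c p) = w"
  by (simp_all add: lower_column_def vec_eq_iff)

lemma v_form_m_elt:
  "v_form (m_elt x w c p) (m_elt y w' c' p') = inner c c' + inner p p' + inner w w' - x * y"
  by (simp add: v_form_def)

lemma inner_unitary:
  assumes B: "B \<in> unitary_group" and a: "norm a = 1"
  shows "inner (cnj a *s (B *v x)) (cnj a *s (B *v y)) = inner x y"
proof -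
  have "hprod (B *v x) (B *v y) = hprod x y"
    by (simp add: hprod_adjoint matrix_vector_mul_assoc unitary_left [OF B])
  moreover have "a * cnj a = 1"
    using a cnj_mult_self_1 [of a] by (simp add: mult.commute)
  ultimately show ?thesis
    by (simp add: inner_eq_hprod hprod_scale)
qed

lemma v_form_invariant: "k \<in> K_v \<Longrightarrow> v_form (conj_by k X) (conj_by k Y) = v_form X Y"
  unfolding K_v_eq
  by (erule v_stabilizerE) (simp only: v_form_def conj_by_kmat_nth inner_unitary)

text \<open>The three positive components are parametrized isometrically by a Euclidean space, whose standard
  basis gives the spacelike part of the orthonormal basis.\<close>

lemma v_form_lorentzian: "lorentzian_mod su1n h_space (v_form :: 'w::finite mat2 \<Rightarrow> _)"
proof -
  define \<Phi> where "\<Phi> = (\<lambda>(w, c, p). m_elt 0 w c p :: 'w mat2)"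
  have lin: "linear \<Phi>"
    unfolding \<Phi>_def by (rule linearI) (auto simp: vec_eq_iff all_option algebra_simps)
  have \<Phi>: "v_form (\<Phi> u) (\<Phi> v) = inner u v" for u v
    by (cases u; cases v) (simp add: \<Phi>_def v_form_m_elt)
  have inj: "\<Phi> u = \<Phi> v \<longleftrightarrow> u = v" for u v
  proof
    assume "\<Phi> u = \<Phi> v"
    then have "\<Phi> (u - v) = 0"
      by (simp add: linear_diff [OF lin])
    then have "inner (u - v) (u - v) = v_form (0 :: 'w mat2) 0"
      using \<Phi> [of "u - v" "u - v"] by simp
    also have "\<dots> = 0"
      using v_form_bilinear(3) [of 0 "0 :: 'w mat2" 0] by simp
    finally show "u = v"
      by simp
  qed simp
  let ?e = "m_elt 1 0 0 0 :: 'w mat2" and ?E = "\<Phi> ` Basis"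
  have e\<Phi>: "v_form ?e (\<Phi> u) = 0" for u
    by (cases u) (simp add: \<Phi>_def v_form_m_elt)
  have ee: "v_form ?e ?e = - 1"
    by (simp add: v_form_m_elt)
  have E: "\<Phi> u \<in> su1n" for u
    by (cases u) (simp add: \<Phi>_def m_elt_su1n)
  have rad: "v_form X Y = 0" if "X \<in> h_space" for X Y
    using that unfolding h_space_eq by (auto simp: v_form_def lower_column_def inner_vec_def)
  have span: "m_elt x w c p \<in> span (insert ?e ?E)" for x w c p
  proof -
    have "\<Phi> (w, c, p) \<in> \<Phi> ` span Basis"
      by simp
    also have "\<dots> = span ?E"
      by (rule linear_span_image [OF lin, symmetric])
    also have "\<dots> \<subseteq> span (insert ?e ?E)"
      by (rule span_mono) blast
    finally have "\<Phi> (w, c, p) \<in> span (insert ?e ?E)" .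
    moreover have "m_elt x w c p = x *\<^sub>R ?e + \<Phi> (w, c, p)"
      by (simp add: \<Phi>_def vec_eq_iff all_option scaleR_complex_mult)
    ultimately show ?thesis
      by (simp add: span_add span_scale span_base)
  qed
  have sp: "span (insert ?e ?E) \<subseteq> su1n"
    using E m_elt_su1n by (intro span_minimal subspace_su1n) auto
  have "su1n = {x + y | x y. x \<in> span (insert ?e ?E) \<and> y \<in> h_space}"
  proof (intro equalityI subsetI)
    fix X :: "'w mat2" assume "X \<in> su1n"
    then obtain h x w c p where "h \<in> h_space" "X = h + m_elt x w c p"
      by (rule su1n_decomposition)
    then have "X = m_elt x w c p + h" "h \<in> h_space"
      by simp_all
    then show "X \<in> {x + y | x y. x \<in> span (insert ?e ?E) \<and> y \<in> h_space}"
      using span [of x w c p] by blast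
  next
    fix X :: "'w mat2" assume "X \<in> {x + y | x y. x \<in> span (insert ?e ?E) \<and> y \<in> h_space}"
    then show "X \<in> su1n"
      using sp h_space_subset_su1n subspace_add [OF subspace_su1n] by blast
  qed
  moreover have "finite ?E" "?E \<subseteq> su1n" "?e \<in> su1n"
    using E m_elt_su1n by auto
  moreover have "\<forall>X\<in>?E. \<forall>Y\<in>?E. v_form X Y = (if X = Y then 1 else 0)"
    by (simp add: \<Phi> inj inner_Basis)
  moreover have "\<forall>X\<in>?E. v_form ?e X = 0" "\<forall>X\<in>h_space. \<forall>Y\<in>su1n. v_form X Y = 0"
    using e\<Phi> rad by blast+
  moreover have "symmetric_bilinear_on su1n v_form"
    unfolding symmetric_bilinear_on_def
    by (intro conjI allI ballI) (rule v_form_bilinear(1), rule v_form_bilinear(2), rule v_form_bilinear(3))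
  ultimately show ?thesis
    unfolding lorentzian_mod_def
    by (intro conjI exI [of _ ?e] exI [of _ ?E] h_space_subset_su1n ee)
qed

lemma admissible_K_v: "admissible K_v"
  unfolding admissible_iff invariant_lorentz_form_def lie_algebra_K_v
  using cc_subgroup_K_v v_form_lorentzian v_form_invariant by blast

section \<open>Groups fixing a vector of p\<close>

text \<open>A complex reflection, after adjusting the phase of \<open>x\<close> so that the reflecting vector makes sense.\<close>

lemma unitary_transitive:
  fixes x y :: "complex^'n"
  assumes "norm x = norm y"
  obtains A c where "A \<in> unitary_group" "norm c = 1" "A *v x = c *s y"
proof -
  \<comment> \<open>This phase makes the product of \<open>x\<close> with \<open>c y\<close> real.\<close>
  define c where "c = (if hprod y x = 0 then 1 else sgn (hprod y x))"
  have c: "norm c = 1"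
    by (simp add: c_def norm_sgn)
  have cc: "cnj c * c = 1"
    using c cnj_mult_self_1 by blast
  define e where "e = c *s y"
  have ee: "hprod e e = hprod x x"
  proof -
    have "hprod e e = cnj c * c * hprod y y"
      by (simp add: e_def hprod_scale)
    then show ?thesis
      using assms by (simp add: cc hprod_self)
  qed
  have real: "cnj (hprod e x) = hprod e x"
  proof -
    have "hprod e x = cnj c * hprod y x"
      using hprod_scale [of c y 1 x] by (simp add: e_def)
    moreover have "cnj (sgn z) * z = of_real (norm z)" for z
      by (cases "z = 0") (simp_all add: sgn_eq complex_norm_square [symmetric] power2_eq_square mult.commute)
    ultimately have "hprod e x = of_real (norm (hprod y x))"
      by (simp add: c_def)
    then show ?thesis
      by (simp only: complex_cnj_complex_of_real)
  qed
  have sym: "hprod x e = hprod e x"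
    using real by (simp add: hprod_def mult.commute)
  define u where "u = x - e"
  show thesis
  proof (cases "u = 0")
    case True
    then show thesis
      using that [OF unitary_1 c] by (simp add: u_def e_def)
  next
    case False
    define r where "r = 2 / (norm u)\<^sup>2"
    define P where "P = (\<chi> i j. u $ i * cnj (u $ j))"
    have Pv: "P *v w = hprod u w *s u" for w
      by (simp add: P_def vec_eq_iff matrix_vector_mult_def hprod_def sum_distrib_left sum_distrib_right
          mult_ac)
    have cP: "cadj P = P"
      by (simp add: P_def vec_eq_iff mult.commute)
    have PP: "P ** P = (norm u)\<^sup>2 *\<^sub>R P"
    proof -
      have "(P ** P) $ i $ j = hprod u u * P $ i $ j" for i j
        by (simp add: P_def matrix_matrix_mult_def hprod_def sum_distrib_left sum_distrib_right mult_ac)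
      then show ?thesis
        by (simp add: vec_eq_iff hprod_self scaleR_complex_mult)
    qed
    define A where "A = mat 1 - r *\<^sub>R P"
    have "cadj A = A"
      by (simp add: A_def cadj_diff cadj_scaleR cP)
    moreover have "A ** A = mat 1 + (r * r * (norm u)\<^sup>2 - 2 * r) *\<^sub>R P"
      by (simp add: A_def matrix_ring_simps PP algebra_simps scaleR_2 [symmetric])
    moreover have "r * r * (norm u)\<^sup>2 - 2 * r = 0"
      using False by (simp add: r_def power2_eq_square)
    ultimately have "A \<in> unitary_group"
      by (simp add: unitary_group_def)
    moreover have "A *v x = e"
    proof -
      have "hprod u u = hprod x x - hprod x e - hprod e x + hprod e e"
        by (simp add: u_def hprod_def sum_subtractf sum.distrib algebra_simps)
      moreover have "hprod u x = hprod x x - hprod e x"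
        by (simp add: u_def hprod_def sum_subtractf algebra_simps)
      ultimately have "hprod u u = 2 * hprod u x"
        by (simp add: ee sym)
      then have "hprod u x = of_real ((norm u)\<^sup>2 / 2)"
        by (simp add: hprod_self)
      moreover have "r * ((norm u)\<^sup>2 / 2) = 1"
        using False by (simp add: r_def)
      ultimately have "of_real r * hprod u x = 1"
        by (metis of_real_1 of_real_mult)
      then have "r *\<^sub>R (hprod u x *s u) = u"
        by (simp add: vec_eq_iff scaleR_complex_mult mult.assoc [symmetric])
      moreover have "A *v x = x - r *\<^sub>R (P *v x)"
        by (simp add: A_def matrix_vector_mult_diff_rdistrib)
          (simp add: vec_eq_iff matrix_vector_mult_def scaleR_sum_right)
      ultimately show ?thesis
        by (simp add: Pv u_def)
    qed
    ultimately show thesis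
      using that c by (simp add: e_def)
  qed
qed

lemma complex_unit_root:
  assumes "norm z = 1" "n > 0"
  obtains c :: complex where "norm c = 1" "c ^ n = z"
proof -
  have z: "z = cis (Arg z)"
  proof -
    have "z \<noteq> 0"
      using assms by auto
    then show ?thesis
      using assms by (simp add: cis_Arg sgn_eq)
  qed
  have "cis (Arg z / n) ^ n = cis (real n * (Arg z / n))"
    by (rule Complex.DeMoivre)
  then have "cis (Arg z / n) ^ n = z"
    using assms(2) z by simp
  then show thesis
    by (intro that [of "cis (Arg z / n)"]) simp_all
qed

text \<open>The isotropy group acts transitively on the spheres of \<open>p\<close>; a scalar factor in \<open>U\<^sub>n\<close> absorbs both
  the determinant and the phase.\<close>

lemma K_group_transitive_on_p:
  fixes x :: "complex^('w::finite option)"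
  assumes "x \<noteq> 0"
  obtains k where "k \<in> K_group" "conj_by k (p_mat x) = norm x *\<^sub>R v_elt"
proof -
  define y :: "complex^('w option)" where "y = norm x *\<^sub>R vcons 1 0"
  have "norm (vcons 1 0 :: complex^('w option)) = 1"
  proof -
    have "complex_of_real ((norm (vcons 1 0 :: complex^('w option)))\<^sup>2) = 1"
      unfolding hprod_self [symmetric] by (simp add: hprod_def sum_option)
    then have "(norm (vcons 1 0 :: complex^('w option)))\<^sup>2 = 1"
      by (simp only: of_real_eq_1_iff)
    then show ?thesis
      using norm_ge_zero [of "vcons 1 0 :: complex^('w option)"] by (simp add: power2_eq_1_iff)
  qed
  then have "norm x = norm y"
    by (simp add: y_def)
  then obtain A c where A: "A \<in> unitary_group" "norm c = 1" "A *v x = c *s y"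
    by (rule unitary_transitive)
  let ?n = "CARD('w option)"
  have "norm (inverse (c * det A)) = 1"
    using A unitary_norm_det [OF A(1)] by (simp add: norm_inverse norm_mult)
  then obtain s where s: "norm s = 1" "s ^ Suc ?n = inverse (c * det A)"
    using complex_unit_root [of _ "Suc ?n"] by blast
  \<comment> \<open>The exponent is \<open>n + 1\<close> because the scalar \<open>s\<close> contributes \<open>s\<^sup>n\<close> to the determinant and \<open>s\<close> to the action.\<close>
  define A' where "A' = mat s ** A"
  have A': "A' \<in> unitary_group"
    unfolding A'_def by (intro unitary_mult unitary_mat s A)
  have nz: "c \<noteq> 0" "det A \<noteq> 0"
    using A(2) unitary_norm_det [OF A(1)] by auto
  have "A' *v x = s *s (c *s y)"
    unfolding A'_def matrix_vector_mul_assoc [symmetric] A(3)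
    by (simp add: vec_eq_iff matrix_vector_mult_def mat_nth if_distrib if_distribR cong: if_cong)
  then have "det A' *s (A' *v x) = (s ^ Suc ?n * (c * det A)) *s y"
    by (simp add: A'_def det_mul det_mat vec_eq_iff)
  moreover have "s ^ Suc ?n * (c * det A) = 1"
    unfolding s(2) using nz by (intro left_inverse) simp
  ultimately have act: "det A' *s (A' *v x) = y"
    by (simp only: vector_smult_lid)
  let ?k = "block_mat (inverse (det A')) 0 0 A'"
  have "?k \<in> K_group"
    unfolding K_group_def using A' by blast
  moreover have "conj_by ?k (p_mat x) = p_mat y"
    using conj_by_block_diag [OF A', of "cnj (det A')" x] unitary_det [OF A']
    by (simp add: det_unitary_inverse [OF A'] act mult.commute)
  moreover have "p_mat y = norm x *\<^sub>R v_elt"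
    by (auto simp: y_def v_elt_def p_mat_def vec_eq_iff all_option)
  ultimately show thesis
    using that by simp
qed

lemma K_group_mult:
  assumes "g \<in> K_group" "h \<in> K_group"
  shows "g ** h \<in> K_group"
proof -
  obtain A B where "A \<in> unitary_group" "g = block_mat (inverse (det A)) 0 0 A"
    "B \<in> unitary_group" "h = block_mat (inverse (det B)) 0 0 B"
    using assms unfolding K_group_def by blast
  then show ?thesis
    unfolding K_group_def
    by (auto simp: block_diag_mult det_mul unitary_mult intro!: exI [of _ "A ** B"])
qed

lemma K_group_inv:
  assumes "g \<in> K_group"
  shows "matrix_inv g \<in> K_group"
proof -
  obtain A where A: "A \<in> unitary_group" "g = block_mat (inverse (det A)) 0 0 A"
    using assms unfolding K_group_def by blast
  have "matrix_inv g = block_mat (det A) 0 0 (cadj A)"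
    using block_diag_unitary_inv [OF A(1), of "cnj (det A)"] unitary_det [OF A(1)]
    by (simp add: A(2) det_unitary_inverse [OF A(1)] mult.commute)
  also have "det A = inverse (det (cadj A))"
    using det_unitary_inverse [OF unitary_cadj [OF A(1)]] by (simp add: det_cadj)
  finally show ?thesis
    unfolding K_group_def using unitary_cadj [OF A(1)] by blast
qed

text \<open>Transitivity moves the fixed vector of \<open>p\<close> to a multiple of \<open>v\<close>.\<close>

lemma class_II_conjugate_into_K_v:
  fixes H :: "'w::finite mat2 set"
  assumes "class_II H"
  obtains g where "g \<in> SU1n" "H \<subseteq> conj_by g ` K_v"
proof -
  obtain x where adm: "admissible H" and HK: "H \<subseteq> K_group"
    and x: "p_mat x \<noteq> 0" "\<And>h. h \<in> H \<Longrightarrow> conj_by h (p_mat x) = p_mat x"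
    using assms unfolding class_II_def p_space_def by blast
  have "x \<noteq> 0"
    using x(1) by (auto simp: p_mat_def vec_eq_iff all_option)
  then obtain k where k: "k \<in> K_group" "conj_by k (p_mat x) = norm x *\<^sub>R v_elt"
    by (rule K_group_transitive_on_p)
  have kS: "k \<in> SU1n"
    using k K_group_subset_SU1n by blast
  note ki = SU1n_invertible [OF kS]
  have H: "cc_subgroup H"
    using adm by (simp add: admissible_def)
  let ?H = "conj_by k ` H"
  have "?H \<subseteq> {k \<in> K_group. conj_by k v_elt = v_elt}"
  proof (rule image_subsetI)
    fix h assume h: "h \<in> H"
    note hi = cc_subgroupD(5) [OF H h]
    have eq: "conj_by k h = k ** (h ** matrix_inv k)"
      by (simp add: conj_by_def matrix_mul_assoc)
    have "conj_by k h \<in> K_group"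
      unfolding eq using h HK k(1) by (intro K_group_mult K_group_inv) auto
    moreover have "conj_by (conj_by k h) (norm x *\<^sub>R v_elt) = norm x *\<^sub>R v_elt"
    proof -
      have "conj_by (conj_by k h) (conj_by k (p_mat x)) =
          conj_by k (conj_by h (conj_by (matrix_inv k) (conj_by k (p_mat x))))"
        unfolding eq using ki hi
        by (simp add: conj_by_mult invertible_mult invertible_matrix_inv)
      also have "\<dots> = conj_by k (p_mat x)"
        by (simp add: conj_by_inv_cancel(2) [OF ki] x(2) [OF h])
      finally show ?thesis
        by (simp only: k(2))
    qed
    then have "conj_by (conj_by k h) v_elt = v_elt"
      using \<open>x \<noteq> 0\<close> by (simp add: conj_by_scaleR)
    ultimately show "conj_by k h \<in> {k \<in> K_group. conj_by k v_elt = v_elt}"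
      by blast
  qed
  then have sub: "conj_by k ` H \<subseteq> K_v"
    by (simp add: v_stabilizer_eq K_v_eq)
  have "H \<subseteq> conj_by (matrix_inv k) ` K_v"
  proof
    fix h assume h: "h \<in> H"
    have "h = conj_by (matrix_inv k) (conj_by k h)"
      by (simp add: conj_by_inv_cancel(2) [OF ki])
    then show "h \<in> conj_by (matrix_inv k) ` K_v"
      using sub h by blast
  qed
  then show thesis
    using that SU1n_inv [OF kS] by blast
qed

text \<open>A strictly smaller isotropy group is not minimal, because the conjugate of \<open>K\<^sub>v\<close> that contains it is
  admissible.\<close>

lemma minimal_class_II_conjugate:
  fixes H :: "'w::finite mat2 set"
  assumes "minimal_admissible H" "class_II H"
  shows "\<exists>g\<in>SU1n. H = conj_by g ` K_v"
proof -
  obtain g where g: "g \<in> SU1n" "H \<subseteq> conj_by g ` K_v"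
    using class_II_conjugate_into_K_v [OF assms(2)] by blast
  have "admissible (conj_by g ` K_v)"
    using admissible_conj_by [OF admissible_K_v g(1)] .
  then have "H = conj_by g ` K_v"
    using assms(1) g(2) unfolding minimal_admissible_def admissible_def by blast
  then show ?thesis
    using g(1) by blast
qed

lemma class_II_K_v: "class_II (K_v :: 'w::finite mat2 set)"
proof -
  have "v_elt \<noteq> (0 :: 'w mat2)"
    by (auto simp: v_elt_def p_mat_def vec_eq_iff all_option)
  moreover have "v_elt \<in> p_space"
    by (simp add: v_elt_def p_space_def)
  moreover have "K_v \<subseteq> K_group" "\<forall>h\<in>K_v. conj_by h v_elt = (v_elt :: 'w mat2)"
    using v_stabilizer_eq unfolding K_v_eq by blast+
  ultimately show ?thesis
    unfolding class_II_def using admissible_K_v by blast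
qed

section \<open>Lorentzian forms\<close>

lemma symmetric_bilinear_onD:
  assumes "symmetric_bilinear_on S b"
  shows "x \<in> S \<Longrightarrow> y \<in> S \<Longrightarrow> b x y = b y x"
    "x \<in> S \<Longrightarrow> y \<in> S \<Longrightarrow> z \<in> S \<Longrightarrow> b (x + y) z = b x z + b y z"
    "x \<in> S \<Longrightarrow> z \<in> S \<Longrightarrow> b (c *\<^sub>R x) z = c * b x z"
  using assms unfolding symmetric_bilinear_on_def by blast+

context
  fixes S :: "'v::real_vector set" and b
  assumes b: "symmetric_bilinear_on S b" and S: "subspace S"
begin

lemma form_add_right: "x \<in> S \<Longrightarrow> y \<in> S \<Longrightarrow> z \<in> S \<Longrightarrow> b z (x + y) = b z x + b z y"
  using symmetric_bilinear_onD(1,2) [OF b] subspace_add [OF S] by simp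

lemma form_scale_right: "x \<in> S \<Longrightarrow> z \<in> S \<Longrightarrow> b z (c *\<^sub>R x) = c * b z x"
  using symmetric_bilinear_onD(1,3) [OF b] subspace_scale [OF S] by simp

lemma form_sum_left:
  assumes "finite A" "A \<subseteq> S" "y \<in> S"
  shows "b (\<Sum>f\<in>A. c f *\<^sub>R f) y = (\<Sum>f\<in>A. c f * b f y)"
  using assms
proof (induction A rule: finite_induct)
  case empty
  have "b (0 *\<^sub>R 0) y = 0 * b 0 y"
    using subspace_0 [OF S] assms(3) by (rule symmetric_bilinear_onD(3) [OF b])
  then show ?case
    by simp
next
  case (insert a A)
  have "(\<Sum>f\<in>A. c f *\<^sub>R f) \<in> S" "c a *\<^sub>R a \<in> S"
    using insert by (auto intro!: subspace_sum subspace_scale S)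
  then show ?case
    using insert by (simp add: symmetric_bilinear_onD(2,3) [OF b])
qed

lemma form_square_combination:
  assumes x: "x \<in> S" and y: "y \<in> S" and xy: "b x y = 0"
  shows "b (s *\<^sub>R x + r *\<^sub>R y) (s *\<^sub>R x + r *\<^sub>R y) = s\<^sup>2 * b x x + r\<^sup>2 * b y y"
proof -
  have yx: "b y x = 0"
    using symmetric_bilinear_onD(1) [OF b x y] xy by simp
  have m: "s *\<^sub>R x \<in> S" "r *\<^sub>R y \<in> S"
    by (intro subspace_scale S x y)+
  have "b (s *\<^sub>R x + r *\<^sub>R y) (s *\<^sub>R x + r *\<^sub>R y) =
      b (s *\<^sub>R x) (s *\<^sub>R x) + b (s *\<^sub>R x) (r *\<^sub>R y) + (b (r *\<^sub>R y) (s *\<^sub>R x) + b (r *\<^sub>R y) (r *\<^sub>R y))"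
    using m by (simp add: symmetric_bilinear_onD(2) [OF b] form_add_right subspace_add [OF S])
  also have "\<dots> = s\<^sup>2 * b x x + r\<^sup>2 * b y y"
    using x y m xy yx
    by (simp add: symmetric_bilinear_onD(3) [OF b] form_scale_right power2_eq_square)
  finally show ?thesis .
qed

end

text \<open>A suitable combination of two vectors of a Lorentzian space lies in the positive hyperplane
  spanned by \<open>E\<close>; for orthogonal timelike vectors its square would be negative.\<close>

lemma lorentzian_timelike_not_orthogonal:
  assumes l: "lorentzian_mod S N b" and S: "subspace S" and x: "x \<in> S" "b x x < 0"
    and y: "y \<in> S" "b y y < 0"
  shows "b x y \<noteq> 0"
proof
  assume xy: "b x y = 0"
  obtain e E where b: "symmetric_bilinear_on S b" and N: "N \<subseteq> S" "\<forall>x\<in>N. \<forall>y\<in>S. b x y = 0"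
    and e: "e \<in> S" "E \<subseteq> S" "finite E" "b e e = - 1" "\<forall>f\<in>E. b e f = 0"
      "\<forall>f\<in>E. \<forall>g\<in>E. b f g = (if f = g then 1 else 0)"
    and Seq: "S = {x + y | x y. x \<in> span (insert e E) \<and> y \<in> N}"
    using l by (rule lorentzian_modE)
  have spE: "span E \<subseteq> S"
    by (rule span_minimal [OF e(2) S])
  have pos: "b (u + n) (u + n) \<ge> 0"
    if u: "u \<in> span E" and nS: "n \<in> S" and n: "\<forall>y\<in>S. b n y = 0" for u n
  proof -
    have uS: "u \<in> S"
      using spE u by auto
    have nz: "b n u = 0" "b n n = 0"
      using n uS nS by auto
    then have un: "b u n = 0"
      using symmetric_bilinear_onD(1) [OF b uS nS] by simp
    have "b (1 *\<^sub>R u + 1 *\<^sub>R n) (1 *\<^sub>R u + 1 *\<^sub>R n) = b u u"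
      using form_square_combination [OF b S uS nS un, of 1 1] nz by simp
    moreover obtain c where c: "u = (\<Sum>f\<in>E. c f *\<^sub>R f)"
      using u unfolding span_finite [OF e(3)] by blast
    have "b u u = (\<Sum>f\<in>E. c f * b f u)"
      using form_sum_left [OF b S e(3,2) uS, of c] unfolding c [symmetric] .
    also have "\<dots> = (\<Sum>f\<in>E. c f * c f)"
    proof (rule sum.cong)
      fix f assume f: "f \<in> E"
      then have fS: "f \<in> S"
        using e(2) by blast
      have "b f u = b u f"
        by (rule symmetric_bilinear_onD(1) [OF b fS uS])
      also have "\<dots> = (\<Sum>g\<in>E. c g * b g f)"
        using form_sum_left [OF b S e(3,2) fS, of c] unfolding c [symmetric] .
      also have "\<dots> = (\<Sum>g\<in>E. if g = f then c f else 0)"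
        using e(6) f by (intro sum.cong) auto
      also have "\<dots> = c f"
        using e(3) f by simp
      finally show "c f * b f u = c f * c f"
        by simp
    qed simp
    also have "\<dots> \<ge> 0"
      by (intro sum_nonneg) simp
    ultimately show ?thesis
      by simp
  qed
  have decomp: "\<exists>r u n. z = r *\<^sub>R e + (u + n) \<and> u \<in> span E \<and> n \<in> N" if z: "z \<in> S" for z
  proof -
    have "z \<in> {x + y | x y. x \<in> span (insert e E) \<and> y \<in> N}"
      using z Seq by (rule subst [where P = "\<lambda>A. z \<in> A", rotated])
    then obtain p n where p: "z = p + n" "p \<in> span (insert e E)" "n \<in> N"
      by blast
    obtain r where r: "p - r *\<^sub>R e \<in> span E"
      using span_breakdown_eq p(2) by blast
    have "z = r *\<^sub>R e + ((p - r *\<^sub>R e) + n)"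
      by (simp add: p(1))
    then show ?thesis
      using r p(3) by blast
  qed
  obtain r u n where X: "x = r *\<^sub>R e + (u + n)" "u \<in> span E" "n \<in> N"
    using decomp [OF x(1)] by blast
  obtain s v k where Y: "y = s *\<^sub>R e + (v + k)" "v \<in> span E" "k \<in> N"
    using decomp [OF y(1)] by blast
  have nk: "n \<in> S" "k \<in> S" "\<forall>y\<in>S. b n y = 0" "\<forall>y\<in>S. b k y = 0"
    using X(3) Y(3) N by blast+
  have rad: "\<forall>y\<in>S. b (s *\<^sub>R n + (- r) *\<^sub>R k) y = 0"
    using nk by (simp add: symmetric_bilinear_onD(2,3) [OF b] subspace_scale [OF S] subspace_neg [OF S]
        del: scaleR_minus_left)
  have nkS: "s *\<^sub>R n + (- r) *\<^sub>R k \<in> S"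
    by (intro subspace_add subspace_scale S nk)
  have uv: "s *\<^sub>R u + (- r) *\<^sub>R v \<in> span E"
    by (intro span_add span_scale X Y)
  have w: "s *\<^sub>R x + (- r) *\<^sub>R y = (s *\<^sub>R u + (- r) *\<^sub>R v) + (s *\<^sub>R n + (- r) *\<^sub>R k)"
    by (simp add: X(1) Y(1) algebra_simps)
  have "s\<^sup>2 * b x x + (- r)\<^sup>2 * b y y \<ge> 0"
    using pos [OF uv nkS rad] unfolding w [symmetric] form_square_combination [OF b S x(1) y(1) xy] .
  moreover have "s\<^sup>2 * b x x \<le> 0" "(- r)\<^sup>2 * b y y \<le> 0"
    using x(2) y(2) by (simp_all add: mult_nonneg_nonpos)
  ultimately have "(- r)\<^sup>2 * b y y = 0"
    by linarith
  then have "r = 0"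
    using y(2) by simp
  then have "x = u + n"
    by (simp add: X(1))
  then have "b x x \<ge> 0"
    using pos [OF X(2) nk(1,3)] by simp
  then show False
    using x(2) by simp
qed

lemma lorentzian_timelike_exists:
  assumes "lorentzian_mod S N b"
  obtains x where "x \<in> S" "b x x < 0"
proof -
  obtain e where "e \<in> S" "b e e = - 1"
    using assms by (rule lorentzian_modE) blast
  then show thesis
    by (intro that [of e]) simp_all
qed

text \<open>Bilinear forms on a subspace extend continuously, by an orthogonal projection onto it.\<close>

lemma subspace_projection:
  fixes S :: "'v::euclidean_space set"
  assumes "subspace S"
  obtains p where "linear p" "\<And>x. p x \<in> S" "\<And>x. x \<in> S \<Longrightarrow> p x = x"
proof -
  obtain B where B: "B \<subseteq> S" "pairwise orthogonal B" "\<And>x. x \<in> B \<Longrightarrow> norm x = 1" "independent B"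
    "card B = dim S" "span B = S"
    using orthonormal_basis_subspace [OF assms] by metis
  define p where "p x = (\<Sum>e\<in>B. inner x e *\<^sub>R e)" for x
  have "linear p"
    unfolding p_def
    by (rule linearI) (simp_all add: inner_add_left scaleR_add_left sum.distrib scaleR_sum_right)
  moreover have "p x \<in> S" for x
    unfolding p_def B(6) [symmetric] by (intro span_sum span_scale span_base)
  moreover have "p x = x" if "x \<in> S" for x
    unfolding p_def
    by (rule orthonormal_basis_expand [OF B(2,3)])
      (use that B(4,6) independent_imp_finite in auto)
  ultimately show thesis
    by (rule that)
qed

lemma bracket_su1n:
  assumes "X \<in> su1n" "Y \<in> su1n"
  shows "bracket X Y \<in> su1n"
proof -
  have X: "form_J ** cadj X ** form_J = - X" and Y: "form_J ** cadj Y ** form_J = - Y"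
    using assms by (simp_all add: su1n_iff)
  have J: "form_J ** cadj (A ** B) ** form_J =
      (form_J ** cadj B ** form_J) ** (form_J ** cadj A ** form_J)" for A B :: "'a mat1"
  proof -
    have "(form_J ** cadj B ** form_J) ** (form_J ** cadj A ** form_J) =
        form_J ** cadj B ** (form_J ** form_J) ** cadj A ** form_J"
      by (simp only: matrix_mul_assoc)
    then show ?thesis
      by (simp add: form_J_square cadj_mult matrix_mul_assoc)
  qed
  have "form_J ** cadj (bracket X Y) ** form_J = (- Y) ** (- X) - (- X) ** (- Y)"
    unfolding bracket_def cadj_diff matrix_diff_ldistrib matrix_diff_rdistrib J X Y ..
  also have "\<dots> = - bracket X Y"
    by (simp add: bracket_def matrix_ring_simps)
  finally show ?thesis
    by (simp add: su1n_iff bracket_def trace_sub trace_mul_sym [of X Y])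
qed

text \<open>The derivative of the invariance along a curve of the group.\<close>

lemma invariant_form_bracket:
  fixes H :: "'n::finite mat1 set"
  assumes H: "cc_subgroup H" and b: "symmetric_bilinear_on su1n b"
    and inv: "\<And>h X Y. h \<in> H \<Longrightarrow> X \<in> su1n \<Longrightarrow> Y \<in> su1n \<Longrightarrow> b (conj_by h X) (conj_by h Y) = b X Y"
    and y: "y \<in> lie_algebra H" and u: "u \<in> su1n" and v: "v \<in> su1n"
  shows "b (bracket y u) v + b u (bracket y v) = 0"
proof -
  obtain p :: "'n mat1 \<Rightarrow> 'n mat1" where p: "linear p" "\<And>x. p x \<in> su1n" "\<And>x. x \<in> su1n \<Longrightarrow> p x = x"
    using subspace_projection [OF subspace_su1n] by metis
  define B where "B X Y = b (p X) (p Y)" for X Y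
  note D = symmetric_bilinear_onD [OF b]
  have comm: "B X Y = B Y X" for X Y
    unfolding B_def by (rule D(1) [OF p(2) p(2)])
  have add: "B (X + Y) Z = B X Z + B Y Z" for X Y Z
    unfolding B_def linear_add [OF p(1)] by (rule D(2) [OF p(2) p(2) p(2)])
  have scale: "B (c *\<^sub>R X) Z = c * B X Z" for c X Z
    unfolding B_def linear_scale [OF p(1)] by (rule D(3) [OF p(2) p(2)])
  have "bilinear B"
    unfolding bilinear_def
  proof (intro conjI allI linearI)
    show "B x (y + z) = B x y + B x z" for x y z
      unfolding comm [of x] by (rule add)
    show "B x (c *\<^sub>R y) = c *\<^sub>R B x y" for c x y
      unfolding comm [of x] by (simp add: scale)
  qed (simp_all add: add scale)
  then have bB: "bounded_bilinear B"
    by (simp add: bilinear_conv_bounded_bilinear)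
  obtain \<gamma> where \<gamma>: "\<And>t. \<gamma> t \<in> H" "\<gamma> 0 = mat 1" "(\<gamma> has_vector_derivative y) (at 0)"
    using y by (rule lie_algebraE) blast
  have SU: "\<gamma> t \<in> SU1n" for t
    by (rule cc_subgroupD(1) [OF H \<gamma>(1)])
  note d = has_vector_derivative_conj_by [OF SU \<gamma>(2,3)]
  have "((\<lambda>t. B (conj_by (\<gamma> t) u) (conj_by (\<gamma> t) v)) has_vector_derivative
      B (conj_by (\<gamma> 0) u) (bracket y v) + B (bracket y u) (conj_by (\<gamma> 0) v)) (at 0)"
    by (rule bounded_bilinear.has_vector_derivative [OF bB d d])
  moreover have "(\<lambda>t. B (conj_by (\<gamma> t) u) (conj_by (\<gamma> t) v)) = (\<lambda>t. b u v)"
    by (simp add: B_def p(3) conj_by_su1n [OF SU] u v inv [OF \<gamma>(1)])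
  ultimately have "((\<lambda>t :: real. b u v) has_vector_derivative
      B u (bracket y v) + B (bracket y u) v) (at 0)"
    by (simp add: \<gamma>(2))
  then have "B u (bracket y v) + B (bracket y u) v = 0"
    by (metis has_vector_derivative_const vector_derivative_at)
  moreover have "y \<in> su1n"
    using y lie_algebra_su1n cc_subgroupD(1) [OF H] by blast
  ultimately show ?thesis
    by (simp add: B_def p(3) u v bracket_su1n)
qed

section \<open>The complement as a representation of the stabilizer\<close>

text \<open>An element of the stabilizer that acts trivially on \<open>\<real> z' + \<complex> v\<close> and as multiplication by \<open>\<i>\<close> on
  \<open>n' + p'\<close>. It is a discrete substitute for the one-parameter group generated by \<open>z\<close>.\<close>

definition quarter_turn :: "'w::finite mat2 \<Rightarrow> bool"
  where "quarter_turn s \<longleftrightarrow> (\<exists>a. norm a = 1 \<and> s = kmat a (mat (\<i> * a)) \<and> s \<in> v_stabilizer)"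

lemma quarter_turn_exists: "\<exists>s :: 'w::finite mat2. quarter_turn s"
proof -
  let ?m = "CARD('w)"
  have "norm (inverse (\<i> ^ ?m)) = 1"
    by (simp add: norm_inverse norm_power)
  then obtain a where a: "norm a = 1" "a ^ (?m + 2) = inverse (\<i> ^ ?m)"
    using complex_unit_root [of _ "?m + 2"] by (metis add_gr_0 zero_less_numeral)
  have "a\<^sup>2 * (\<i> * a) ^ ?m = a ^ (?m + 2) * \<i> ^ ?m"
    by (simp add: power_mult_distrib power_add power2_eq_square)
  also have "\<dots> = 1"
    unfolding a(2) by (rule left_inverse) simp
  finally have "kmat a (mat (\<i> * a) :: complex^'w^'w) \<in> v_stabilizer"
    using a(1) by (simp add: v_stabilizer_iff det_mat unitary_mat norm_mult)
  then show ?thesis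
    unfolding quarter_turn_def using a(1) by blast
qed

lemma m_elt_eqI:
  assumes "X \<in> m_space" "X $ None $ None = of_real x * \<i>" "X $ Some None $ None = c"
    "lower_column None X = p" "lower_column (Some None) X = w"
  shows "X = m_elt x w c p"
proof -
  obtain x' w' c' p' where X: "X = m_elt x' w' c' p'"
    using assms(1) unfolding m_space_eq by blast
  show ?thesis
    using assms(2-5) unfolding X by simp
qed

lemma mat_mult_vec: "mat c *v y = c *s y" for c :: complex
  by (simp add: vec_eq_iff matrix_vector_mult_def mat_nth if_distrib if_distribR cong: if_cong)

lemma m_elt_m_space: "m_elt x w c p \<in> m_space"
  unfolding m_space_eq by blast

lemma quarter_turn_m:
  assumes "quarter_turn s"
  shows "conj_by s (m_elt x w c p) = m_elt x (\<i> *s w) c (\<i> *s p)"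
proof -
  obtain a where a: "norm a = 1" "s = kmat a (mat (\<i> * a))" "s \<in> v_stabilizer"
    using assms unfolding quarter_turn_def by blast
  have u: "cnj a * a = 1"
    using a(1) cnj_mult_self_1 by blast
  have ia: "norm (\<i> * a) = 1"
    using a(1) by (simp add: norm_mult)
  have col: "cnj a *s (mat (\<i> * a) *v y) = \<i> *s y" for y :: "complex^'a"
    using u by (simp add: mat_mult_vec vec_eq_iff)
  note nth = conj_by_kmat_nth [OF unitary_mat [OF ia] a(1)]
  have "conj_by s (m_elt x w c p) \<in> m_space"
    using m_space_invariant m_elt_m_space a(3) unfolding K_v_eq by blast
  then show ?thesis
    by (rule m_elt_eqI) (simp_all add: a(2) nth col)
qed

lemma m_elt_add: "m_elt x w c p + m_elt x' w' c' p' = m_elt (x + x') (w + w') (c + c') (p + p')"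
  by (simp add: vec_eq_iff all_option algebra_simps)

lemma m_elt_scaleR: "r *\<^sub>R m_elt x w c p = m_elt (r * x) (r *\<^sub>R w) (r *\<^sub>R c) (r *\<^sub>R p)"
  by (simp add: vec_eq_iff all_option scaleR_complex_mult)

lemma m_elt_0: "m_elt 0 0 0 0 = 0"
  by (simp add: vec_eq_iff all_option)

text \<open>The subspace \<open>\<real> z' + \<complex> v\<close> is the copy of \<open>su(1,1)\<close> acting on the plane of \<open>e\<^sub>0\<close> and \<open>e\<^sub>1\<close>.\<close>

lemma su11_bracket:
  "bracket (m_elt x 0 c 0) (m_elt y 0 d 0) =
    m_elt (2 * Im (cnj c * d)) 0 (- 2 * \<i> * (of_real x * d - of_real y * c)) 0"
  unfolding bracket_def
  by (simp add: vec_eq_iff all_option matrix_matrix_mult_def sum_option complex_eq_iff algebra_simps)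

lemma su11_double_bracket:
  "bracket (m_elt x 0 c 0) (bracket (m_elt x 0 c 0) (m_elt y 0 d 0)) =
    (4 * ((norm c)\<^sup>2 - x\<^sup>2)) *\<^sub>R m_elt y 0 d 0 +
    (- 4 * (Re (cnj c * d) - x * y)) *\<^sub>R m_elt x 0 c 0"
proof -
  have eq: "m_elt x 0 c 0 = m_elt x' w c' p" if "x = x'" "c = c'" "w = 0" "p = 0" for x x' c c' w p
    using that by simp
  show ?thesis
    unfolding su11_bracket m_elt_scaleR m_elt_add cmod_power2
    by (rule eq) (simp_all add: complex_eq_iff algebra_simps power2_eq_square)
qed

text \<open>For \<open>\<xi>\<close> in \<open>n' + p'\<close> the bracket with its rotation by \<open>\<i>\<close> lies in the block diagonal part; the
  difference of its first two diagonal entries is a positive multiple of \<open>\<i>\<close> unless \<open>\<xi> = 0\<close>.\<close>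

lemma bracket_rotated:
  "bracket (m_elt 0 w 0 p) (m_elt 0 (\<i> *s w) 0 (\<i> *s p)) $ None $ None -
   bracket (m_elt 0 w 0 p) (m_elt 0 (\<i> *s w) 0 (\<i> *s p)) $ Some None $ Some None =
   of_real (2 * ((norm p)\<^sup>2 + (norm w)\<^sup>2)) * \<i>"
proof -
  have n: "(\<Sum>i\<in>UNIV. x $ i * cnj (x $ i)) = of_real ((norm x)\<^sup>2)" for x :: "complex^'a"
    unfolding hprod_self [symmetric] by (simp add: hprod_def mult.commute)
  have a: "(\<Sum>i\<in>UNIV. cnj (x $ i) * (\<i> * x $ i)) = \<i> * of_real ((norm x)\<^sup>2)"
    "(\<Sum>i\<in>UNIV. cnj (\<i> * x $ i) * x $ i) = - \<i> * of_real ((norm x)\<^sup>2)" for x :: "complex^'a"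
    unfolding n [symmetric] by (simp_all add: sum_distrib_left mult_ac)
  have "bracket (m_elt 0 w 0 p) (m_elt 0 (\<i> *s w) 0 (\<i> *s p)) $ None $ None =
      (\<Sum>i\<in>UNIV. cnj (p $ i) * (\<i> * p $ i)) - (\<Sum>i\<in>UNIV. cnj (\<i> * p $ i) * p $ i)"
    unfolding bracket_def by (simp add: matrix_matrix_mult_def sum_option)
  moreover have "bracket (m_elt 0 w 0 p) (m_elt 0 (\<i> *s w) 0 (\<i> *s p)) $ Some None $ Some None =
      - (\<Sum>i\<in>UNIV. cnj (w $ i) * (\<i> * w $ i)) + (\<Sum>i\<in>UNIV. cnj (\<i> * w $ i) * w $ i)"
    unfolding bracket_def by (simp add: matrix_matrix_mult_def sum_option sum_negf)
  ultimately show ?thesis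
    unfolding a by (simp add: algebra_simps)
qed

lemma lie_algebra_mono: "H \<subseteq> H' \<Longrightarrow> lie_algebra H \<subseteq> lie_algebra H'"
  unfolding lie_algebra_def by blast

section \<open>Overgroups of the stabilizer\<close>

context
  fixes H :: "'w::finite mat2 set"
  assumes H: "cc_subgroup H" and K: "K_v \<subseteq> H"
begin

lemma lie_su1n: "X \<in> lie_algebra H \<Longrightarrow> X \<in> su1n"
  using lie_algebra_su1n cc_subgroupD(1) [OF H] by blast

lemma h_space_lie: "X \<in> h_space \<Longrightarrow> X \<in> lie_algebra H"
  using lie_algebra_mono [OF K] unfolding lie_algebra_K_v by blast

lemma quarter_turn_in: "quarter_turn s \<Longrightarrow> s \<in> H"
  using K unfolding quarter_turn_def K_v_eq by blast

text \<open>The quarter turn splits the Lie algebra of the overgroup into its eigenspaces.\<close>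

lemma lie_algebra_splits:
  assumes X: "h + m_elt x w c p \<in> lie_algebra H" and h: "h \<in> h_space"
  shows "m_elt x 0 c 0 \<in> lie_algebra H" "m_elt 0 w 0 p \<in> lie_algebra H"
proof -
  obtain s :: "'w mat2" where s: "quarter_turn s"
    using quarter_turn_exists by blast
  note sub = subspace_lie_algebra [OF H]
  have m: "m_elt x w c p \<in> lie_algebra H"
    using subspace_diff [OF sub X h_space_lie [OF h]] by simp
  have "conj_by s (conj_by s (m_elt x w c p)) \<in> lie_algebra H"
    by (intro lie_algebra_Ad [OF H] quarter_turn_in s m)
  then have n: "m_elt x (- w) c (- p) \<in> lie_algebra H"
    by (simp add: quarter_turn_m [OF s] vector_smult_lneg)
  have "(1 / 2) *\<^sub>R (m_elt x w c p + m_elt x (- w) c (- p)) \<in> lie_algebra H"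
    by (intro subspace_scale subspace_add sub m n)
  then show 1: "m_elt x 0 c 0 \<in> lie_algebra H"
    by (simp add: m_elt_add m_elt_scaleR scaleR_2 [symmetric])
  have "m_elt x w c p - m_elt x 0 c 0 \<in> lie_algebra H"
    by (rule subspace_diff [OF sub m 1])
  moreover have "m_elt x w c p - m_elt x 0 c 0 = m_elt 0 w 0 p"
    by (simp add: vec_eq_iff all_option)
  ultimately show "m_elt 0 w 0 p \<in> lie_algebra H"
    by simp
qed

text \<open>On the plane of \<open>e\<^sub>0\<close> and \<open>e\<^sub>1\<close> the element \<open>y\<close> satisfies \<open>y\<^sup>2 = \<delta>\<close>, hence \<open>(1 - s y) (1 + s y) = 1 - s\<^sup>2 \<delta>\<close>, and neither
  factor shrinks the invariant norm. If \<open>\<delta> > 0\<close>, some \<open>s\<close> makes the product vanish; if \<open>\<delta> = 0\<close>, the line of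
  all \<open>e\<^sub>0 + s y e\<^sub>0\<close> is bounded, so it is a point.\<close>

lemma su11_compact_elliptic:
  assumes y: "m_elt x 0 c 0 \<in> lie_algebra H" and \<delta>: "(norm c)\<^sup>2 - x\<^sup>2 \<ge> 0"
  shows "x = 0 \<and> c = 0"
proof -
  define \<delta> where "\<delta> = (norm c)\<^sup>2 - x\<^sup>2"
  let ?Y = "m_elt x 0 c 0 :: 'w mat2" and ?N = "orbit_norm H"
  define e :: "complex^('w option option)" where "e = axis None 1"
  have Ye: "?Y *v (?Y *v e) = \<delta> *\<^sub>R e"
  proof -
    have "of_real x * \<i> * (of_real x * \<i>) + cnj c * c = of_real \<delta>"
      unfolding \<delta>_def cmod_power2 by (simp add: complex_eq_iff power2_eq_square)
    then show ?thesis
      by (simp add: vec_eq_iff all_option matrix_vector_mult_def sum_option e_def axis_def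
          scaleR_complex_mult algebra_simps)
  qed
  have shrink: "?N (e + s *\<^sub>R (?Y *v e)) \<le> ?N ((1 - s\<^sup>2 * \<delta>) *\<^sub>R e)" for s
  proof -
    have "?N (e + s *\<^sub>R (?Y *v e)) \<le> ?N ((e + s *\<^sub>R (?Y *v e)) + (- s) *\<^sub>R (?Y *v (e + s *\<^sub>R (?Y *v e))))"
      by (rule orbit_norm_expanding [OF H y])
    moreover have "?Y *v (s *\<^sub>R f) = s *\<^sub>R (?Y *v f)" for f
      by (simp add: vec_eq_iff matrix_vector_mult_def scaleR_sum_right)
    then have "?Y *v (e + s *\<^sub>R (?Y *v e)) = ?Y *v e + (s * \<delta>) *\<^sub>R e"
      by (simp add: matrix_vector_right_distrib Ye)
    ultimately show ?thesis
      by (simp add: algebra_simps power2_eq_square)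
  qed
  have e0: "e \<noteq> 0"
    by (simp add: e_def axis_eq_0_iff)
  have "\<not> \<delta> > 0"
  proof
    assume "\<delta> > 0"
    then have "1 - (1 / sqrt \<delta>)\<^sup>2 * \<delta> = 0"
      by (simp add: power_divide)
    then have "?N (e + (1 / sqrt \<delta>) *\<^sub>R (?Y *v e)) \<le> ?N (0 *\<^sub>R e)"
      using shrink [of "1 / sqrt \<delta>"] by simp
    also have "\<dots> \<le> \<bar>0\<bar> * ?N e"
      by (rule orbit_norm_scaleR [OF H])
    finally have "?N (e + (1 / sqrt \<delta>) *\<^sub>R (?Y *v e)) \<le> 0"
      by simp
    then have "?N e \<le> 0"
      using orbit_norm_expanding [OF H y, of e "1 / sqrt \<delta>"] by linarith
    then show False
      using orbit_norm_pos [OF H e0] by simp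
  qed
  then have \<delta>0: "\<delta> = 0"
    using \<delta> by (simp add: \<delta>_def)
  have "?Y *v e = 0"
  proof (rule ccontr)
    assume ne: "?Y *v e \<noteq> 0"
    let ?f = "?Y *v e"
    have bound: "s * ?N ?f \<le> 2 * ?N e" if s: "s > 0" for s
    proof -
      have "?N ?f = ?N ((1 / s) *\<^sub>R (s *\<^sub>R ?f))"
        using s by simp
      also have "\<dots> \<le> \<bar>1 / s\<bar> * ?N (s *\<^sub>R ?f)"
        by (rule orbit_norm_scaleR [OF H])
      finally have 1: "s * ?N ?f \<le> ?N (s *\<^sub>R ?f)"
        using s by (simp add: field_simps)
      have "?N (s *\<^sub>R ?f) = ?N ((e + s *\<^sub>R ?f) + (- 1) *\<^sub>R e)"
        by simp
      also have "\<dots> \<le> ?N (e + s *\<^sub>R ?f) + ?N ((- 1) *\<^sub>R e)"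
        by (rule orbit_norm_triangle [OF H])
      also have "\<dots> \<le> ?N e + ?N e"
        using shrink [of s] orbit_norm_scaleR [OF H, of "- 1" e] \<delta>0 by (intro add_mono) simp_all
      finally show ?thesis
        using 1 by simp
    qed
    have pos: "?N ?f > 0"
      by (rule orbit_norm_pos [OF H ne])
    have "?N e > 0"
      by (rule orbit_norm_pos [OF H e0])
    then have "3 * ?N e / ?N ?f > 0"
      using pos by simp
    from bound [OF this] show False
      using pos \<open>?N e > 0\<close> by simp
  qed
  then have "(?Y *v e) $ None = 0" "(?Y *v e) $ Some None = 0"
    by simp_all
  then show ?thesis
    by (simp add: e_def matrix_vector_mult_def sum_option axis_def)
qed

context
  fixes b :: "'w mat2 \<Rightarrow> 'w mat2 \<Rightarrow> real"
  assumes b: "invariant_lorentz_form H b"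
begin

lemma b_lorentzian: "lorentzian_mod su1n (lie_algebra H) b"
  using b by (simp add: invariant_lorentz_form_def)

lemma b_bilinear: "symmetric_bilinear_on su1n b"
  using b_lorentzian by (simp add: lorentzian_mod_def)

lemma b_invariant: "h \<in> H \<Longrightarrow> X \<in> su1n \<Longrightarrow> Y \<in> su1n \<Longrightarrow> b (conj_by h X) (conj_by h Y) = b X Y"
  using b by (simp add: invariant_lorentz_form_def)

lemma b_radical: "X \<in> lie_algebra H \<Longrightarrow> Y \<in> su1n \<Longrightarrow> b X Y = 0"
  using b_lorentzian by (simp add: lorentzian_mod_def)

lemmas b_sym = symmetric_bilinear_onD(1) [OF b_bilinear]
  and b_add_right = form_add_right [OF b_bilinear subspace_su1n]
  and b_scale_right = form_scale_right [OF b_bilinear subspace_su1n]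
  and b_combination = form_square_combination [OF b_bilinear subspace_su1n]

lemma b_neg_right: "X \<in> su1n \<Longrightarrow> Z \<in> su1n \<Longrightarrow> b Z (- X) = - b Z X"
  using b_scale_right [of X Z "- 1"] by simp

lemma b_timelike: "X \<in> su1n \<Longrightarrow> b X X < 0 \<Longrightarrow> Y \<in> su1n \<Longrightarrow> b Y Y < 0 \<Longrightarrow> b X Y \<noteq> 0"
  using lorentzian_timelike_not_orthogonal [OF b_lorentzian subspace_su1n] by blast

lemma b_infinitesimal:
  "Y \<in> lie_algebra H \<Longrightarrow> U \<in> su1n \<Longrightarrow> V \<in> su1n \<Longrightarrow> b (bracket Y U) V + b U (bracket Y V) = 0"
  using invariant_form_bracket [OF H b_bilinear b_invariant] by blast

text \<open>On \<open>n' + p'\<close> the form is invariant under multiplication by \<open>\<i>\<close>, hence its negative index is even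
  and must be \<open>0\<close>. So there is a timelike vector in \<open>\<real> z' + \<complex> v\<close>.\<close>

lemma timelike_in_su11: "\<exists>x c. b (m_elt x 0 c 0) (m_elt x 0 c 0) < 0"
proof -
  obtain s :: "'w mat2" where s: "quarter_turn s"
    using quarter_turn_exists by blast
  note sH = quarter_turn_in [OF s]
  have rot: "b (m_elt x w c p) (m_elt y u d q) =
      b (m_elt x (\<i> *s w) c (\<i> *s p)) (m_elt y (\<i> *s u) d (\<i> *s q))" for x w c p y u d q
    using b_invariant [OF sH m_elt_su1n m_elt_su1n] unfolding quarter_turn_m [OF s] by simp
  have neg: "m_elt 0 (- w) 0 (- p) = - m_elt 0 w 0 p" for w p
    by (simp add: vec_eq_iff all_option)
  have ii: "\<i> *s (\<i> *s w) = - w" for w :: "complex^'w"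
    by (simp add: vec_eq_iff)
  obtain X where X: "X \<in> su1n" "b X X < 0"
    by (rule lorentzian_timelike_exists [OF b_lorentzian])
  obtain h x w c p where h: "h \<in> h_space" "X = h + m_elt x w c p"
    using X(1) by (rule su1n_decomposition)
  let ?f = "m_elt x 0 c 0" and ?q = "m_elt 0 w 0 p" and ?q' = "m_elt 0 (\<i> *s w) 0 (\<i> *s p)"
  have fq: "b ?f ?q = 0"
  proof -
    have "b ?f ?q = b ?f (m_elt 0 (- w) 0 (- p))"
      using rot [of x 0 c 0 0 w 0 p] rot [of x 0 c 0 0 "\<i> *s w" 0 "\<i> *s p"] by (simp add: ii)
    also have "\<dots> = - b ?f ?q"
      unfolding neg by (rule b_neg_right [OF m_elt_su1n m_elt_su1n])
    finally show ?thesis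
      by simp
  qed
  have qq': "b ?q ?q' = 0"
  proof -
    have "b ?q ?q' = b ?q' (m_elt 0 (- w) 0 (- p))"
      using rot [of 0 w 0 p 0 "\<i> *s w" 0 "\<i> *s p"] by (simp add: ii)
    also have "\<dots> = - b ?q' ?q"
      unfolding neg by (rule b_neg_right [OF m_elt_su1n m_elt_su1n])
    also have "b ?q' ?q = b ?q ?q'"
      by (rule b_sym) (rule m_elt_su1n)+
    finally show ?thesis
      by simp
  qed
  have q0: "b ?q ?q \<ge> 0"
  proof (rule ccontr)
    assume "\<not> b ?q ?q \<ge> 0"
    then have "b ?q ?q < 0" "b ?q' ?q' < 0"
      using rot [of 0 w 0 p 0 w 0 p] by simp_all
    then show False
      using b_timelike [OF m_elt_su1n _ m_elt_su1n] qq' by blast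
  qed
  have hS: "h \<in> su1n" "h \<in> lie_algebra H"
    using h(1) h_space_subset_su1n h_space_lie by blast+
  have m: "m_elt x w c p = 1 *\<^sub>R ?f + 1 *\<^sub>R ?q"
    by (simp add: m_elt_add)
  have "b X X = b (m_elt x w c p) (m_elt x w c p)"
  proof -
    have "b (1 *\<^sub>R h + 1 *\<^sub>R m_elt x w c p) (1 *\<^sub>R h + 1 *\<^sub>R m_elt x w c p) =
        1\<^sup>2 * b h h + 1\<^sup>2 * b (m_elt x w c p) (m_elt x w c p)"
      by (rule b_combination [OF hS(1) m_elt_su1n b_radical [OF hS(2) m_elt_su1n]])
    then show ?thesis
      using b_radical [OF hS(2,1)] by (simp add: h(2))
  qed
  also have "\<dots> = 1\<^sup>2 * b ?f ?f + 1\<^sup>2 * b ?q ?q"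
    unfolding m by (rule b_combination [OF m_elt_su1n m_elt_su1n fq])
  finally have "b ?f ?f < 0"
    using X(2) q0 by simp
  then show ?thesis
    by blast
qed

text \<open>An elliptic element \<open>y\<close> would rotate the timelike vector \<open>a\<close> to a vector \<open>[y, a]\<close> that is orthogonal
  to it and, since \<open>[y, [y, a]]\<close> is a negative multiple of \<open>a\<close> modulo \<open>y\<close>, again timelike.\<close>

lemma lie_algebra_su11_trivial:
  assumes y: "m_elt x 0 c 0 \<in> lie_algebra H"
  shows "x = 0 \<and> c = 0"
proof (cases "(norm c)\<^sup>2 - x\<^sup>2 \<ge> 0")
  case True
  with y show ?thesis
    by (rule su11_compact_elliptic)
next
  case False
  define \<delta> where "\<delta> = (norm c)\<^sup>2 - x\<^sup>2"
  let ?y = "m_elt x 0 c 0 :: 'w mat2"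
  obtain t d where a: "b (m_elt t 0 d 0) (m_elt t 0 d 0) < 0"
    using timelike_in_su11 by blast
  define A :: "'w mat2" where "A = m_elt t 0 d 0"
  define C where "C = bracket ?y A"
  have AS: "A \<in> su1n" and yS: "?y \<in> su1n"
    by (simp_all add: A_def m_elt_su1n)
  have CS: "C \<in> su1n"
    unfolding C_def by (rule bracket_su1n [OF yS AS])
  have AC: "b A C = 0"
    using b_infinitesimal [OF y AS AS] b_sym [OF AS CS] by (simp add: C_def)
  obtain r where D: "bracket ?y C = (4 * \<delta>) *\<^sub>R A + r *\<^sub>R ?y"
    unfolding C_def A_def su11_double_bracket \<delta>_def by blast
  have "b A ?y = 0"
    using b_radical [OF y AS] b_sym [OF AS yS] by simp
  then have "b A (bracket ?y C) = 4 * \<delta> * b A A"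
    unfolding D
    by (simp add: b_add_right [OF subspace_scale [OF subspace_su1n AS] subspace_scale [OF subspace_su1n yS] AS]
        b_scale_right [OF AS AS] b_scale_right [OF yS AS])
  moreover have "b C C + b A (bracket ?y C) = 0"
    using b_infinitesimal [OF y AS CS] by (simp add: C_def)
  ultimately have "b C C = - (4 * \<delta> * b A A)"
    by simp
  moreover have "\<delta> < 0" "b A A < 0"
    using False a by (simp_all add: \<delta>_def A_def)
  then have "\<delta> * b A A > 0"
    by (rule mult_neg_neg)
  ultimately have "b C C < 0"
    by simp
  then show ?thesis
    using b_timelike [OF AS _ CS] AC \<open>b A A < 0\<close> by blast
qed

text \<open>The components along \<open>\<real> z' + \<complex> v\<close> vanish by the previous lemma. For a component \<open>\<xi>\<close> in \<open>n' + p'\<close> the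
  bracket \<open>[\<xi>, \<i> \<xi>]\<close> is again in the Lie algebra, so its first two diagonal entries agree; this
  forces \<open>\<xi> = 0\<close>.\<close>

lemma lie_algebra_eq_h_space: "lie_algebra H = h_space"
proof (intro equalityI subsetI)
  fix X assume X: "X \<in> lie_algebra H"
  have diag: "Y $ None $ None = Y $ Some None $ Some None" if Y: "Y \<in> lie_algebra H" for Y
  proof -
    obtain h x w c p where h: "h \<in> h_space" "Y = h + m_elt x w c p"
      using lie_su1n [OF Y] by (rule su1n_decomposition)
    have "x = 0 \<and> c = 0"
      using lie_algebra_splits(1) [of h x w c p] Y h by (intro lie_algebra_su11_trivial) simp
    moreover have "h $ None $ None = h $ Some None $ Some None"
      using h(1) unfolding h_space_eq by auto
    ultimately show ?thesis
      by (simp add: h(2))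
  qed
  obtain s :: "'w mat2" where s: "quarter_turn s"
    using quarter_turn_exists by blast
  obtain h x w c p where h: "h \<in> h_space" "X = h + m_elt x w c p"
    using lie_su1n [OF X] by (rule su1n_decomposition)
  have 1: "x = 0 \<and> c = 0"
    using lie_algebra_splits(1) [of h x w c p] X h by (intro lie_algebra_su11_trivial) simp
  have q: "m_elt 0 w 0 p \<in> lie_algebra H"
    using lie_algebra_splits(2) [of h x w c p] X h by simp
  have "conj_by s (m_elt 0 w 0 p) \<in> lie_algebra H"
    by (intro lie_algebra_Ad [OF H] quarter_turn_in s q)
  then have "m_elt 0 (\<i> *s w) 0 (\<i> *s p) \<in> lie_algebra H"
    by (simp add: quarter_turn_m [OF s])
  then have "bracket (m_elt 0 w 0 p) (m_elt 0 (\<i> *s w) 0 (\<i> *s p)) \<in> lie_algebra H"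
    by (rule lie_algebra_bracket [OF H q])
  then have "complex_of_real (2 * ((norm p)\<^sup>2 + (norm w)\<^sup>2)) * \<i> = 0"
    unfolding bracket_rotated [symmetric] by (simp add: diag)
  then have "(norm p)\<^sup>2 + (norm w)\<^sup>2 = 0"
    by (metis complex_i_not_zero mult_eq_0_iff of_real_eq_0_iff zero_neq_numeral)
  then have "p = 0 \<and> w = 0"
    by (simp add: add_nonneg_eq_0_iff)
  with 1 have "X = h"
    by (simp add: h(2) m_elt_0)
  then show "X \<in> h_space"
    using h(1) by simp
qed (rule h_space_lie)

end

end

section \<open>The normalizer of the isotropy algebra\<close>

lemma kmat_scalar: "kmat c (mat c) = mat c"
  by (auto simp: vec_eq_iff all_option mat_nth)

lemma z_elt_quadratic:
  fixes \<mu> :: complex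
  defines "\<mu> \<equiv> - (2 / of_nat CARD('w::finite)) * \<i>"
  shows "z_elt ** z_elt - mat (\<i> + \<mu>) ** z_elt + mat (\<i> * \<mu>) = (0 :: 'w mat2)"
proof -
  have z: "z_elt = (kmat \<i> (mat \<mu>) :: 'w mat2)"
    by (simp add: z_elt_eq \<mu>_def)
  show ?thesis
    unfolding z kmat_scalar [symmetric] kmat_mult mat_mult_mat kmat_diff kmat_add
    by (simp add: vec_eq_iff all_option mat_nth algebra_simps)
qed

text \<open>The vector \<open>g e\<^sub>0\<close> is negative, hence not in the positive definite span of the other basis vectors.\<close>

lemma SU1n_first_column_negative:
  assumes "g \<in> SU1n"
  shows "g $ None $ None \<noteq> 0"
proof
  assume 0: "g $ None $ None = 0"
  have "(cadj g ** form_J ** g) $ None $ None = - 1"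
    using assms by (simp add: SU1n_def)
  then have "(\<Sum>i\<in>UNIV. cnj (g $ Some i $ None) * g $ Some i $ None) = - 1"
    using 0 by (simp add: matrix_matrix_mult_def sum_option if_distrib if_distribR cong: if_cong)
  then have "Re (\<Sum>i\<in>UNIV. cnj (g $ Some i $ None) * g $ Some i $ None) = - 1"
    by simp
  moreover have "Re (\<Sum>i\<in>UNIV. cnj (g $ Some i $ None) * g $ Some i $ None) \<ge> 0"
    by (simp add: sum_nonneg)
  ultimately show False
    by simp
qed

text \<open>An element \<open>k\<close> normalizing \<open>h\<close> sends \<open>z\<close> to an element of \<open>h\<close> with the same quadratic equation.
  Since \<open>k\<^sup>-\<^sup>1 e\<^sub>0\<close> is negative, it is not in \<open>W\<close>, so \<open>e\<^sub>0\<close> is an eigenvector for the same eigenvalue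
  \<open>\<i>\<close>; the trace then determines the part on \<open>W\<close>.\<close>

lemma normalizer_centralizes_z:
  fixes k :: "'w::finite mat2"
  assumes k: "k \<in> SU1n" and h: "conj_by k z_elt \<in> h_space"
  shows "conj_by k z_elt = z_elt"
proof -
  define \<mu> :: complex where "\<mu> = - (2 / of_nat CARD('w)) * \<i>"
  have z: "z_elt = (kmat \<i> (mat \<mu>) :: 'w mat2)"
    by (simp add: z_elt_eq \<mu>_def)
  have tr_mu: "of_nat CARD('w) * \<mu> = - 2 * \<i>"
    by (simp add: \<mu>_def)
  have cmu: "cnj \<mu> = - \<mu>"
    by (simp add: \<mu>_def)
  note ki = SU1n_invertible [OF k]
  obtain \<alpha> S where T: "conj_by k z_elt = kmat \<alpha> S" and S: "S \<in> skew_hermitian" "2 * \<alpha> + trace S = 0"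
    using h unfolding h_space_eq by blast
  have \<alpha>: "\<alpha> = \<i>"
  proof -
    let ?g = "matrix_inv k"
    have "conj_by k z_elt ** k = k ** z_elt"
      by (simp add: conj_by_def matrix_mul_assoc [symmetric] matrix_inv_left_right [OF ki])
    then have "?g ** (kmat \<alpha> S ** k) ** ?g = ?g ** (k ** z_elt) ** ?g"
      by (simp add: T)
    moreover have "?g ** (kmat \<alpha> S ** k) ** ?g = ?g ** kmat \<alpha> S ** (k ** ?g)"
      by (simp only: matrix_mul_assoc)
    moreover have "?g ** (k ** z_elt) ** ?g = (?g ** k) ** z_elt ** ?g"
      by (simp only: matrix_mul_assoc)
    ultimately have "?g ** kmat \<alpha> S = z_elt ** ?g"
      by (simp add: matrix_inv_left_right [OF ki])
    then have "(?g ** kmat \<alpha> S) $ None $ None = (z_elt ** ?g) $ None $ None"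
      by simp
    then have "?g $ None $ None * \<alpha> = \<i> * ?g $ None $ None"
      by (simp add: z matrix_matrix_mult_def sum_option)
    then show ?thesis
      using SU1n_first_column_negative [OF SU1n_inv [OF k]] by simp
  qed
  have cm: "conj_by k (mat c) = mat c" for c
  proof -
    have "k ** mat c = mat c ** k"
      by (simp add: vec_eq_iff mat_mult_nth)
    then show ?thesis
      by (simp add: conj_by_def matrix_mul_assoc [symmetric] matrix_inv_left_right [OF ki])
  qed
  have "conj_by k (z_elt ** z_elt - mat (\<i> + \<mu>) ** z_elt + mat (\<i> * \<mu>)) = 0"
    using z_elt_quadratic [where 'w = 'w] by (simp add: \<mu>_def conj_by_0)
  then have "kmat \<alpha> S ** kmat \<alpha> S - mat (\<i> + \<mu>) ** kmat \<alpha> S + mat (\<i> * \<mu>) = 0"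
    unfolding conj_by_add conj_by_diff conj_by_matrix_mult [OF ki] cm T .
  then have "kmat (\<alpha> * \<alpha> - (\<i> + \<mu>) * \<alpha> + \<i> * \<mu>) (S ** S - mat (\<i> + \<mu>) ** S + mat (\<i> * \<mu>)) = kmat 0 0"
    unfolding kmat_scalar [symmetric] kmat_mult kmat_diff kmat_add
    by (simp add: vec_eq_iff all_option)
  then have SS: "S ** S - mat (\<i> + \<mu>) ** S + mat (\<i> * \<mu>) = 0"
    by (simp add: kmat_eq_iff)
  define E where "E = S - mat \<mu>"
  have SE: "S = E + mat \<mu>"
    by (simp add: E_def)
  have comm: "E ** mat c = mat c ** E" for c
    by (simp add: vec_eq_iff mat_mult_nth)
  have "S ** S - mat (\<i> + \<mu>) ** S + mat (\<i> * \<mu>) = E ** E - mat (\<i> - \<mu>) ** E"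
    unfolding SE
    by (simp add: matrix_ring_simps comm mat_mult_mat)
       (simp add: vec_eq_iff mat_mult_nth mat_nth algebra_simps)
  then have EE: "E ** E = mat (\<i> - \<mu>) ** E"
    using SS by simp
  have "trace E = 0"
    unfolding E_def trace_sub trace_mat tr_mu using S(2) by (simp add: \<alpha> add_eq_0_iff)
  moreover have "trace (mat c ** E) = c * trace E" for c
    by (simp add: trace_def mat_mult_nth sum_distrib_left)
  ultimately have "trace (E ** E) = 0"
    by (simp add: EE)
  moreover have "cadj E = - E"
    using S(1) by (simp add: E_def cadj_diff skew_hermitian_def cadj_mat cmu)
      (simp add: vec_eq_iff mat_nth)
  then have "complex_of_real ((norm E)\<^sup>2) = - trace (E ** E)"
    unfolding norm_matrix_square by (simp add: matrix_ring_simps trace_def sum_negf)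
  ultimately have "complex_of_real ((norm E)\<^sup>2) = 0"
    by simp
  then have "E = 0"
    by simp
  then have "conj_by k z_elt = kmat \<i> (mat \<mu>)"
    unfolding T by (simp add: \<alpha> E_def)
  then show ?thesis
    by (rule trans [OF _ z [symmetric]])
qed

definition block_diagonal :: "'w::finite mat2 \<Rightarrow> bool"
  where "block_diagonal X \<longleftrightarrow> (\<forall>i. X $ Some (Some i) $ None = 0 \<and> X $ Some (Some i) $ Some None = 0 \<and>
    X $ None $ Some (Some i) = 0 \<and> X $ Some None $ Some (Some i) = 0)"

text \<open>The plane of \<open>e\<^sub>0\<close>, \<open>e\<^sub>1\<close> and \<open>W\<close> are the eigenspaces of \<open>z\<close>, for distinct eigenvalues.\<close>

lemma centralizer_z_block_diagonal:
  fixes k :: "'w::finite mat2"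
  assumes "invertible k" "conj_by k z_elt = z_elt"
  shows "block_diagonal k"
proof -
  define \<mu> :: complex where "\<mu> = - (2 / of_nat CARD('w)) * \<i>"
  have z: "z_elt = (kmat \<i> (mat \<mu>) :: 'w mat2)"
    by (simp add: z_elt_eq \<mu>_def)
  have "Im \<mu> < 0"
    by (simp add: \<mu>_def)
  then have ne: "\<mu> \<noteq> \<i>"
    by auto
  have "k ** z_elt = conj_by k z_elt ** k"
    by (simp add: conj_by_def matrix_mul_assoc [symmetric] matrix_inv_left_right [OF assms(1)])
  then have c: "(k ** z_elt) $ i $ j = (z_elt ** k) $ i $ j" for i j
    by (simp add: assms(2))
  have s: "(\<Sum>j\<in>UNIV. f j * mat \<mu> $ j $ i) = f i * \<mu>" "(\<Sum>j\<in>UNIV. mat \<mu> $ i $ j * f j) = \<mu> * f i"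
    for f :: "'w \<Rightarrow> complex" and i
    by (simp_all add: mat_nth if_distrib if_distribR cong: if_cong)
  have eigen: "x * \<i> = \<mu> * x \<longleftrightarrow> x = 0" "x * \<mu> = \<i> * x \<longleftrightarrow> x = 0" for x
    using ne by (auto simp: mult.commute [of x])
  show ?thesis
    unfolding block_diagonal_def
    using c [of "Some (Some i)" None for i] c [of "Some (Some i)" "Some None" for i]
      c [of None "Some (Some i)" for i] c [of "Some None" "Some (Some i)" for i]
    by (simp add: z matrix_matrix_mult_def sum_option s eigen)
qed

lemma W_block_mult:
  "block_diagonal X \<Longrightarrow> W_block (X ** Y) = W_block X ** W_block Y"
  by (simp add: W_block_def block_diagonal_def vec_eq_iff matrix_matrix_mult_def sum_option)

lemma block_diagonal_unitary:
  assumes g: "g \<in> SU1n" and d: "block_diagonal g"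
  shows "W_block g \<in> unitary_group"
proof -
  have "(cadj g ** form_J ** g) $ Some (Some i) $ Some (Some j) = (if i = j then 1 else 0)" for i j
    using g by (simp add: SU1n_def)
  then have "(cadj (W_block g) ** W_block g) $ i $ j = mat 1 $ i $ j" for i j
    using d
    by (simp add: block_diagonal_def W_block_def matrix_matrix_mult_def sum_option mat_nth
        if_distrib if_distribR cong: if_cong)
  then show ?thesis
    by (simp add: unitary_group_def vec_eq_iff)
qed

section \<open>Minimality\<close>

lemma tendsto_lift:
  assumes "(f \<longlongrightarrow> mat 1) F"
  shows "((\<lambda>x. lift (f x)) \<longlongrightarrow> mat 1) F"
proof -
  have "((\<lambda>x. csqrt (inverse (det (f x)))) \<longlongrightarrow> csqrt (inverse (det (mat 1 :: complex^'b^'b)))) F"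
    by (intro isCont_tendsto_compose [OF continuous_at_csqrt] tendsto_intros assms) simp_all
  then have "((\<lambda>x. (\<lambda>(a, B). kmat a B) (csqrt (inverse (det (f x))), f x)) \<longlongrightarrow>
      (\<lambda>(a, B). kmat a B) (csqrt (inverse (det (mat 1 :: complex^'b^'b))), mat 1)) F"
    by (intro bounded_linear.tendsto [OF bounded_linear_kmat] tendsto_Pair assms)
  then show ?thesis
    by (simp add: lift_def kmat_1)
qed

text \<open>If the complement of \<open>K\<^sub>v\<close> in the overgroup accumulated at \<open>K\<^sub>v\<close>, it would contain a sequence
  tending to the identity. Correcting it by elements of \<open>K\<^sub>v\<close> we may assume that its members act
  trivially on \<open>W\<close>; a limit of their directions is then a tangent vector outside \<open>h\<close>.\<close>

lemma overgroup_eq_K_v: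
  fixes H :: "'w::finite mat2 set"
  assumes H: "cc_subgroup H" and K: "K_v \<subseteq> H" and lie: "lie_algebra H = h_space"
  shows "H = K_v"
proof (rule ccontr)
  assume ne: "H \<noteq> K_v"
  note cK = cc_subgroup_K_v
  have comp: "compact H" "compact (K_v :: 'w mat2 set)" and conn: "connected H"
    using H cK unfolding cc_subgroup_def by blast+
  \<comment> \<open>The group normalizes its Lie algebra, which is \<open>h\<close>.\<close>
  have bd: "block_diagonal g" if g: "g \<in> H" for g
  proof -
    have "z_elt \<in> (h_space :: 'w mat2 set)"
    proof -
      have "(0 :: 'w mat2) \<in> su_W" "z_elt \<in> real_line (z_elt :: 'w mat2)"
        using subspace_0 [OF subspace_su_W] by (auto simp: real_line_def intro: range_eqI [of _ _ 1])
      then have "0 + z_elt \<in> (h_space :: 'w mat2 set)"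
        unfolding h_space_def sum_spaces_2 by blast
      then show ?thesis
        by simp
    qed
    then have "conj_by g z_elt \<in> h_space"
      using lie_algebra_Ad [OF H g] unfolding lie by blast
    then have "conj_by g z_elt = z_elt"
      by (rule normalizer_centralizes_z [OF cc_subgroupD(1) [OF H g]])
    then show ?thesis
      by (rule centralizer_z_block_diagonal [OF cc_subgroupD(5) [OF H g]])
  qed
  have "\<not> closed (H - K_v)"
  proof
    assume "closed (H - K_v)"
    moreover have "closed (K_v :: 'w mat2 set)"
      using comp(2) by (rule compact_imp_closed)
    moreover have "K_v \<inter> H \<noteq> {}" "(H - K_v) \<inter> H \<noteq> {}"
      using K ne cc_subgroupD(2) [OF cK] by blast+
    moreover have "H \<subseteq> K_v \<union> (H - K_v)" "K_v \<inter> (H - K_v) \<inter> H = {}"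
      by blast+
    ultimately show False
      using conn unfolding connected_closed by blast
  qed
  then obtain x k where x: "\<And>n. x n \<in> H - K_v" "x \<longlonglongrightarrow> k" "k \<notin> H - K_v"
    unfolding closed_sequential_limits by blast
  have "k \<in> H"
    using x(1,2) compact_imp_closed [OF comp(1)] unfolding closed_sequential_limits by blast
  then have k: "k \<in> K_v"
    using x(3) by blast
  define g where "g n = matrix_inv k ** x n" for n
  note ki = cc_subgroupD(5) [OF cK k]
  have gH: "g n \<in> H" for n
    unfolding g_def using x(1) K cc_subgroupD(4) [OF cK k] by (intro cc_subgroupD(3) [OF H]) auto
  have gK: "g n \<notin> K_v" for n
  proof
    assume "g n \<in> K_v"
    then have "k ** g n \<in> K_v"
      by (rule cc_subgroupD(3) [OF cK k])
    then show False
      using x(1) [of n] by (simp add: g_def matrix_mul_assoc matrix_inv_left_right [OF ki])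
  qed
  have "g \<longlonglongrightarrow> matrix_inv k ** k"
    unfolding g_def by (intro tendsto_intros x)
  then have g1: "g \<longlonglongrightarrow> mat 1"
    by (simp add: matrix_inv_left_right [OF ki])
  have gU: "W_block (g n) \<in> unitary_group" for n
    by (rule block_diagonal_unitary [OF cc_subgroupD(1) [OF H gH] bd [OF gH]])
  define h where "h n = lift (cadj (W_block (g n)))" for n
  have hK: "h n \<in> K_v" for n
    unfolding h_def K_v_eq by (intro lift_in unitary_cadj gU)
  have h1: "h \<longlonglongrightarrow> mat 1"
  proof -
    have "(\<lambda>n. W_block (g n)) \<longlonglongrightarrow> W_block (mat 1)"
      unfolding W_block_def by (intro tendsto_intros g1)
    moreover have "W_block (mat 1) = (mat 1 :: complex^'w^'w)"
      using W_block_kmat [of 1 "mat 1"] by (simp add: kmat_1)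
    ultimately have "(\<lambda>n. W_block (g n)) \<longlonglongrightarrow> mat 1"
      by simp
    then have "(\<lambda>n. cadj (W_block (g n))) \<longlonglongrightarrow> cadj (mat 1)"
      by (rule tendsto_cadj)
    then show ?thesis
      unfolding h_def by (intro tendsto_lift) simp
  qed
  \<comment> \<open>Now \<open>a n\<close> is the identity on \<open>W\<close>, still outside \<open>K\<^sub>v\<close>, and tends to the identity.\<close>
  define a where "a n = g n ** h n" for n
  have aH: "a n \<in> H" for n
    unfolding a_def using gH hK K by (intro cc_subgroupD(3) [OF H]) auto
  have a1: "a \<longlonglongrightarrow> mat 1"
    using tendsto_matrix_mult [OF g1 h1] unfolding a_def by simp
  have a_ne: "a n \<noteq> mat 1" for n
  proof
    assume "a n = mat 1"
    then have "matrix_inv (g n) = h n"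
      unfolding a_def by (rule matrix_inv_unique)
    then have "g n = matrix_inv (h n)"
      using matrix_inv_inv [OF cc_subgroupD(5) [OF H gH]] by metis
    then show False
      using gK [of n] cc_subgroupD(4) [OF cK hK] by simp
  qed
  have aW: "W_block (a n) = mat 1" for n
    unfolding a_def W_block_mult [OF bd [OF gH]] h_def lift_def W_block_kmat
    by (rule unitary_right [OF gU])
  define e where "e n = norm (a n - mat 1)" for n
  define d where "d n = (1 / e n) *\<^sub>R (a n - mat 1)" for n
  have e: "e n > 0" for n
    using a_ne by (simp add: e_def)
  have e0: "e \<longlonglongrightarrow> 0"
    unfolding e_def using tendsto_norm [OF tendsto_diff [OF a1 tendsto_const [of "mat 1"]]] by simp
  have "d n \<in> sphere 0 1" for n
    using e [of n] by (simp add: d_def e_def)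
  then obtain y r where y: "y \<in> sphere 0 1" and r: "strict_mono r" "(d \<circ> r) \<longlonglongrightarrow> y"
    using compact_sphere [of "0 :: 'w mat2" 1] unfolding compact_def by blast
  have "y \<in> lie_algebra H"
  proof (rule tangent_direction_in_lie_algebra [OF H, of "a \<circ> r" "e \<circ> r"])
    show "(e \<circ> r) \<longlonglongrightarrow> 0"
      using LIMSEQ_subseq_LIMSEQ [OF e0 r(1)] .
    show "(\<lambda>n. (1 / (e \<circ> r) n) *\<^sub>R ((a \<circ> r) n - mat 1)) \<longlonglongrightarrow> y"
      using r(2) by (simp add: d_def o_def)
  qed (simp_all add: aH e)
  then obtain \<alpha> S where yk: "y = kmat \<alpha> S" "2 * \<alpha> + trace S = 0"
    unfolding lie h_space_eq by blast
  have "S $ i $ j = 0" for i j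
  proof -
    have "W_block (a n) $ i $ j = mat 1 $ i $ j" for n
      by (simp add: aW)
    then have "d n $ Some (Some i) $ Some (Some j) = 0" for n
      by (simp add: d_def W_block_def mat_nth)
    moreover have "(\<lambda>n. (d \<circ> r) n $ Some (Some i) $ Some (Some j)) \<longlonglongrightarrow> y $ Some (Some i) $ Some (Some j)"
      by (intro tendsto_intros r)
    ultimately have "(\<lambda>n. 0) \<longlonglongrightarrow> S $ i $ j"
      by (simp add: yk)
    then show ?thesis
      by (simp add: LIMSEQ_const_iff)
  qed
  then have "S = 0"
    by (simp add: vec_eq_iff)
  then have "y = 0"
    using yk by (simp add: trace_zero) (simp add: vec_eq_iff all_option)
  then show False
    using y by simp
qed

text \<open>An admissible overgroup has the same Lie algebra, and a connected overgroup with the same Lie algebra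
  is equal.\<close>

lemma minimal_admissible_K_v: "minimal_admissible (K_v :: 'w::finite mat2 set)"
  unfolding minimal_admissible_def
proof (intro conjI notI admissible_K_v)
  assume "\<exists>H :: 'w mat2 set. cc_subgroup H \<and> K_v \<subset> H \<and> admissible H"
  then obtain H :: "'w mat2 set" and b where H: "cc_subgroup H" "K_v \<subset> H" "invariant_lorentz_form H b"
    unfolding admissible_iff by blast
  then have "lie_algebra H = h_space"
    by (intro lie_algebra_eq_h_space) auto
  then have "H = K_v"
    using H by (intro overgroup_eq_K_v) auto
  then show False
    using H(2) by blast
qed

lemma m_elt_summands:
  "m_elt x 0 0 0 = x *\<^sub>R z'_elt" "m_elt 0 w 0 0 = n'_mat w" "m_elt 0 0 c 0 = Cv_mat c"
  "m_elt 0 0 0 p = p'_mat p"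
  by (simp_all add: vec_eq_iff all_option m_defs scaleR_complex_mult)

lemma z_elt_brackets:
  assumes "X \<in> su_W \<union> real_line z_elt \<union> real_line z'_elt \<union> range Cv_mat"
  shows "bracket z_elt X = (0 :: 'w::finite mat2)"
proof -
  have comm: "bracket z_elt (kmat a B) = 0" for a and B :: "complex^'w^'w"
    unfolding z_elt_eq bracket_def kmat_mult
    by (simp add: vec_eq_iff all_option mat_mult_nth)
  have zero: "bracket z_elt (m_elt x 0 c 0) = (0 :: 'w mat2)" for x c
    unfolding z_elt_eq bracket_def
    by (simp add: vec_eq_iff all_option matrix_matrix_mult_def sum_option)
  have z: "t *\<^sub>R z_elt = (kmat (t *\<^sub>R \<i>) (t *\<^sub>R mat (- (2 / of_nat CARD('w)) * \<i>)) :: 'w mat2)" for t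
    unfolding z_elt_eq kmat_scaleR ..
  consider B where "X = kmat 0 B" | t where "X = t *\<^sub>R z_elt" | x where "X = x *\<^sub>R z'_elt"
    | c where "X = Cv_mat c"
    using assms unfolding su_W_eq real_line_def by blast
  then show ?thesis
  proof cases
    case 1
    then show ?thesis
      by (simp only: comm)
  next
    case 2
    then show ?thesis
      by (simp only: z comm)
  next
    case 3
    then show ?thesis
      by (simp only: m_elt_summands(1) [symmetric] zero)
  next
    case 4
    then show ?thesis
      by (simp only: m_elt_summands(3) [symmetric] zero)
  qed
qed

lemma z_elt_on_n'_p':
  fixes w :: "complex^'w::finite"
  defines "c \<equiv> - (of_nat (CARD('w option) + 1) / of_nat (CARD('w option) - 1)) * \<i>"
  shows "bracket z_elt (n'_mat w) = n'_mat (c *s w)" "bracket z_elt (p'_mat w) = p'_mat (c *s w)"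
proof -
  define \<mu> :: complex where "\<mu> = - (2 / of_nat CARD('w)) * \<i>"
  have z: "z_elt = (kmat \<i> (mat \<mu>) :: 'w mat2)"
    by (simp add: z_elt_eq \<mu>_def)
  have c: "c = \<mu> - \<i>"
    by (simp add: c_def \<mu>_def field_simps)
  have cmu: "cnj \<mu> = - \<mu>"
    by (simp add: \<mu>_def)
  have s: "(\<Sum>j\<in>UNIV. f j * mat \<mu> $ j $ i) = f i * \<mu>" "(\<Sum>j\<in>UNIV. mat \<mu> $ i $ j * f j) = \<mu> * f i"
    "(\<Sum>j\<in>UNIV. f j * mat \<mu> $ i $ j) = \<mu> * f i" for f :: "'w \<Rightarrow> complex" and i
    by (simp_all add: mat_nth if_distrib if_distribR cong: if_cong)
  have m: "bracket z_elt (m_elt 0 w 0 p) = m_elt 0 (c *s w) 0 (c *s p)" for p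
    unfolding z bracket_def c
    by (simp add: vec_eq_iff all_option matrix_matrix_mult_def sum_option s cmu algebra_simps sum_negf)
  show "bracket z_elt (n'_mat w) = n'_mat (c *s w)"
    using m [of 0] by (simp add: m_elt_summands)
  have m': "bracket z_elt (m_elt 0 u 0 w) = m_elt 0 (c *s u) 0 (c *s w)" for u
    unfolding z bracket_def c
    by (simp add: vec_eq_iff all_option matrix_matrix_mult_def sum_option s cmu algebra_simps sum_negf)
  show "bracket z_elt (p'_mat w) = p'_mat (c *s w)"
    using m' [of 0] by (simp add: m_elt_summands)
qed

theorem proposition13:
  shows "minimal_admissible (K_v :: 'w::finite mat2 set) \<and> class_II (K_v :: 'w mat2 set) \<and>
    (\<forall>H :: 'w mat2 set. minimal_admissible H \<and> class_II H \<longrightarrow>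
       (\<exists>g\<in>SU1n. H = conj_by g ` K_v)) \<and>
    W_block_covering (K_v :: 'w mat2 set) \<and>
    lie_algebra K_v = (h_space :: 'w mat2 set) \<and>
    direct_sum_of h_space [su_W :: 'w mat2 set, real_line z_elt] \<and>
    direct_sum_of m_space
      [real_line (z'_elt :: 'w mat2), range n'_mat, range Cv_mat, range p'_mat] \<and>
    direct_sum_of su1n [h_space :: 'w mat2 set, m_space] \<and>
    (\<forall>k\<in>K_v. \<forall>X\<in>(m_space :: 'w mat2 set). conj_by k X \<in> m_space) \<and>
    (\<forall>X\<in>(su_W :: 'w mat2 set) \<union> real_line z_elt \<union> real_line z'_elt \<union> range Cv_mat.
       bracket z_elt X = 0) \<and>
    (let n = CARD('w option); c = - (of_nat (n + 1) / of_nat (n - 1)) * \<i> in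
       (\<forall>w :: complex^'w. bracket z_elt (n'_mat w) = n'_mat (c *s w)) \<and>
       (\<forall>w :: complex^'w. bracket z_elt (p'_mat w) = p'_mat (c *s w)))"
  unfolding Let_def
  by (intro conjI allI impI ballI minimal_admissible_K_v class_II_K_v W_block_covering_K_v
      lie_algebra_K_v direct_sum_h_space direct_sum_m_space direct_sum_su1n m_space_invariant
      z_elt_brackets z_elt_on_n'_p' minimal_class_II_conjugate)
    (auto intro: minimal_class_II_conjugate)

end
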